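(* Let $(M,\mathcal{A})$ be a supermanifold. For any graded linear connection $\overline{\nabla}$ on $(M,\mathcal{A})$, the map $\operatorname{div}_{\overline{\nabla}}:\operatorname{Der}\mathcal{A}\to\mathcal{A}$ defined by $$\operatorname{div}_{\overline{\nabla}}(D)=\operatorname{sTr}\bigl(\overline{\nabla}_D-\operatorname{ad}_D\bigr)$$ is a divergence operator.
   Context: $(M,\mathcal{A})$ is a (real, smooth) supermanifold of dimension $m|n$, $\operatorname{Der}\mathcal{A}$ is the sheaf of graded derivations of $\mathcal{A}$ (graded vector fields), $D(fg)=D(f)g+(-1)^{|D||f|}fD(g)$, and $[\cdot,\cdot]$ is the graded commutator. $|a|$ is the $\mathbb{Z}_2$-degree; formulas are for homogeneous elements and extended by linearity. A (left) graded linear connection on $(M,\mathcal{A})$ is a morphism of sheaves of graded vector spaces $\operatorname{Der}\mathcal{A}\otimes\operatorname{Der}\mathcal{A}\to\operatorname{Der}\mathcal{A}$, $D\otimes E\mapsto\overline{\nabla}_DE$ (so $|\overline{\nabla}_DE|=|D|+|E|$), with $\overline{\nabla}_{fD}E=f\overline{\nabla}_DE$ and $\overline{\nabla}_D(fE)=D(f)E+(-1)^{|D||f|}f\overline{\nabla}_DE$ for sections $f$ of $\mathcal{A}$. $\operatorname{ad}_D$ is the map $E\mapsto[D,E]$ on $\operatorname{Der}\mathcal{A}$. The map $F=\overline{\nabla}_D-\operatorname{ad}_D$ satisfies $F(fE)=(-1)^{|F||f|}fF(E)$ with $|F|=|D|$. $\operatorname{sTr}$ is the supertrace of such endomorphisms: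 in a local homogeneous basis $(e_a)$ of $\operatorname{Der}\mathcal{A}$, if $F(e_a)=\sum_bF_a^b\,e_b$, then $\operatorname{sTr}(F)=\sum_{|e_a|=0}F_a^a-\sum_{|e_a|=1}F_a^a$. A divergence operator on $\mathcal{A}$ is an even linear map (morphism of sheaves of vector spaces) $\operatorname{div}:\operatorname{Der}\mathcal{A}\to\mathcal{A}$ with $\operatorname{div}(fD)=f\operatorname{div}(D)+(-1)^{|f||D|}D(f)$. *)

theory Defs
  imports "HOL-Analysis.Analysis" "HOL-Algebra.Module" "HOL-Library.Z2"
begin

section \<open>Superalgebras and sheaves of superalgebras\<close>

text \<open>
  Parities are elements of \<^typ>\<open>bit\<close>, the field with two elements; \<open>psgn p\<close> is $(-1)^p$.
\<close>

definition psgn :: "bit \<Rightarrow> real"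
  where "psgn p = (if p = 0 then 1 else -1)"

definition real_field :: "real ring"
  where "real_field = \<lparr>carrier = UNIV, mult = (*), one = 1, zero = 0, add = (+)\<rparr>"

definition real_linear ::
    "(real, 'a, 'm) module_scheme \<Rightarrow> (real, 'b, 'n) module_scheme \<Rightarrow> ('a \<Rightarrow> 'b) \<Rightarrow> bool"
  where "real_linear X Y h \<longleftrightarrow>
    h \<in> carrier X \<rightarrow> carrier Y \<and>
    (\<forall>x\<in>carrier X. \<forall>y\<in>carrier X. h (x \<oplus>\<^bsub>X\<^esub> y) = h x \<oplus>\<^bsub>Y\<^esub> h y) \<and>
    (\<forall>c. \<forall>x\<in>carrier X. h (c \<odot>\<^bsub>X\<^esub> x) = c \<odot>\<^bsub>Y\<^esub> h x)"

text \<open>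
  The locale \<open>algebra\<close> of the library is not usable here, since it requires commutativity.
\<close>

definition superalgebra :: "(real, 'a) module \<Rightarrow> (bit \<Rightarrow> 'a set) \<Rightarrow> bool"
  where "superalgebra R G \<longleftrightarrow>
    ring R \<and> Module.module real_field R \<and>
    (\<forall>c. \<forall>x\<in>carrier R. \<forall>y\<in>carrier R.
       (c \<odot>\<^bsub>R\<^esub> x) \<otimes>\<^bsub>R\<^esub> y = c \<odot>\<^bsub>R\<^esub> (x \<otimes>\<^bsub>R\<^esub> y) \<and>
       x \<otimes>\<^bsub>R\<^esub> (c \<odot>\<^bsub>R\<^esub> y) = c \<odot>\<^bsub>R\<^esub> (x \<otimes>\<^bsub>R\<^esub> y)) \<and>
    (\<forall>p. submodule (G p) real_field R) \<and>
    G 0 \<inter> G 1 = {\<zero>\<^bsub>R\<^esub>} \<and>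
    (\<forall>x\<in>carrier R. \<exists>y\<in>G 0. \<exists>z\<in>G 1. x = y \<oplus>\<^bsub>R\<^esub> z) \<and>
    \<one>\<^bsub>R\<^esub> \<in> G 0 \<and>
    (\<forall>p q. \<forall>x\<in>G p. \<forall>y\<in>G q. x \<otimes>\<^bsub>R\<^esub> y \<in> G (p + q)) \<and>
    (\<forall>p q. \<forall>x\<in>G p. \<forall>y\<in>G q. y \<otimes>\<^bsub>R\<^esub> x = psgn (p * q) \<odot>\<^bsub>R\<^esub> (x \<otimes>\<^bsub>R\<^esub> y))"

text \<open>
  \<open>sec A U\<close> is the algebra of sections over \<open>U\<close>, \<open>par A U p\<close> its homogeneous part of degree \<open>p\<close>,
  and \<open>res A U V\<close> the restriction from \<open>U\<close> to \<open>V \<subseteq> U\<close>. Only open sets are relevant.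
\<close>

record ('x, 'a) superalgebra_sheaf =
  sec :: "'x set \<Rightarrow> (real, 'a) module"
  par :: "'x set \<Rightarrow> bit \<Rightarrow> 'a set"
  res :: "'x set \<Rightarrow> 'x set \<Rightarrow> 'a \<Rightarrow> 'a"

definition superalgebra_hom ::
    "(real, 'a) module \<Rightarrow> (bit \<Rightarrow> 'a set) \<Rightarrow> (real, 'b) module \<Rightarrow> (bit \<Rightarrow> 'b set) \<Rightarrow> ('a \<Rightarrow> 'b) \<Rightarrow> bool"
  where "superalgebra_hom R G S H h \<longleftrightarrow>
    h \<in> ring_hom R S \<and> real_linear R S h \<and> (\<forall>p. h ` G p \<subseteq> H p)"

definition is_superalgebra_sheaf :: "'x topology \<Rightarrow> ('x, 'a) superalgebra_sheaf \<Rightarrow> bool"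
  where "is_superalgebra_sheaf M A \<longleftrightarrow>
    (\<forall>U. openin M U \<longrightarrow> superalgebra (sec A U) (par A U)) \<and>
    (\<forall>U V. openin M U \<and> openin M V \<and> V \<subseteq> U \<longrightarrow>
       superalgebra_hom (sec A U) (par A U) (sec A V) (par A V) (res A U V)) \<and>
    (\<forall>U. openin M U \<longrightarrow> (\<forall>s\<in>carrier (sec A U). res A U U s = s)) \<and>
    (\<forall>U V W. openin M U \<and> openin M V \<and> openin M W \<and> W \<subseteq> V \<and> V \<subseteq> U \<longrightarrow>
       (\<forall>s\<in>carrier (sec A U). res A V W (res A U V s) = res A U W s)) \<and>
    (\<forall>\<U>. (\<forall>U\<in>\<U>. openin M U) \<longrightarrow>
       (\<forall>s. (\<forall>U\<in>\<U>. s U \<in> carrier (sec A U)) \<and>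
            (\<forall>U\<in>\<U>. \<forall>V\<in>\<U>. res A U (U \<inter> V) (s U) = res A V (U \<inter> V) (s V)) \<longrightarrow>
            (\<exists>!t. t \<in> carrier (sec A (\<Union>\<U>)) \<and> (\<forall>U\<in>\<U>. res A (\<Union>\<U>) U t = s U))))"


section \<open>The local model and supermanifolds\<close>

text \<open>
  Points of $\mathbb{R}^m$ are the elements of \<^term>\<open>topspace (Euclidean_space m)\<close>, i.e.\ sequences
  vanishing from index \<open>m\<close> on.
\<close>

definition partial :: "nat \<Rightarrow> ((nat \<Rightarrow> real) \<Rightarrow> real) \<Rightarrow> (nat \<Rightarrow> real) \<Rightarrow> real"
  where "partial i f x = deriv (\<lambda>t. f (x(i := t))) (x i)"

definition smooth_fun_on :: "nat \<Rightarrow> (nat \<Rightarrow> real) set \<Rightarrow> ((nat \<Rightarrow> real) \<Rightarrow> real) \<Rightarrow> bool"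
  where "smooth_fun_on m V f \<longleftrightarrow>
    (\<forall>is. set is \<subseteq> {..<m} \<longrightarrow>
       continuous_map (subtopology (Euclidean_space m) V) euclideanreal (foldr partial is f) \<and>
       (\<forall>i<m. \<forall>x\<in>V. (\<lambda>t. foldr partial is f (x(i := t))) differentiable (at (x i))))"

text \<open>
  A section of $C^\infty \otimes \Lambda(\mathbb{R}^n)$ over \<open>V\<close> is the family \<open>f\<close> of its coefficients with
  respect to $\theta_I = \theta_{i_1} \cdots \theta_{i_k}$, $I = \{i_1 < \cdots < i_k\} \subseteq \{0, \ldots, n-1\}$;
  coefficient functions are extended by 0 outside \<open>V\<close>.
  One has $\theta_I \theta_J = \pm \theta_{I \cup J}$ for disjoint \<open>I\<close>, \<open>J\<close>, the sign being \<open>ext_sign I J\<close>.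
\<close>

definition ext_sign :: "nat set \<Rightarrow> nat set \<Rightarrow> real"
  where "ext_sign I J = (-1) ^ card {(i, j). i \<in> I \<and> j \<in> J \<and> j < i}"

definition model_algebra ::
    "nat \<Rightarrow> nat \<Rightarrow> (nat \<Rightarrow> real) set \<Rightarrow> (real, nat set \<Rightarrow> (nat \<Rightarrow> real) \<Rightarrow> real) module"
  where "model_algebra m n V =
    \<lparr>carrier = {f. (\<forall>I. smooth_fun_on m V (f I)) \<and> (\<forall>I. \<not> I \<subseteq> {..<n} \<longrightarrow> f I = (\<lambda>_. 0)) \<and>
                   (\<forall>I x. x \<notin> V \<longrightarrow> f I x = 0)},
     mult = (\<lambda>f g K x. \<Sum>I\<in>Pow K. ext_sign I (K - I) * f I x * g (K - I) x),
     one = (\<lambda>I x. if I = {} \<and> x \<in> V then 1 else 0),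
     zero = (\<lambda>I x. 0),
     add = (\<lambda>f g I x. f I x + g I x),
     smult = (\<lambda>c f I x. c * f I x)\<rparr>"

definition model_sheaf ::
    "nat \<Rightarrow> nat \<Rightarrow> (nat \<Rightarrow> real, nat set \<Rightarrow> (nat \<Rightarrow> real) \<Rightarrow> real) superalgebra_sheaf"
  where "model_sheaf m n =
    \<lparr>sec = model_algebra m n,
     par = (\<lambda>V p. {f \<in> carrier (model_algebra m n V).
                     \<forall>I. f I \<noteq> (\<lambda>_. 0) \<longrightarrow> (of_nat (card I) :: bit) = p}),
     res = (\<lambda>V W f I x. if x \<in> W then f I x else 0)\<rparr>"

text \<open>
  A supermanifold of dimension $m|n$ is a Hausdorff, second countable space with a sheaf of
  superalgebras locally isomorphic to $C^\infty \otimes \Lambda(\mathbb{R}^n)$ on open subsets of $\mathbb{R}^m$.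
  The smooth structure of the underlying manifold is the one determined by the quotient of the
  structure sheaf by the ideal of nilpotents, so that it is not a separate datum.
\<close>

definition supermanifold :: "nat \<Rightarrow> nat \<Rightarrow> 'x topology \<Rightarrow> ('x, 'a) superalgebra_sheaf \<Rightarrow> bool"
  where "supermanifold m n M A \<longleftrightarrow>
    Hausdorff_space M \<and> second_countable M \<and> is_superalgebra_sheaf M A \<and>
    (\<forall>x\<in>topspace M. \<exists>U V \<phi> \<psi>.
       openin M U \<and> x \<in> U \<and> openin (Euclidean_space m) V \<and>
       homeomorphic_map (subtopology M U) (subtopology (Euclidean_space m) V) \<phi> \<and>
       (\<forall>W. openin M W \<and> W \<subseteq> U \<longrightarrow>
          superalgebra_hom (sec A W) (par A W)
            (sec (model_sheaf m n) (\<phi> ` W)) (par (model_sheaf m n) (\<phi> ` W)) (\<psi> W) \<and>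
          bij_betw (\<psi> W) (carrier (sec A W)) (carrier (sec (model_sheaf m n) (\<phi> ` W)))) \<and>
       (\<forall>W W'. openin M W \<and> openin M W' \<and> W' \<subseteq> W \<and> W \<subseteq> U \<longrightarrow>
          (\<forall>s\<in>carrier (sec A W).
             \<psi> W' (res A W W' s) = res (model_sheaf m n) (\<phi> ` W) (\<phi> ` W') (\<psi> W s))))"


section \<open>Graded vector fields\<close>

text \<open>
  A section of $\mathrm{Der}\,\mathcal{A}$ over \<open>U\<close> is a derivation of the sheaf $\mathcal{A}|_U$: a family \<open>D\<close> of maps
  \<open>D V\<close>, one for each open \<open>V \<subseteq> U\<close>, commuting with restrictions. Families and their members are
  \<^const>\<open>undefined\<close> outside their domains, so that equality of sections is equality in HOL.
\<close>

type_synonym ('x, 'a) vfield = "'x set \<Rightarrow> 'a \<Rightarrow> 'a"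

definition opens :: "'x topology \<Rightarrow> 'x set \<Rightarrow> 'x set set"
  where "opens M U = {V. openin M V \<and> V \<subseteq> U}"

definition hder ::
    "'x topology \<Rightarrow> ('x, 'a) superalgebra_sheaf \<Rightarrow> 'x set \<Rightarrow> bit \<Rightarrow> ('x, 'a) vfield set"
  where "hder M A U p = {D \<in> extensional (opens M U).
    (\<forall>V\<in>opens M U.
       D V \<in> extensional (carrier (sec A V)) \<and>
       real_linear (sec A V) (sec A V) (D V) \<and>
       (\<forall>q. \<forall>f\<in>par A V q. D V f \<in> par A V (p + q)) \<and>
       (\<forall>q. \<forall>f\<in>par A V q. \<forall>g\<in>carrier (sec A V).
          D V (f \<otimes>\<^bsub>sec A V\<^esub> g) =
            (D V f \<otimes>\<^bsub>sec A V\<^esub> g) \<oplus>\<^bsub>sec A V\<^esub>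
            (psgn (p * q) \<odot>\<^bsub>sec A V\<^esub> (f \<otimes>\<^bsub>sec A V\<^esub> D V g)))) \<and>
    (\<forall>V\<in>opens M U. \<forall>W\<in>opens M V. \<forall>f\<in>carrier (sec A V).
       res A V W (D V f) = D W (res A V W f))}"

definition vf_add ::
    "'x topology \<Rightarrow> ('x, 'a) superalgebra_sheaf \<Rightarrow> 'x set \<Rightarrow>
     ('x, 'a) vfield \<Rightarrow> ('x, 'a) vfield \<Rightarrow> ('x, 'a) vfield"
  where "vf_add M A U D E =
    (\<lambda>V\<in>opens M U. \<lambda>f\<in>carrier (sec A V). D V f \<oplus>\<^bsub>sec A V\<^esub> E V f)"

definition vf_zero :: "'x topology \<Rightarrow> ('x, 'a) superalgebra_sheaf \<Rightarrow> 'x set \<Rightarrow> ('x, 'a) vfield"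
  where "vf_zero M A U = (\<lambda>V\<in>opens M U. \<lambda>f\<in>carrier (sec A V). \<zero>\<^bsub>sec A V\<^esub>)"

definition vf_carrier :: "'x topology \<Rightarrow> ('x, 'a) superalgebra_sheaf \<Rightarrow> 'x set \<Rightarrow> ('x, 'a) vfield set"
  where "vf_carrier M A U = {vf_add M A U D E |D E. D \<in> hder M A U 0 \<and> E \<in> hder M A U 1}"

text \<open>
  $\mathrm{Der}\,\mathcal{A}(U)$ as a left module over $\mathcal{A}(U)$ (\<open>Der\<close>) and as a real vector space (\<open>Der_real\<close>);
  the ring fields \<^const>\<open>mult\<close> and \<^const>\<open>one\<close> of the record are irrelevant.
\<close>

definition Der ::
    "'x topology \<Rightarrow> ('x, 'a) superalgebra_sheaf \<Rightarrow> 'x set \<Rightarrow> ('a, ('x, 'a) vfield) module"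
  where "Der M A U =
    \<lparr>carrier = vf_carrier M A U, mult = undefined, one = undefined,
     zero = vf_zero M A U, add = vf_add M A U,
     smult = (\<lambda>g D. \<lambda>V\<in>opens M U. \<lambda>f\<in>carrier (sec A V). res A U V g \<otimes>\<^bsub>sec A V\<^esub> D V f)\<rparr>"

definition Der_real ::
    "'x topology \<Rightarrow> ('x, 'a) superalgebra_sheaf \<Rightarrow> 'x set \<Rightarrow> (real, ('x, 'a) vfield) module"
  where "Der_real M A U =
    \<lparr>carrier = vf_carrier M A U, mult = undefined, one = undefined,
     zero = vf_zero M A U, add = vf_add M A U,
     smult = (\<lambda>c D. \<lambda>V\<in>opens M U. \<lambda>f\<in>carrier (sec A V). c \<odot>\<^bsub>sec A V\<^esub> D V f)\<rparr>"

definition vf_res :: "'x topology \<Rightarrow> 'x set \<Rightarrow> ('x, 'a) vfield \<Rightarrow> ('x, 'a) vfield"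
  where "vf_res M W D = (\<lambda>V\<in>opens M W. D V)"

definition vf_part ::
    "'x topology \<Rightarrow> ('x, 'a) superalgebra_sheaf \<Rightarrow> 'x set \<Rightarrow> bit \<Rightarrow> ('x, 'a) vfield \<Rightarrow> ('x, 'a) vfield"
  where "vf_part M A U p D =
    (THE E. E \<in> hder M A U p \<and> (\<exists>E'\<in>hder M A U (p + 1). D = vf_add M A U E E'))"

text \<open>
  The graded commutator $[D,E] = D E - (-1)^{|D||E|} E D$, extended bilinearly:
  $[D,E] = \sum_{p,q} (D_p E_q - (-1)^{pq} E_q D_p)$ with homogeneous components $D_p$, $E_q$.
\<close>

definition bracket ::
    "'x topology \<Rightarrow> ('x, 'a) superalgebra_sheaf \<Rightarrow> 'x set \<Rightarrow>
     ('x, 'a) vfield \<Rightarrow> ('x, 'a) vfield \<Rightarrow> ('x, 'a) vfield"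
  where "bracket M A U D E =
    (\<lambda>V\<in>opens M U. \<lambda>f\<in>carrier (sec A V).
       \<Oplus>\<^bsub>sec A V\<^esub>p\<in>{0, 1}. \<Oplus>\<^bsub>sec A V\<^esub>q\<in>{0, 1}.
         vf_part M A U p D V (vf_part M A U q E V f) \<ominus>\<^bsub>sec A V\<^esub>
         (psgn (p * q) \<odot>\<^bsub>sec A V\<^esub> vf_part M A U q E V (vf_part M A U p D V f)))"


section \<open>Graded connections and divergence operators\<close>

text \<open>
  A morphism of sheaves out of the tensor product over the reals is a family of bilinear maps
  commuting with restrictions.
\<close>

definition graded_connection ::
    "'x topology \<Rightarrow> ('x, 'a) superalgebra_sheaf \<Rightarrow>
     ('x set \<Rightarrow> ('x, 'a) vfield \<Rightarrow> ('x, 'a) vfield \<Rightarrow> ('x, 'a) vfield) \<Rightarrow> bool"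
  where "graded_connection M A nabla \<longleftrightarrow>
    (\<forall>U. openin M U \<longrightarrow>
       (\<forall>D\<in>carrier (Der M A U). real_linear (Der_real M A U) (Der_real M A U) (nabla U D)) \<and>
       (\<forall>E\<in>carrier (Der M A U). real_linear (Der_real M A U) (Der_real M A U) (\<lambda>D. nabla U D E)) \<and>
       (\<forall>p q. \<forall>D\<in>hder M A U p. \<forall>E\<in>hder M A U q. nabla U D E \<in> hder M A U (p + q)) \<and>
       (\<forall>f\<in>carrier (sec A U). \<forall>D\<in>carrier (Der M A U). \<forall>E\<in>carrier (Der M A U).
          nabla U (f \<odot>\<^bsub>Der M A U\<^esub> D) E = f \<odot>\<^bsub>Der M A U\<^esub> nabla U D E) \<and>
       (\<forall>p q. \<forall>f\<in>par A U q. \<forall>D\<in>hder M A U p. \<forall>E\<in>carrier (Der M A U).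
          nabla U D (f \<odot>\<^bsub>Der M A U\<^esub> E) =
            (D U f \<odot>\<^bsub>Der M A U\<^esub> E) \<oplus>\<^bsub>Der M A U\<^esub>
            ((psgn (p * q) \<odot>\<^bsub>sec A U\<^esub> f) \<odot>\<^bsub>Der M A U\<^esub> nabla U D E))) \<and>
    (\<forall>U V. openin M U \<and> openin M V \<and> V \<subseteq> U \<longrightarrow>
       (\<forall>D\<in>carrier (Der M A U). \<forall>E\<in>carrier (Der M A U).
          vf_res M V (nabla U D E) = nabla V (vf_res M V D) (vf_res M V E)))"

definition divergence_operator ::
    "'x topology \<Rightarrow> ('x, 'a) superalgebra_sheaf \<Rightarrow> ('x set \<Rightarrow> ('x, 'a) vfield \<Rightarrow> 'a) \<Rightarrow> bool"
  where "divergence_operator M A dv \<longleftrightarrow>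
    (\<forall>U. openin M U \<longrightarrow>
       real_linear (Der_real M A U) (sec A U) (dv U) \<and>
       (\<forall>p. \<forall>D\<in>hder M A U p. dv U D \<in> par A U p) \<and>
       (\<forall>p q. \<forall>f\<in>par A U q. \<forall>D\<in>hder M A U p.
          dv U (f \<odot>\<^bsub>Der M A U\<^esub> D) =
            (f \<otimes>\<^bsub>sec A U\<^esub> dv U D) \<oplus>\<^bsub>sec A U\<^esub> (psgn (q * p) \<odot>\<^bsub>sec A U\<^esub> D U f))) \<and>
    (\<forall>U V. openin M U \<and> openin M V \<and> V \<subseteq> U \<longrightarrow>
       (\<forall>D\<in>carrier (Der M A U). res A U V (dv U D) = dv V (vf_res M V D)))"


section \<open>Supertrace\<close>

definition is_coords ::
    "'x topology \<Rightarrow> ('x, 'a) superalgebra_sheaf \<Rightarrow> 'x set \<Rightarrow> nat \<Rightarrow> (nat \<Rightarrow> ('x, 'a) vfield) \<Rightarrow>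
     ('x, 'a) vfield \<Rightarrow> (nat \<Rightarrow> 'a) \<Rightarrow> bool"
  where "is_coords M A W k e E c \<longleftrightarrow>
    c \<in> {..<k} \<rightarrow>\<^sub>E carrier (sec A W) \<and>
    E = (\<Oplus>\<^bsub>Der M A W\<^esub>b\<in>{..<k}. c b \<odot>\<^bsub>Der M A W\<^esub> vf_res M W (e b))"

text \<open>
  A homogeneous basis over \<open>V\<close> of the sheaf of left modules $\mathrm{Der}\,\mathcal{A}$, with \<open>p a\<close> the parity of \<open>e a\<close>.
\<close>

definition homogeneous_basis ::
    "'x topology \<Rightarrow> ('x, 'a) superalgebra_sheaf \<Rightarrow> 'x set \<Rightarrow> nat \<Rightarrow> (nat \<Rightarrow> bit) \<Rightarrow>
     (nat \<Rightarrow> ('x, 'a) vfield) \<Rightarrow> bool"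
  where "homogeneous_basis M A V k p e \<longleftrightarrow>
    (\<forall>a<k. e a \<in> hder M A V (p a)) \<and>
    (\<forall>W\<in>opens M V. \<forall>E\<in>carrier (Der M A W). \<exists>!c. is_coords M A W k e E c)"

definition coords ::
    "'x topology \<Rightarrow> ('x, 'a) superalgebra_sheaf \<Rightarrow> 'x set \<Rightarrow> nat \<Rightarrow> (nat \<Rightarrow> ('x, 'a) vfield) \<Rightarrow>
     ('x, 'a) vfield \<Rightarrow> nat \<Rightarrow> 'a"
  where "coords M A V k e E = (THE c. is_coords M A V k e E c)"

definition basis_supertrace ::
    "'x topology \<Rightarrow> ('x, 'a) superalgebra_sheaf \<Rightarrow> 'x set \<Rightarrow> nat \<Rightarrow> (nat \<Rightarrow> bit) \<Rightarrow>
     (nat \<Rightarrow> ('x, 'a) vfield) \<Rightarrow> (('x, 'a) vfield \<Rightarrow> ('x, 'a) vfield) \<Rightarrow> 'a"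
  where "basis_supertrace M A V k p e F =
    (\<Oplus>\<^bsub>sec A V\<^esub>a\<in>{a. a < k \<and> p a = 0}. coords M A V k e (F (e a)) a) \<ominus>\<^bsub>sec A V\<^esub>
    (\<Oplus>\<^bsub>sec A V\<^esub>a\<in>{a. a < k \<and> p a = 1}. coords M A V k e (F (e a)) a)"

text \<open>
  \<open>F\<close> is an endomorphism of the sheaf $\mathrm{Der}\,\mathcal{A}|_U$, given by its maps \<open>F V\<close> for open \<open>V \<subseteq> U\<close>. Homogeneous
  bases of $\mathrm{Der}\,\mathcal{A}$ exist only locally, so the supertrace is the section over \<open>U\<close> that has the
  usual expression in every local homogeneous basis.
\<close>

definition supertrace ::
    "'x topology \<Rightarrow> ('x, 'a) superalgebra_sheaf \<Rightarrow> 'x set \<Rightarrow>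
     ('x set \<Rightarrow> ('x, 'a) vfield \<Rightarrow> ('x, 'a) vfield) \<Rightarrow> 'a"
  where "supertrace M A U F =
    (THE s. s \<in> carrier (sec A U) \<and>
       (\<forall>V\<in>opens M U. \<forall>k p e. homogeneous_basis M A V k p e \<longrightarrow>
          res A U V s = basis_supertrace M A V k p e (F V)))"

definition ad ::
    "'x topology \<Rightarrow> ('x, 'a) superalgebra_sheaf \<Rightarrow> ('x, 'a) vfield \<Rightarrow>
     'x set \<Rightarrow> ('x, 'a) vfield \<Rightarrow> ('x, 'a) vfield"
  where "ad M A D V E = bracket M A V (vf_res M V D) E"

definition div_connection ::
    "'x topology \<Rightarrow> ('x, 'a) superalgebra_sheaf \<Rightarrow>
     ('x set \<Rightarrow> ('x, 'a) vfield \<Rightarrow> ('x, 'a) vfield \<Rightarrow> ('x, 'a) vfield) \<Rightarrow>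
     'x set \<Rightarrow> ('x, 'a) vfield \<Rightarrow> 'a"
  where "div_connection M A nabla U D =
    supertrace M A U (\<lambda>V E. nabla V (vf_res M V D) E \<ominus>\<^bsub>Der M A V\<^esub> ad M A D V E)"

end

theory Submission
  imports Defs
begin

text \<open>
  The map $F = \nabla_D - \mathrm{ad}_D$ is graded $\mathcal{A}$-linear, since both terms have the same Leibniz
  rule. The supertrace of a homogeneous graded linear map does not depend on the homogeneous basis
  in which it is computed, also when the map is odd, so that the local values glue to a section as
  soon as every point has a neighbourhood with a homogeneous basis. The coordinate fields of a chart
  are such a basis: by Hadamard's lemma, a derivation that annihilates the coordinates vanishes at
  every point. Finally, replacing $D$ by $fD$ changes $F(E)$ into
  $f F(E) + (-1)^{(|f|+|D|)|E|} E(f) D$, and the additional term has supertrace $(-1)^{|f||D|} D(f)$.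
\<close>

text \<open>Two points need an argument of their own. First, a vector field is a family of maps over
  all smaller open sets, compatible with restriction, so whether it vanishes can be tested on
  arbitrarily small cubes of a chart. To get vanishing at a point y, write h = h' + z g on a cube
  centred at y, with z = x_i - y_i and h' the function h frozen in the i-th coordinate. A derivation
  d with d(z) = 0 gives d(z g) = z d(g), and z annihilates every exterior coefficient at y,
  nilpotent ones included. Model sections are families of genuine functions, so this pointwise
  information is complete. Second, the sign of the additional term is uniform in the basis. With D =
  sum_a D^a e_a, its a-th diagonal entry is (-1)^{(|f|+|D|)|e_a|} e_a(f) D^a. Reordering to D^a
  e_a(f) costs (-1)^{(|D|+|e_a|)(|e_a|+|f|)}, and the supertrace contributes (-1)^{|e_a|}. In the
  product |e_a| drops out, and sum_a D^a e_a(f) is D(f).\<close>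

section \<open>Superalgebras and their sheaves\<close>

text \<open>These rules turn sums and products of parities into bit operations.\<close>

declare add_bit_eq_xor [simp del] mult_bit_eq_and [simp del]

lemma psgn_simps [simp]: "psgn 0 = 1" "psgn 1 = -1" "psgn p * psgn p = 1"
  by (auto simp: psgn_def)

lemma psgn_add: "psgn (p + q) = psgn p * psgn q"
  by (cases p; cases q) auto

lemma psgn_mult_self [simp]: "psgn p * (psgn p * x) = x"
  by (simp add: psgn_def)

lemma bit_add_self [simp]: "(p::bit) + p = 0" "p + (p + q) = q"
  by (cases p; simp; fail) (cases p; cases q; simp)

section \<open>Homogeneous parts and signs in a single superalgebra\<close>

locale superalg =
  fixes R :: "(real, 'a) module" (structure) and G :: "bit \<Rightarrow> 'a set"
  assumes superalgebra: "superalgebra R G"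
begin

sublocale ring R
  using superalgebra by (simp add: superalgebra_def)

lemma real_module: "Module.module real_field R"
  using superalgebra by (simp add: superalgebra_def)

lemma smult_closed [simp, intro]: "x \<in> carrier R \<Longrightarrow> c \<odot> x \<in> carrier R"
  using module.smult_closed[OF real_module] by (simp add: real_field_def)

lemma smult_smult [simp]: "x \<in> carrier R \<Longrightarrow> c \<odot> (d \<odot> x) = (c * d) \<odot> x"
  using module.smult_assoc1[OF real_module] by (simp add: real_field_def)

lemma smult_one [simp]: "x \<in> carrier R \<Longrightarrow> 1 \<odot> x = x"
  using module.smult_one[OF real_module] by (simp add: real_field_def)

lemma smult_add: "x \<in> carrier R \<Longrightarrow> y \<in> carrier R \<Longrightarrow> c \<odot> (x \<oplus> y) = c \<odot> x \<oplus> c \<odot> y"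
  using module.smult_r_distr[OF real_module] by (simp add: real_field_def)

lemma add_smult: "x \<in> carrier R \<Longrightarrow> (c + d) \<odot> x = c \<odot> x \<oplus> d \<odot> x"
  using module.smult_l_distr[OF real_module] by (simp add: real_field_def)

lemma smult_zero_left [simp]: "x \<in> carrier R \<Longrightarrow> 0 \<odot> x = \<zero>"
  using module.smult_l_null[OF real_module] by (simp add: real_field_def)

lemma smult_zero_right [simp]: "c \<odot> \<zero> = \<zero>"
  using module.smult_r_null[OF real_module] by (simp add: real_field_def)

text \<open>Writing negation as scaling by -1 puts it on the same footing as the Koszul signs
  \<open>psgn\<close>, so that one set of rewrite rules normalises both.\<close>

lemma minus_conv: "x \<in> carrier R \<Longrightarrow> \<ominus> x = (-1) \<odot> x"
proof -
  assume x: "x \<in> carrier R"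
  have "(-1) \<odot> x \<oplus> x = ((-1) + 1) \<odot> x"
    using x by (simp only: add_smult smult_one)
  then show ?thesis using x by (simp add: minus_equality)
qed

lemma diff_conv: "x \<in> carrier R \<Longrightarrow> y \<in> carrier R \<Longrightarrow> x \<ominus> y = x \<oplus> (-1) \<odot> y"
  by (simp add: a_minus_def minus_conv)

lemma add_minus_self [simp]: "x \<in> carrier R \<Longrightarrow> x \<oplus> (-1) \<odot> x = \<zero>"
  by (metis minus_conv r_neg)

lemma smult_mult_left [simp]:
  "x \<in> carrier R \<Longrightarrow> y \<in> carrier R \<Longrightarrow> (c \<odot> x) \<otimes> y = c \<odot> (x \<otimes> y)"
  using superalgebra by (simp add: superalgebra_def)

lemma smult_mult_right [simp]:
  "x \<in> carrier R \<Longrightarrow> y \<in> carrier R \<Longrightarrow> x \<otimes> (c \<odot> y) = c \<odot> (x \<otimes> y)"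
  using superalgebra by (simp add: superalgebra_def)

lemma par_submodule: "submodule (G p) real_field R"
  using superalgebra by (simp add: superalgebra_def)

lemma par_closed: "x \<in> G p \<Longrightarrow> x \<in> carrier R"
  using subgroup.subset[OF submodule.axioms(1)[OF par_submodule]] by auto

lemma par_add: "x \<in> G p \<Longrightarrow> y \<in> G p \<Longrightarrow> x \<oplus> y \<in> G p"
  using subgroup.m_closed[OF submodule.axioms(1)[OF par_submodule]] by auto

lemma par_zero [simp]: "\<zero> \<in> G p"
  using subgroup.one_closed[OF submodule.axioms(1)[OF par_submodule]] by auto

lemma par_smult: "x \<in> G p \<Longrightarrow> c \<odot> x \<in> G p"
  using submodule.smult_closed[OF par_submodule] by (auto simp: real_field_def)

lemma par_mult: "x \<in> G p \<Longrightarrow> y \<in> G q \<Longrightarrow> x \<otimes> y \<in> G (p + q)"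
  using superalgebra unfolding superalgebra_def by blast

lemma par_commute: "x \<in> G p \<Longrightarrow> y \<in> G q \<Longrightarrow> y \<otimes> x = psgn (p * q) \<odot> (x \<otimes> y)"
  using superalgebra unfolding superalgebra_def by blast

lemma par_finsum: "(\<And>i. i \<in> I \<Longrightarrow> f i \<in> G p) \<Longrightarrow> finsum R f I \<in> G p"
proof (induction I rule: infinite_finite_induct)
  case (insert i I)
  then have "finsum R f (insert i I) = f i \<oplus> finsum R f I"
    by (intro finsum_insert) (auto intro: par_closed)
  with insert show ?case by (auto intro: par_add)
qed (auto simp: finsum_infinite)

lemma par_disjoint: "x \<in> G p \<Longrightarrow> x \<in> G (p + 1) \<Longrightarrow> x = \<zero>"
  using superalgebra by (cases p) (auto simp: superalgebra_def)

lemma par_decompose: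
  assumes "x \<in> carrier R"
  obtains y z where "y \<in> G p" "z \<in> G (p + 1)" "x = y \<oplus> z"
proof -
  obtain a b where ab: "a \<in> G 0" "b \<in> G 1" "x = a \<oplus> b"
    using superalgebra assms unfolding superalgebra_def by meson
  then have "x = b \<oplus> a" by (simp add: a_comm par_closed)
  with ab that show thesis by (cases p) auto
qed

text \<open>The equation y = -z places y in both homogeneous parts, which meet only in zero.\<close>

lemma par_sum_zero:
  assumes "y \<in> G p" "z \<in> G (p + 1)" "y \<oplus> z = \<zero>"
  shows "y = \<zero>" "z = \<zero>"
proof -
  have c: "y \<in> carrier R" "z \<in> carrier R" using assms par_closed by auto
  then have "y = (-1) \<odot> z" using assms(3) by (metis minus_conv minus_equality)
  then have "y \<in> G (p + 1)" using assms by (simp add: par_smult)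
  with assms show "y = \<zero>" by (auto intro: par_disjoint)
  with assms c show "z = \<zero>" by simp
qed

text \<open>The differences of corresponding components are homogeneous of opposite parities and add
  up to zero.\<close>

lemma par_decompose_unique:
  assumes "y \<in> G p" "z \<in> G (p + 1)" "y' \<in> G p" "z' \<in> G (p + 1)" "y \<oplus> z = y' \<oplus> z'"
  shows "y = y'" "z = z'"
proof -
  have c: "y \<in> carrier R" "z \<in> carrier R" "y' \<in> carrier R" "z' \<in> carrier R"
    using assms par_closed by auto
  have "(y \<ominus> y') \<oplus> (z \<ominus> z') = (y \<oplus> z) \<ominus> (y' \<oplus> z')"
    using c by (simp add: a_minus_def minus_add a_ac)
  also have "\<dots> = \<zero>" using c assms(5) by (simp add: a_minus_def r_neg)
  finally have *: "(y \<ominus> y') \<oplus> (z \<ominus> z') = \<zero>" .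
  have "y \<ominus> y' \<in> G p" "z \<ominus> z' \<in> G (p + 1)"
    using assms c by (simp_all add: diff_conv par_add par_smult)
  from par_sum_zero[OF this *] show "y = y'" "z = z'"
    using c minus_equality[of y "\<ominus> y'"] minus_equality[of z "\<ominus> z'"] by (auto simp: minus_eq)
qed

lemma smult_finsum:
  "(\<And>i. i \<in> I \<Longrightarrow> f i \<in> carrier R) \<Longrightarrow> c \<odot> finsum R f I = finsum R (\<lambda>i. c \<odot> f i) I"
proof (induction I rule: infinite_finite_induct)
  case (insert i I)
  then show ?case by (simp add: finsum_insert Pi_def smult_add finsum_closed)
qed (auto simp: finsum_infinite)

end

text \<open>Assumes additivity alone, so that it covers restrictions, coordinate functions and
  graded linear maps, which are linear over different scalars or only up to sign.\<close>

lemma additive_finsum: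
  assumes R: "abelian_group R" "abelian_group S" and h: "h \<in> carrier R \<rightarrow> carrier S"
    and add: "\<And>x y. x \<in> carrier R \<Longrightarrow> y \<in> carrier R \<Longrightarrow> h (x \<oplus>\<^bsub>R\<^esub> y) = h x \<oplus>\<^bsub>S\<^esub> h y"
    and f: "\<And>i. i \<in> I \<Longrightarrow> f i \<in> carrier R" and fin: "finite I"
  shows "h (finsum R f I) = finsum S (\<lambda>i. h (f i)) I"
  using fin f
proof (induction I rule: finite_induct)
  case empty
  interpret R: abelian_group R by fact
  interpret S: abelian_group S by fact
  \<comment> \<open>Preservation of zero is derived: the image of zero equals its own double, hence
    vanishes by cancellation.\<close>
  have "h \<zero>\<^bsub>R\<^esub> \<oplus>\<^bsub>S\<^esub> h \<zero>\<^bsub>R\<^esub> = h \<zero>\<^bsub>R\<^esub>"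
    using add[of "\<zero>\<^bsub>R\<^esub>" "\<zero>\<^bsub>R\<^esub>"] by simp
  moreover have "h \<zero>\<^bsub>R\<^esub> \<in> carrier S" using h by auto
  ultimately show ?case by (simp add: S.add.r_cancel_one')
next
  case (insert i I)
  interpret R: abelian_group R by fact
  interpret S: abelian_group S by fact
  have "finsum R f I \<in> carrier R" using insert by (intro R.finsum_closed) auto
  moreover have "finsum S (\<lambda>i. h (f i)) (insert i I) = h (f i) \<oplus>\<^bsub>S\<^esub> finsum S (\<lambda>i. h (f i)) I"
    using insert h by (intro S.finsum_insert) auto
  moreover have "finsum R f (insert i I) = f i \<oplus>\<^bsub>R\<^esub> finsum R f I"
    using insert by (intro R.finsum_insert) auto
  ultimately show ?case using insert add by auto
qed

lemma real_linear_zero: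
  assumes "abelian_group R" "abelian_group S" "real_linear R S h"
  shows "h \<zero>\<^bsub>R\<^esub> = \<zero>\<^bsub>S\<^esub>"
proof -
  interpret R: abelian_group R by fact
  interpret S: abelian_group S by fact
  show ?thesis
    using additive_finsum[OF assms(1,2), of h "{}"] assms(3) by (simp add: real_linear_def)
qed

lemma opens_trans: "V \<in> opens M U \<Longrightarrow> W \<in> opens M V \<Longrightarrow> W \<in> opens M U"
  by (auto simp: opens_def)

lemma opens_self [simp]: "openin M U \<Longrightarrow> U \<in> opens M U"
  by (auto simp: opens_def)

section \<open>Restriction maps and gluing in a sheaf of superalgebras\<close>

locale superalg_sheaf =
  fixes M :: "'x topology" and A :: "('x, 'a) superalgebra_sheaf"
  assumes sheaf: "is_superalgebra_sheaf M A"
begin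

lemma superalg: "V \<in> opens M U \<Longrightarrow> superalg (sec A V) (par A V)"
  using sheaf by (auto simp: is_superalgebra_sheaf_def opens_def superalg_def)

lemma superalg': "openin M V \<Longrightarrow> superalg (sec A V) (par A V)"
  using sheaf by (auto simp: is_superalgebra_sheaf_def opens_def superalg_def)

lemma res_hom:
  "V \<in> opens M U \<Longrightarrow> W \<in> opens M V \<Longrightarrow> superalgebra_hom (sec A V) (par A V) (sec A W) (par A W) (res A V W)"
  using sheaf by (auto simp: is_superalgebra_sheaf_def opens_def)

lemma res_hom':
  "openin M V \<Longrightarrow> W \<in> opens M V \<Longrightarrow> superalgebra_hom (sec A V) (par A V) (sec A W) (par A W) (res A V W)"
  using res_hom[OF opens_self] .

context
  fixes V W assumes V: "openin M V" and W: "W \<in> opens M V"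
begin

lemma res_closed: "f \<in> carrier (sec A V) \<Longrightarrow> res A V W f \<in> carrier (sec A W)"
  using res_hom'[OF V W] by (auto simp: superalgebra_hom_def ring_hom_def)

lemma res_linear: "real_linear (sec A V) (sec A W) (res A V W)"
  using res_hom'[OF V W] by (auto simp: superalgebra_hom_def)

lemma res_add: "f \<in> carrier (sec A V) \<Longrightarrow> g \<in> carrier (sec A V) \<Longrightarrow>
    res A V W (f \<oplus>\<^bsub>sec A V\<^esub> g) = res A V W f \<oplus>\<^bsub>sec A W\<^esub> res A V W g"
  using res_hom'[OF V W] by (auto simp: superalgebra_hom_def ring_hom_def)

lemma res_mult: "f \<in> carrier (sec A V) \<Longrightarrow> g \<in> carrier (sec A V) \<Longrightarrow>
    res A V W (f \<otimes>\<^bsub>sec A V\<^esub> g) = res A V W f \<otimes>\<^bsub>sec A W\<^esub> res A V W g"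
  using res_hom'[OF V W] by (auto simp: superalgebra_hom_def ring_hom_def)

lemma res_one: "res A V W \<one>\<^bsub>sec A V\<^esub> = \<one>\<^bsub>sec A W\<^esub>"
  using res_hom'[OF V W] by (auto simp: superalgebra_hom_def ring_hom_def)

lemma res_smult: "f \<in> carrier (sec A V) \<Longrightarrow>
    res A V W (c \<odot>\<^bsub>sec A V\<^esub> f) = c \<odot>\<^bsub>sec A W\<^esub> res A V W f"
  using res_hom'[OF V W] by (auto simp: superalgebra_hom_def real_linear_def)

lemma res_par: "f \<in> par A V p \<Longrightarrow> res A V W f \<in> par A W p"
  using res_hom'[OF V W] by (auto simp: superalgebra_hom_def)

lemma res_zero: "res A V W \<zero>\<^bsub>sec A V\<^esub> = \<zero>\<^bsub>sec A W\<^esub>"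
proof -
  interpret V: superalg "sec A V" "par A V" using superalg' V .
  interpret W: superalg "sec A W" "par A W" using superalg W .
  show ?thesis
    by (rule real_linear_zero[OF V.is_abelian_group W.is_abelian_group res_linear])
qed

lemma res_finsum: "finite I \<Longrightarrow> (\<And>i. i \<in> I \<Longrightarrow> f i \<in> carrier (sec A V)) \<Longrightarrow>
    res A V W (finsum (sec A V) f I) = finsum (sec A W) (\<lambda>i. res A V W (f i)) I"
proof -
  assume f: "finite I" "\<And>i. i \<in> I \<Longrightarrow> f i \<in> carrier (sec A V)"
  interpret V: superalg "sec A V" "par A V" using superalg' V .
  interpret W: superalg "sec A W" "par A W" using superalg W .
  show ?thesis
    by (rule additive_finsum[OF V.is_abelian_group W.is_abelian_group])
      (use f in \<open>auto simp: res_closed res_add\<close>)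
qed

end

lemma res_self: "openin M U \<Longrightarrow> s \<in> carrier (sec A U) \<Longrightarrow> res A U U s = s"
  using sheaf by (auto simp: is_superalgebra_sheaf_def)

lemma res_res: "openin M U \<Longrightarrow> V \<in> opens M U \<Longrightarrow> W \<in> opens M V \<Longrightarrow> s \<in> carrier (sec A U) \<Longrightarrow>
   res A V W (res A U V s) = res A U W s"
  using sheaf unfolding is_superalgebra_sheaf_def opens_def by blast

lemma sheaf_gluing:
  assumes "\<forall>U\<in>\<U>. openin M U" "\<forall>U\<in>\<U>. s U \<in> carrier (sec A U)"
    "\<forall>U\<in>\<U>. \<forall>V\<in>\<U>. res A U (U \<inter> V) (s U) = res A V (U \<inter> V) (s V)"
  shows "\<exists>!t. t \<in> carrier (sec A (\<Union>\<U>)) \<and> (\<forall>U\<in>\<U>. res A (\<Union>\<U>) U t = s U)"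
proof -
  have "\<forall>\<U>. (\<forall>U\<in>\<U>. openin M U) \<longrightarrow>
       (\<forall>s. (\<forall>U\<in>\<U>. s U \<in> carrier (sec A U)) \<and>
            (\<forall>U\<in>\<U>. \<forall>V\<in>\<U>. res A U (U \<inter> V) (s U) = res A V (U \<inter> V) (s V)) \<longrightarrow>
            (\<exists>!t. t \<in> carrier (sec A (\<Union>\<U>)) \<and> (\<forall>U\<in>\<U>. res A (\<Union>\<U>) U t = s U)))"
    using sheaf unfolding is_superalgebra_sheaf_def by (elim conjE) assumption
  from this[THEN spec, THEN mp, OF assms(1), THEN spec, THEN mp, OF conjI, OF assms(2,3)]
  show ?thesis .
qed

text \<open>Both sections glue the family of restrictions of s, which is compatible because
  restriction is transitive.\<close>

lemma glue_unique:
  assumes "\<And>U. U \<in> \<U> \<Longrightarrow> openin M U" "s \<in> carrier (sec A (\<Union>\<U>))" "t \<in> carrier (sec A (\<Union>\<U>))"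
    "\<And>U. U \<in> \<U> \<Longrightarrow> res A (\<Union>\<U>) U s = res A (\<Union>\<U>) U t"
  shows "s = t"
proof -
  have UU: "openin M (\<Union>\<U>)" using assms by blast
  define r where "r = (\<lambda>U. res A (\<Union>\<U>) U s)"
  have o: "U \<in> opens M (\<Union>\<U>)" if "U \<in> \<U>" for U using that assms by (auto simp: opens_def)
  have "\<exists>!t. t \<in> carrier (sec A (\<Union>\<U>)) \<and> (\<forall>U\<in>\<U>. res A (\<Union>\<U>) U t = r U)"
  proof -
    have "\<forall>U\<in>\<U>. r U \<in> carrier (sec A U)"
      using o assms(2) UU by (auto simp: r_def intro: res_closed)
    moreover have "\<forall>U\<in>\<U>. \<forall>V\<in>\<U>. res A U (U \<inter> V) (r U) = res A V (U \<inter> V) (r V)"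
    proof (intro ballI)
      fix U V assume UV: "U \<in> \<U>" "V \<in> \<U>"
      then have "U \<inter> V \<in> opens M U" "U \<inter> V \<in> opens M V" using assms(1) by (auto simp: opens_def)
      with UV show "res A U (U \<inter> V) (r U) = res A V (U \<inter> V) (r V)"
        using o UU assms(2) by (simp add: r_def res_res)
    qed
    ultimately show ?thesis
      using assms(1) by (intro sheaf_gluing) auto
  qed
  then obtain u where "\<And>t. t \<in> carrier (sec A (\<Union>\<U>)) \<and> (\<forall>U\<in>\<U>. res A (\<Union>\<U>) U t = r U) \<Longrightarrow> t = u"
    by (elim ex1E) metis
  from this[of s] this[of t] show ?thesis
    using assms(2-4) by (simp add: r_def)
qed

lemma glue_exists:
  assumes "\<And>U. U \<in> \<U> \<Longrightarrow> openin M U" "\<And>U. U \<in> \<U> \<Longrightarrow> s U \<in> carrier (sec A U)"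
    "\<And>U V. U \<in> \<U> \<Longrightarrow> V \<in> \<U> \<Longrightarrow> res A U (U \<inter> V) (s U) = res A V (U \<inter> V) (s V)"
  obtains t where "t \<in> carrier (sec A (\<Union>\<U>))" "\<And>U. U \<in> \<U> \<Longrightarrow> res A (\<Union>\<U>) U t = s U"
proof -
  have "\<exists>!t. t \<in> carrier (sec A (\<Union>\<U>)) \<and> (\<forall>U\<in>\<U>. res A (\<Union>\<U>) U t = s U)"
    using assms by (intro sheaf_gluing) auto
  then show thesis using that by blast
qed

end

section \<open>Vector fields\<close>

context superalg_sheaf
begin

abbreviation "C V \<equiv> carrier (sec A V)"

text \<open>The conditions on sections of $\mathrm{Der}\,\mathcal{A}$ that do not involve the grading.\<close>

definition lin_field :: "'x set \<Rightarrow> ('x, 'a) vfield set"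
  where "lin_field U = {D \<in> extensional (opens M U).
    (\<forall>V\<in>opens M U. D V \<in> extensional (C V) \<and> real_linear (sec A V) (sec A V) (D V)) \<and>
    (\<forall>V\<in>opens M U. \<forall>W\<in>opens M V. \<forall>f\<in>C V. res A V W (D V f) = D W (res A V W f))}"

lemma hder_lin_field: "hder M A U p \<subseteq> lin_field U"
  by (auto simp: hder_def lin_field_def)

lemma hderI:
  assumes "D \<in> lin_field U"
    and "\<And>V q f. V \<in> opens M U \<Longrightarrow> f \<in> par A V q \<Longrightarrow> D V f \<in> par A V (p + q)"
    and "\<And>V q f g. V \<in> opens M U \<Longrightarrow> f \<in> par A V q \<Longrightarrow> g \<in> C V \<Longrightarrow>
      D V (f \<otimes>\<^bsub>sec A V\<^esub> g) =
        (D V f \<otimes>\<^bsub>sec A V\<^esub> g) \<oplus>\<^bsub>sec A V\<^esub> (psgn (p * q) \<odot>\<^bsub>sec A V\<^esub> (f \<otimes>\<^bsub>sec A V\<^esub> D V g))"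
  shows "D \<in> hder M A U p"
  using assms by (simp add: hder_def lin_field_def)

lemma hder_par: "D \<in> hder M A U p \<Longrightarrow> V \<in> opens M U \<Longrightarrow> f \<in> par A V q \<Longrightarrow> D V f \<in> par A V (p + q)"
  by (simp add: hder_def)

lemma hder_Leibniz: "D \<in> hder M A U p \<Longrightarrow> V \<in> opens M U \<Longrightarrow> f \<in> par A V q \<Longrightarrow> g \<in> C V \<Longrightarrow>
    D V (f \<otimes>\<^bsub>sec A V\<^esub> g) =
      (D V f \<otimes>\<^bsub>sec A V\<^esub> g) \<oplus>\<^bsub>sec A V\<^esub> (psgn (p * q) \<odot>\<^bsub>sec A V\<^esub> (f \<otimes>\<^bsub>sec A V\<^esub> D V g))"
  by (simp add: hder_def)

context
  fixes D U assumes D: "D \<in> lin_field U"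
begin

lemma lf_closed: "V \<in> opens M U \<Longrightarrow> f \<in> C V \<Longrightarrow> D V f \<in> C V"
  using D by (auto simp: lin_field_def real_linear_def)

lemma lf_linear: "V \<in> opens M U \<Longrightarrow> real_linear (sec A V) (sec A V) (D V)"
  using D by (auto simp: lin_field_def)

lemma lf_add: "V \<in> opens M U \<Longrightarrow> f \<in> C V \<Longrightarrow> g \<in> C V \<Longrightarrow>
    D V (f \<oplus>\<^bsub>sec A V\<^esub> g) = D V f \<oplus>\<^bsub>sec A V\<^esub> D V g"
  using D by (auto simp: lin_field_def real_linear_def)

lemma lf_smult: "V \<in> opens M U \<Longrightarrow> f \<in> C V \<Longrightarrow> D V (c \<odot>\<^bsub>sec A V\<^esub> f) = c \<odot>\<^bsub>sec A V\<^esub> D V f"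
  using D by (auto simp: lin_field_def real_linear_def)

lemma lf_zero: "V \<in> opens M U \<Longrightarrow> D V \<zero>\<^bsub>sec A V\<^esub> = \<zero>\<^bsub>sec A V\<^esub>"
proof -
  assume V: "V \<in> opens M U"
  interpret V: superalg "sec A V" "par A V" using superalg V .
  show ?thesis using real_linear_zero[OF V.is_abelian_group V.is_abelian_group lf_linear[OF V]] .
qed

lemma lf_res: "V \<in> opens M U \<Longrightarrow> W \<in> opens M V \<Longrightarrow> f \<in> C V \<Longrightarrow>
    res A V W (D V f) = D W (res A V W f)"
  using D by (auto simp: lin_field_def)

end

lemma lf_eqI:
  assumes "D \<in> lin_field U" "E \<in> lin_field U"
    and "\<And>V f. V \<in> opens M U \<Longrightarrow> f \<in> C V \<Longrightarrow> D V f = E V f"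
  shows "D = E"
proof (rule extensionalityI)
  show "D \<in> extensional (opens M U)" "E \<in> extensional (opens M U)"
    using assms by (auto simp: lin_field_def)
  fix V assume V: "V \<in> opens M U"
  show "D V = E V"
    by (rule extensionalityI[where A = "C V"]) (use V assms in \<open>auto simp: lin_field_def\<close>)
qed

text \<open>Every section is a sum of homogeneous ones and the maps are additive, so homogeneous
  arguments suffice. These are the arguments on which the graded rules speak.\<close>

lemma lf_eqI_par:
  assumes D: "D \<in> lin_field U" and E: "E \<in> lin_field U"
    and eq: "\<And>V q f. V \<in> opens M U \<Longrightarrow> f \<in> par A V q \<Longrightarrow> D V f = E V f"
  shows "D = E"
proof (rule lf_eqI[OF D E])
  fix V f assume V: "V \<in> opens M U" and f: "f \<in> C V"
  interpret V: superalg "sec A V" "par A V" using superalg V .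
  obtain y z where yz: "y \<in> par A V 0" "z \<in> par A V (0 + 1)" "f = y \<oplus>\<^bsub>sec A V\<^esub> z"
    using V.par_decompose[OF f] by blast
  then show "D V f = E V f"
    using V eq[OF V yz(1)] eq[OF V yz(2)] by (simp add: lf_add[OF D] lf_add[OF E] V.par_closed)
qed

text \<open>Imposes the \<open>undefined\<close> convention outside the domains, which turns
  pointwise agreement of fields into equality.\<close>

definition field_of :: "'x set \<Rightarrow> ('x set \<Rightarrow> 'a \<Rightarrow> 'a) \<Rightarrow> ('x, 'a) vfield"
  where "field_of U g = (\<lambda>V\<in>opens M U. \<lambda>f\<in>C V. g V f)"

lemma field_of_apply [simp]: "V \<in> opens M U \<Longrightarrow> f \<in> C V \<Longrightarrow> field_of U g V f = g V f"
  by (simp add: field_of_def)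

lemma field_of_lin_field:
  assumes "\<And>V f. V \<in> opens M U \<Longrightarrow> f \<in> C V \<Longrightarrow> g V f \<in> C V"
    and "\<And>V f h. V \<in> opens M U \<Longrightarrow> f \<in> C V \<Longrightarrow> h \<in> C V \<Longrightarrow>
      g V (f \<oplus>\<^bsub>sec A V\<^esub> h) = g V f \<oplus>\<^bsub>sec A V\<^esub> g V h"
    and "\<And>V f c. V \<in> opens M U \<Longrightarrow> f \<in> C V \<Longrightarrow> g V (c \<odot>\<^bsub>sec A V\<^esub> f) = c \<odot>\<^bsub>sec A V\<^esub> g V f"
    and "\<And>V W f. V \<in> opens M U \<Longrightarrow> W \<in> opens M V \<Longrightarrow> W \<in> opens M U \<Longrightarrow> f \<in> C V \<Longrightarrow>
      res A V W (g V f) = g W (res A V W f)"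
  shows "field_of U g \<in> lin_field U"
proof -
  have "real_linear (sec A V) (sec A V) (field_of U g V)" if V: "V \<in> opens M U" for V
  proof -
    interpret V: superalg "sec A V" "par A V" using superalg V .
    show ?thesis unfolding real_linear_def using assms(1-3) V by auto
  qed
  moreover have "res A V W (field_of U g V f) = field_of U g W (res A V W f)"
    if V: "V \<in> opens M U" and W: "W \<in> opens M V" and f: "f \<in> C V" for V W f
  proof -
    have "openin M V" using V by (auto simp: opens_def)
    then have "res A V W f \<in> C W" using W f by (rule res_closed)
    then show ?thesis using V W f opens_trans[OF V W] by (simp add: assms(4))
  qed
  ultimately show ?thesis
    by (auto simp: lin_field_def) (auto simp: field_of_def)
qed

lemma opens_open: "V \<in> opens M U \<Longrightarrow> openin M V"
  by (simp add: opens_def)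

section \<open>Sums and multiples of vector fields\<close>

definition lmult :: "'x set \<Rightarrow> 'a \<Rightarrow> ('x, 'a) vfield \<Rightarrow> ('x, 'a) vfield"
  where "lmult U g D = field_of U (\<lambda>V f. res A U V g \<otimes>\<^bsub>sec A V\<^esub> D V f)"

definition rmult :: "'x set \<Rightarrow> real \<Rightarrow> ('x, 'a) vfield \<Rightarrow> ('x, 'a) vfield"
  where "rmult U c D = field_of U (\<lambda>V f. c \<odot>\<^bsub>sec A V\<^esub> D V f)"

lemma vf_add_field_of: "vf_add M A U D E = field_of U (\<lambda>V f. D V f \<oplus>\<^bsub>sec A V\<^esub> E V f)"
  by (simp add: vf_add_def field_of_def)

lemma vf_zero_field_of: "vf_zero M A U = field_of U (\<lambda>V f. \<zero>\<^bsub>sec A V\<^esub>)"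
  by (simp add: vf_zero_def field_of_def)

text \<open>The two records share carrier and addition and differ in their scalars. After this
  unfolding, computations take place with plain functions on fields.\<close>

lemma Der_simps:
  "carrier (Der M A U) = vf_carrier M A U" "zero (Der M A U) = vf_zero M A U"
  "add (Der M A U) = vf_add M A U" "smult (Der M A U) = lmult U"
  "carrier (Der_real M A U) = vf_carrier M A U" "zero (Der_real M A U) = vf_zero M A U"
  "add (Der_real M A U) = vf_add M A U" "smult (Der_real M A U) = rmult U"
  by (simp_all add: Der_def Der_real_def lmult_def[abs_def] rmult_def[abs_def] field_of_def)

lemma vf_add_apply [simp]: "V \<in> opens M U \<Longrightarrow> f \<in> C V \<Longrightarrow> vf_add M A U D E V f = D V f \<oplus>\<^bsub>sec A V\<^esub> E V f"
  by (simp add: vf_add_field_of)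

lemma vf_zero_apply [simp]: "V \<in> opens M U \<Longrightarrow> f \<in> C V \<Longrightarrow> vf_zero M A U V f = \<zero>\<^bsub>sec A V\<^esub>"
  by (simp add: vf_zero_field_of)

lemma lmult_apply [simp]:
  "V \<in> opens M U \<Longrightarrow> f \<in> C V \<Longrightarrow> lmult U g D V f = res A U V g \<otimes>\<^bsub>sec A V\<^esub> D V f"
  by (simp add: lmult_def)

lemma rmult_apply [simp]: "V \<in> opens M U \<Longrightarrow> f \<in> C V \<Longrightarrow> rmult U c D V f = c \<odot>\<^bsub>sec A V\<^esub> D V f"
  by (simp add: rmult_def)

lemma lf_vf_add:
  assumes D: "D \<in> lin_field U" and E: "E \<in> lin_field U"
  shows "vf_add M A U D E \<in> lin_field U"
  unfolding vf_add_field_of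
proof (rule field_of_lin_field)
  fix V f assume V: "V \<in> opens M U" and f: "f \<in> C V"
  interpret V: superalg "sec A V" "par A V" using superalg V .
  note lf = lf_closed[OF D V] lf_closed[OF E V] lf_add[OF D V] lf_add[OF E V] lf_smult[OF D V] lf_smult[OF E V]
  show "D V f \<oplus>\<^bsub>sec A V\<^esub> E V f \<in> C V" using f lf by simp
  show "D V (c \<odot>\<^bsub>sec A V\<^esub> f) \<oplus>\<^bsub>sec A V\<^esub> E V (c \<odot>\<^bsub>sec A V\<^esub> f) =
      c \<odot>\<^bsub>sec A V\<^esub> (D V f \<oplus>\<^bsub>sec A V\<^esub> E V f)" for c
    using f by (simp add: lf V.smult_add)
  show "D V (f \<oplus>\<^bsub>sec A V\<^esub> h) \<oplus>\<^bsub>sec A V\<^esub> E V (f \<oplus>\<^bsub>sec A V\<^esub> h) =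
     D V f \<oplus>\<^bsub>sec A V\<^esub> E V f \<oplus>\<^bsub>sec A V\<^esub> (D V h \<oplus>\<^bsub>sec A V\<^esub> E V h)" if "h \<in> C V" for h
    using f that by (simp add: lf V.a_ac)
  show "res A V W (D V f \<oplus>\<^bsub>sec A V\<^esub> E V f) = D W (res A V W f) \<oplus>\<^bsub>sec A W\<^esub> E W (res A V W f)"
    if W: "W \<in> opens M V" for W
    using f lf res_add[OF opens_open[OF V] W] by (simp add: lf_res[OF D V W] lf_res[OF E V W])
qed

lemma lf_rmult:
  assumes D: "D \<in> lin_field U"
  shows "rmult U c D \<in> lin_field U"
  unfolding rmult_def
proof (rule field_of_lin_field)
  fix V f assume V: "V \<in> opens M U" and f: "f \<in> C V"
  interpret V: superalg "sec A V" "par A V" using superalg V .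
  note lf = lf_closed[OF D V] lf_add[OF D V] lf_smult[OF D V]
  show "c \<odot>\<^bsub>sec A V\<^esub> D V f \<in> C V" using f lf by simp
  show "c \<odot>\<^bsub>sec A V\<^esub> D V (d \<odot>\<^bsub>sec A V\<^esub> f) = d \<odot>\<^bsub>sec A V\<^esub> (c \<odot>\<^bsub>sec A V\<^esub> D V f)" for d
    using f by (simp add: lf mult.commute)
  show "c \<odot>\<^bsub>sec A V\<^esub> D V (f \<oplus>\<^bsub>sec A V\<^esub> h) = c \<odot>\<^bsub>sec A V\<^esub> D V f \<oplus>\<^bsub>sec A V\<^esub> c \<odot>\<^bsub>sec A V\<^esub> D V h"
    if "h \<in> C V" for h
    using f that by (simp add: lf V.smult_add)
  show "res A V W (c \<odot>\<^bsub>sec A V\<^esub> D V f) = c \<odot>\<^bsub>sec A W\<^esub> D W (res A V W f)"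
    if W: "W \<in> opens M V" for W
    using f lf res_smult[OF opens_open[OF V] W] by (simp add: lf_res[OF D V W])
qed

lemma lf_lmult:
  assumes D: "D \<in> lin_field U" and U: "openin M U" and g: "g \<in> C U"
  shows "lmult U g D \<in> lin_field U"
  unfolding lmult_def
proof (rule field_of_lin_field)
  fix V f assume V: "V \<in> opens M U" and f: "f \<in> C V"
  interpret V: superalg "sec A V" "par A V" using superalg V .
  note lf = lf_closed[OF D V] lf_add[OF D V] lf_smult[OF D V]
  have gV: "res A U V g \<in> C V" using res_closed[OF U V g] .
  show "res A U V g \<otimes>\<^bsub>sec A V\<^esub> D V f \<in> C V" using f lf gV by simp
  show "res A U V g \<otimes>\<^bsub>sec A V\<^esub> D V (d \<odot>\<^bsub>sec A V\<^esub> f) = d \<odot>\<^bsub>sec A V\<^esub> (res A U V g \<otimes>\<^bsub>sec A V\<^esub> D V f)" for d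
    using f gV by (simp add: lf)
  show "res A U V g \<otimes>\<^bsub>sec A V\<^esub> D V (f \<oplus>\<^bsub>sec A V\<^esub> h) =
     res A U V g \<otimes>\<^bsub>sec A V\<^esub> D V f \<oplus>\<^bsub>sec A V\<^esub> res A U V g \<otimes>\<^bsub>sec A V\<^esub> D V h"
    if "h \<in> C V" for h
    using f that gV by (simp add: lf V.r_distr)
  show "res A V W (res A U V g \<otimes>\<^bsub>sec A V\<^esub> D V f) = res A U W g \<otimes>\<^bsub>sec A W\<^esub> D W (res A V W f)"
    if W: "W \<in> opens M V" for W
    using f lf gV g U V W res_mult[OF opens_open[OF V] W] by (simp add: lf_res[OF D V W] res_res)
qed

lemma lf_vf_zero: "vf_zero M A U \<in> lin_field U"
  unfolding vf_zero_field_of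
proof (rule field_of_lin_field)
  fix V f assume V: "V \<in> opens M U" and f: "f \<in> C V"
  interpret V: superalg "sec A V" "par A V" using superalg V .
  show "\<zero>\<^bsub>sec A V\<^esub> \<in> C V" by simp
  show "\<zero>\<^bsub>sec A V\<^esub> = c \<odot>\<^bsub>sec A V\<^esub> \<zero>\<^bsub>sec A V\<^esub>" for c by simp
  show "\<zero>\<^bsub>sec A V\<^esub> = \<zero>\<^bsub>sec A V\<^esub> \<oplus>\<^bsub>sec A V\<^esub> \<zero>\<^bsub>sec A V\<^esub>" by simp
  show "res A V W \<zero>\<^bsub>sec A V\<^esub> = \<zero>\<^bsub>sec A W\<^esub>" if W: "W \<in> opens M V" for W
    using V W by (simp add: res_zero opens_open)
qed

lemma hder_vf_add:
  assumes D: "D \<in> hder M A U p" and E: "E \<in> hder M A U p"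
  shows "vf_add M A U D E \<in> hder M A U p"
proof (rule hderI)
  have l: "D \<in> lin_field U" "E \<in> lin_field U" using D E hder_lin_field by auto
  then show "vf_add M A U D E \<in> lin_field U" by (rule lf_vf_add)
  fix V q f assume V: "V \<in> opens M U" and f: "f \<in> par A V q"
  interpret V: superalg "sec A V" "par A V" using superalg V .
  have fC: "f \<in> C V" using f V.par_closed by simp
  show "vf_add M A U D E V f \<in> par A V (p + q)"
    using V f fC hder_par[OF D V f] hder_par[OF E V f] by (simp add: V.par_add)
  fix g assume g: "g \<in> C V"
  show "vf_add M A U D E V (f \<otimes>\<^bsub>sec A V\<^esub> g) = vf_add M A U D E V f \<otimes>\<^bsub>sec A V\<^esub> g \<oplus>\<^bsub>sec A V\<^esub>
      psgn (p * q) \<odot>\<^bsub>sec A V\<^esub> (f \<otimes>\<^bsub>sec A V\<^esub> vf_add M A U D E V g)"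
    using V f fC g lf_closed[OF l(1) V] lf_closed[OF l(2) V]
    by (simp add: hder_Leibniz[OF D V f] hder_Leibniz[OF E V f] V.l_distr V.r_distr V.smult_add V.a_ac)
qed

lemma hder_rmult:
  assumes D: "D \<in> hder M A U p"
  shows "rmult U c D \<in> hder M A U p"
proof (rule hderI)
  have l: "D \<in> lin_field U" using D hder_lin_field by auto
  then show "rmult U c D \<in> lin_field U" by (rule lf_rmult)
  fix V q f assume V: "V \<in> opens M U" and f: "f \<in> par A V q"
  interpret V: superalg "sec A V" "par A V" using superalg V .
  have fC: "f \<in> C V" using f V.par_closed by simp
  show "rmult U c D V f \<in> par A V (p + q)"
    using V f fC hder_par[OF D V f] by (simp add: V.par_smult)
  fix g assume g: "g \<in> C V"
  show "rmult U c D V (f \<otimes>\<^bsub>sec A V\<^esub> g) = rmult U c D V f \<otimes>\<^bsub>sec A V\<^esub> g \<oplus>\<^bsub>sec A V\<^esub>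
      psgn (p * q) \<odot>\<^bsub>sec A V\<^esub> (f \<otimes>\<^bsub>sec A V\<^esub> rmult U c D V g)"
    using V f fC g lf_closed[OF l V]
    by (simp add: hder_Leibniz[OF D V f] V.smult_add mult.commute)
qed

lemma hder_lmult:
  assumes D: "D \<in> hder M A U p" and U: "openin M U" and h: "h \<in> par A U r"
  shows "lmult U h D \<in> hder M A U (r + p)"
proof (rule hderI)
  interpret U: superalg "sec A U" "par A U" using superalg' U .
  have hC: "h \<in> C U" using h U.par_closed by simp
  have l: "D \<in> lin_field U" using D hder_lin_field by auto
  then show "lmult U h D \<in> lin_field U" using U hC by (rule lf_lmult)
  fix V q f assume V: "V \<in> opens M U" and f: "f \<in> par A V q"
  interpret V: superalg "sec A V" "par A V" using superalg V .
  have fC: "f \<in> C V" using f V.par_closed by simp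
  have hV: "res A U V h \<in> par A V r" using res_par[OF U V h] .
  then have hVC: "res A U V h \<in> C V" using V.par_closed by simp
  show "lmult U h D V f \<in> par A V (r + p + q)"
    using V f fC V.par_mult[OF hV hder_par[OF D V f]] by (simp add: add.assoc)
  fix g assume g: "g \<in> C V"
  \<comment> \<open>Moving h past f costs (-1)^{|h||f|}, which is exactly what completes the Leibniz
    sign of D to that of a field of degree |h| + |D|.\<close>
  have "res A U V h \<otimes>\<^bsub>sec A V\<^esub> (f \<otimes>\<^bsub>sec A V\<^esub> D V g) =
     psgn (r * q) \<odot>\<^bsub>sec A V\<^esub> (f \<otimes>\<^bsub>sec A V\<^esub> (res A U V h \<otimes>\<^bsub>sec A V\<^esub> D V g))"
    using fC hVC g lf_closed[OF l V] V.par_commute[OF f hV]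
    by (simp flip: V.m_assoc add: mult.commute)
  then show "lmult U h D V (f \<otimes>\<^bsub>sec A V\<^esub> g) = lmult U h D V f \<otimes>\<^bsub>sec A V\<^esub> g \<oplus>\<^bsub>sec A V\<^esub>
      psgn ((r + p) * q) \<odot>\<^bsub>sec A V\<^esub> (f \<otimes>\<^bsub>sec A V\<^esub> lmult U h D V g)"
    using V f fC g hVC lf_closed[OF l V]
    by (simp add: hder_Leibniz[OF D V f] V.r_distr V.m_assoc distrib_right distrib_left psgn_add mult.commute)
qed

text \<open>Zero has both parities, so a homogeneous field is completed by it to a pair of
  components of opposite parity.\<close>

lemma hder_vf_zero: "vf_zero M A U \<in> hder M A U p"
proof (rule hderI)
  show "vf_zero M A U \<in> lin_field U" by (rule lf_vf_zero)
  fix V q f assume V: "V \<in> opens M U" and f: "f \<in> par A V q"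
  interpret V: superalg "sec A V" "par A V" using superalg V .
  have fC: "f \<in> C V" using f V.par_closed by simp
  show "vf_zero M A U V f \<in> par A V (p + q)" using V fC by simp
  fix g assume g: "g \<in> C V"
  show "vf_zero M A U V (f \<otimes>\<^bsub>sec A V\<^esub> g) = vf_zero M A U V f \<otimes>\<^bsub>sec A V\<^esub> g \<oplus>\<^bsub>sec A V\<^esub>
      psgn (p * q) \<odot>\<^bsub>sec A V\<^esub> (f \<otimes>\<^bsub>sec A V\<^esub> vf_zero M A U V g)"
    using V fC g by simp
qed

lemma vf_add_commute: "D \<in> lin_field U \<Longrightarrow> E \<in> lin_field U \<Longrightarrow> vf_add M A U D E = vf_add M A U E D"
proof (rule lf_eqI)
  fix V f assume DE: "D \<in> lin_field U" "E \<in> lin_field U" and V: "V \<in> opens M U" and f: "f \<in> C V"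
  interpret V: superalg "sec A V" "par A V" using superalg V .
  show "vf_add M A U D E V f = vf_add M A U E D V f"
    using V f DE by (simp add: V.a_comm lf_closed)
qed (auto intro: lf_vf_add)

lemma vf_add_assoc: "D \<in> lin_field U \<Longrightarrow> E \<in> lin_field U \<Longrightarrow> F \<in> lin_field U \<Longrightarrow>
   vf_add M A U (vf_add M A U D E) F = vf_add M A U D (vf_add M A U E F)"
proof (rule lf_eqI)
  fix V f assume DE: "D \<in> lin_field U" "E \<in> lin_field U" "F \<in> lin_field U"
    and V: "V \<in> opens M U" and f: "f \<in> C V"
  interpret V: superalg "sec A V" "par A V" using superalg V .
  show "vf_add M A U (vf_add M A U D E) F V f = vf_add M A U D (vf_add M A U E F) V f"
    using V f DE by (simp add: V.a_assoc lf_closed)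
qed (auto intro: lf_vf_add)

lemma vf_add_zero: "D \<in> lin_field U \<Longrightarrow> vf_add M A U (vf_zero M A U) D = D"
proof (rule lf_eqI)
  fix V f assume DE: "D \<in> lin_field U" and V: "V \<in> opens M U" and f: "f \<in> C V"
  interpret V: superalg "sec A V" "par A V" using superalg V .
  show "vf_add M A U (vf_zero M A U) D V f = D V f"
    using V f DE by (simp add: lf_closed)
qed (auto intro: lf_vf_add lf_vf_zero)

lemma vf_add_neg: "D \<in> lin_field U \<Longrightarrow> vf_add M A U (rmult U (-1) D) D = vf_zero M A U"
proof (rule lf_eqI)
  fix V f assume DE: "D \<in> lin_field U" and V: "V \<in> opens M U" and f: "f \<in> C V"
  interpret V: superalg "sec A V" "par A V" using superalg V .
  show "vf_add M A U (rmult U (-1) D) D V f = vf_zero M A U V f"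
    using V f DE by (simp add: lf_closed V.a_comm)
qed (auto intro: lf_vf_add lf_vf_zero lf_rmult)

text \<open>The carrier is defined with the even summand first. Commutativity allows either parity p
  to lead, p + 1 being the other one, which saves case distinctions later.\<close>

lemma vf_carrierE:
  assumes "D \<in> vf_carrier M A U"
  obtains D0 D1 where "D0 \<in> hder M A U p" "D1 \<in> hder M A U (p + 1)" "D = vf_add M A U D0 D1"
proof -
  obtain a b where ab: "a \<in> hder M A U 0" "b \<in> hder M A U 1" "D = vf_add M A U a b"
    using assms by (auto simp: vf_carrier_def)
  then have "D = vf_add M A U b a" using hder_lin_field vf_add_commute by blast
  with ab that show thesis by (cases p) auto
qed

lemma vf_carrierI: "D0 \<in> hder M A U p \<Longrightarrow> D1 \<in> hder M A U (p + 1) \<Longrightarrow> vf_add M A U D0 D1 \<in> vf_carrier M A U"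
proof (cases "p = 0")
  case False
  assume "D0 \<in> hder M A U p" "D1 \<in> hder M A U (p + 1)"
  then have "D0 \<in> hder M A U 1" "D1 \<in> hder M A U 0" "vf_add M A U D0 D1 = vf_add M A U D1 D0"
    using False hder_lin_field by (auto intro!: vf_add_commute)
  then show ?thesis by (auto simp: vf_carrier_def)
qed (auto simp: vf_carrier_def)

lemma vf_carrier_lin_field: "vf_carrier M A U \<subseteq> lin_field U"
  using hder_lin_field by (fastforce simp: vf_carrier_def intro: lf_vf_add)

lemma hder_vf_carrier: "D \<in> hder M A U p \<Longrightarrow> D \<in> vf_carrier M A U"
proof -
  assume D: "D \<in> hder M A U p"
  have "vf_add M A U D (vf_zero M A U) = D"
    using D hder_lin_field lf_vf_zero by (metis vf_add_commute vf_add_zero subsetD)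
  then show ?thesis using vf_carrierI[OF D hder_vf_zero] by simp
qed

lemma vf_carrier_add:
  assumes "D \<in> vf_carrier M A U" "E \<in> vf_carrier M A U"
  shows "vf_add M A U D E \<in> vf_carrier M A U"
proof -
  obtain D0 D1 where D: "D0 \<in> hder M A U 0" "D1 \<in> hder M A U (0 + 1)" "D = vf_add M A U D0 D1"
    using vf_carrierE[OF assms(1)] .
  obtain E0 E1 where E: "E0 \<in> hder M A U 0" "E1 \<in> hder M A U (0 + 1)" "E = vf_add M A U E0 E1"
    using vf_carrierE[OF assms(2)] .
  have l: "D0 \<in> lin_field U" "D1 \<in> lin_field U" "E0 \<in> lin_field U" "E1 \<in> lin_field U"
    using D E hder_lin_field by auto
  have "vf_add M A U D E = vf_add M A U (vf_add M A U D0 E0) (vf_add M A U D1 E1)"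
    using l unfolding D E
    by (metis (no_types, lifting) vf_add_assoc vf_add_commute lf_vf_add)
  then show ?thesis using D E by (simp only:) (auto intro!: vf_carrierI hder_vf_add)
qed

lemma vf_carrier_rmult: "D \<in> vf_carrier M A U \<Longrightarrow> rmult U c D \<in> vf_carrier M A U"
proof -
  assume "D \<in> vf_carrier M A U"
  then obtain D0 D1 where D: "D0 \<in> hder M A U 0" "D1 \<in> hder M A U (0 + 1)" "D = vf_add M A U D0 D1"
    using vf_carrierE by blast
  have l: "D0 \<in> lin_field U" "D1 \<in> lin_field U" using D hder_lin_field by auto
  have "rmult U c D = vf_add M A U (rmult U c D0) (rmult U c D1)"
  proof (rule lf_eqI)
    fix V f assume V: "V \<in> opens M U" and f: "f \<in> C V"
    interpret V: superalg "sec A V" "par A V" using superalg V .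
    show "rmult U c D V f = vf_add M A U (rmult U c D0) (rmult U c D1) V f"
      using V f l by (simp add: D lf_closed V.smult_add)
  qed (use l in \<open>auto simp: D intro: lf_vf_add lf_rmult\<close>)
  then show ?thesis using D by (simp only:) (auto intro!: vf_carrierI hder_rmult)
qed

text \<open>The additive structure is what finite sums of fields rest on. Laws involving scalars are
  checked by evaluating fields on sections.\<close>

lemma Der_abelian_group: "abelian_group (Der M A U)"
proof (rule abelian_groupI, unfold Der_simps)
  note l = vf_carrier_lin_field[THEN subsetD]
  show "vf_add M A U D E \<in> vf_carrier M A U" if "D \<in> vf_carrier M A U" "E \<in> vf_carrier M A U" for D E
    using that by (rule vf_carrier_add)
  show "vf_zero M A U \<in> vf_carrier M A U" by (rule hder_vf_carrier[OF hder_vf_zero])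
  show "\<exists>E\<in>vf_carrier M A U. vf_add M A U E D = vf_zero M A U" if "D \<in> vf_carrier M A U" for D
    using that vf_add_neg[OF l[OF that]] by (auto intro: vf_carrier_rmult)
qed (auto dest!: vf_carrier_lin_field[THEN subsetD] intro: vf_add_assoc vf_add_commute vf_add_zero)

lemma Der_diff:
  assumes D: "D \<in> vf_carrier M A U" and E: "E \<in> vf_carrier M A U"
  shows "D \<ominus>\<^bsub>Der M A U\<^esub> E = vf_add M A U D (rmult U (-1) E)"
proof -
  interpret abelian_group "Der M A U" by (rule Der_abelian_group)
  have "\<ominus>\<^bsub>Der M A U\<^esub> E = rmult U (-1) E"
    by (rule minus_equality)
      (use E in \<open>auto simp: Der_simps vf_add_neg[OF vf_carrier_lin_field[THEN subsetD]] intro: vf_carrier_rmult\<close>)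
  then show ?thesis by (simp add: a_minus_def Der_simps)
qed

lemma vf_carrier_lmult:
  assumes "D \<in> vf_carrier M A U" "openin M U" "g \<in> C U" shows "lmult U g D \<in> vf_carrier M A U"
proof -
  interpret U: superalg "sec A U" "par A U" using superalg' assms(2) .
  obtain D0 D1 where D: "D0 \<in> hder M A U 0" "D1 \<in> hder M A U (0 + 1)" "D = vf_add M A U D0 D1"
    using vf_carrierE[OF assms(1)] .
  obtain g0 g1 where g: "g0 \<in> par A U 0" "g1 \<in> par A U (0 + 1)" "g = g0 \<oplus>\<^bsub>sec A U\<^esub> g1"
    using U.par_decompose[OF assms(3)] .
  have l: "D0 \<in> lin_field U" "D1 \<in> lin_field U" using D hder_lin_field by auto
  have gC: "g0 \<in> C U" "g1 \<in> C U" using g U.par_closed by auto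
  \<comment> \<open>With g and D both split by parity, each of the four products is homogeneous by
    \<open>hder_lmult\<close>.\<close>
  have "lmult U g D = vf_add M A U (vf_add M A U (lmult U g0 D0) (lmult U g0 D1))
    (vf_add M A U (lmult U g1 D0) (lmult U g1 D1))"
  proof (rule lf_eqI)
    fix V f assume V: "V \<in> opens M U" and f: "f \<in> C V"
    interpret V: superalg "sec A V" "par A V" using superalg V .
    show "lmult U g D V f = vf_add M A U (vf_add M A U (lmult U g0 D0) (lmult U g0 D1))
    (vf_add M A U (lmult U g1 D0) (lmult U g1 D1)) V f"
      using V f l gC assms(2) by (simp add: D g lf_closed res_add V.r_distr V.l_distr res_closed V.a_ac)
  qed (use l gC assms in \<open>auto simp: D g intro!: lf_vf_add lf_lmult\<close>)
  then show ?thesis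
    using D g assms(2)
    by (simp only:) (auto intro!: vf_carrier_add intro: hder_vf_carrier[OF hder_lmult])
qed

text \<open>Reduces identities between finite sums of fields to identities in the algebras of
  sections, where distributivity and associativity are at hand.\<close>

lemma Der_finsum_apply:
  assumes "finite I" "\<And>i. i \<in> I \<Longrightarrow> D i \<in> vf_carrier M A U" "V \<in> opens M U" "f \<in> C V"
  shows "finsum (Der M A U) D I V f = finsum (sec A V) (\<lambda>i. D i V f) I"
  using assms(1,2)
proof (induction I rule: finite_induct)
  interpret V: superalg "sec A V" "par A V" using superalg assms(3) .
  interpret Der: abelian_group "Der M A U" by (rule Der_abelian_group)
  {
    case empty
    show ?case using assms by (simp add: Der_simps)
  next
    case (insert i I)
    have "finsum (Der M A U) D (insert i I) = vf_add M A U (D i) (finsum (Der M A U) D I)"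
      using insert by (subst Der.finsum_insert) (auto simp: Der_simps)
    moreover have "finsum (sec A V) (\<lambda>i. D i V f) (insert i I) = D i V f \<oplus>\<^bsub>sec A V\<^esub> finsum (sec A V) (\<lambda>i. D i V f) I"
      using insert assms lf_closed vf_carrier_lin_field by (intro V.finsum_insert) blast+
    ultimately show ?case using insert assms by simp
  }
qed

lemma Der_finsum_closed: "(\<And>i. i \<in> I \<Longrightarrow> D i \<in> vf_carrier M A U) \<Longrightarrow> finsum (Der M A U) D I \<in> vf_carrier M A U"
proof -
  interpret Der: abelian_group "Der M A U" by (rule Der_abelian_group)
  show "(\<And>i. i \<in> I \<Longrightarrow> D i \<in> vf_carrier M A U) \<Longrightarrow> finsum (Der M A U) D I \<in> vf_carrier M A U"
    using Der.finsum_closed[of D I] by (auto simp: Der_simps)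
qed

section \<open>Restriction and homogeneous components of vector fields\<close>

lemma vf_res_apply [simp]: "V \<in> opens M W \<Longrightarrow> vf_res M W D V = D V"
  by (simp add: vf_res_def)

lemma lf_vf_res: "W \<in> opens M U \<Longrightarrow> D \<in> lin_field U \<Longrightarrow> vf_res M W D \<in> lin_field W"
  using opens_trans unfolding lin_field_def vf_res_def by (auto simp: opens_trans[of W M U])

lemma hder_vf_res: "W \<in> opens M U \<Longrightarrow> D \<in> hder M A U p \<Longrightarrow> vf_res M W D \<in> hder M A W p"
proof (rule hderI)
  assume W: "W \<in> opens M U" and D: "D \<in> hder M A U p"
  show "vf_res M W D \<in> lin_field W" using W D hder_lin_field lf_vf_res by blast
  fix V q f assume V: "V \<in> opens M W" and f: "f \<in> par A V q"
  show "vf_res M W D V f \<in> par A V (p + q)" using hder_par[OF D opens_trans[OF W V] f] V by simp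
  fix g assume g: "g \<in> C V"
  show "vf_res M W D V (f \<otimes>\<^bsub>sec A V\<^esub> g) = vf_res M W D V f \<otimes>\<^bsub>sec A V\<^esub> g \<oplus>\<^bsub>sec A V\<^esub>
       psgn (p * q) \<odot>\<^bsub>sec A V\<^esub> (f \<otimes>\<^bsub>sec A V\<^esub> vf_res M W D V g)"
    using hder_Leibniz[OF D opens_trans[OF W V] f g] V by simp
qed

lemma vf_res_add: "W \<in> opens M U \<Longrightarrow> vf_res M W (vf_add M A U D E) = vf_add M A W (vf_res M W D) (vf_res M W E)"
  unfolding vf_res_def vf_add_def by (rule ext) (auto simp: opens_trans restrict_def)

lemma vf_res_carrier: "W \<in> opens M U \<Longrightarrow> D \<in> vf_carrier M A U \<Longrightarrow> vf_res M W D \<in> vf_carrier M A W"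
proof -
  assume W: "W \<in> opens M U" and "D \<in> vf_carrier M A U"
  then obtain D0 D1 where D: "D0 \<in> hder M A U 0" "D1 \<in> hder M A U (0 + 1)" "D = vf_add M A U D0 D1"
    using vf_carrierE by blast
  then show ?thesis using hder_vf_res[OF W] by (simp add: vf_res_add[OF W] vf_carrierI[where p=0])
qed

lemma vf_res_rmult: "W \<in> opens M U \<Longrightarrow> vf_res M W (rmult U c D) = rmult W c (vf_res M W D)"
  unfolding vf_res_def rmult_def field_of_def by (rule ext) (auto simp: opens_trans restrict_def)

lemma vf_res_lmult:
  "openin M U \<Longrightarrow> W \<in> opens M U \<Longrightarrow> g \<in> C U \<Longrightarrow> vf_res M W (lmult U g D) = lmult W (res A U W g) (vf_res M W D)"
  unfolding vf_res_def lmult_def field_of_def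
  by (rule ext) (auto simp: opens_trans restrict_def res_res)

lemma vf_res_vf_res: "W' \<in> opens M W \<Longrightarrow> vf_res M W' (vf_res M W D) = vf_res M W' D"
  unfolding vf_res_def by (rule ext) (auto simp: opens_trans restrict_def)

lemma vf_res_self: "D \<in> lin_field U \<Longrightarrow> vf_res M U D = D"
  unfolding vf_res_def lin_field_def by (simp add: extensional_restrict)

text \<open>On a homogeneous section the two components of a field take values of opposite parities,
  so uniqueness is inherited from the superalgebra.\<close>

lemma hder_decompose_unique:
  assumes "D \<in> hder M A U p" "E \<in> hder M A U (p + 1)" "D' \<in> hder M A U p" "E' \<in> hder M A U (p + 1)"
    "vf_add M A U D E = vf_add M A U D' E'"
  shows "D = D'"
proof (rule lf_eqI_par)
  show "D \<in> lin_field U" "D' \<in> lin_field U" using assms hder_lin_field by auto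
  fix V q f assume V: "V \<in> opens M U" and f: "f \<in> par A V q"
  interpret V: superalg "sec A V" "par A V" using superalg V .
  have *: "D V f \<in> par A V (p + q)" "D' V f \<in> par A V (p + q)" "E V f \<in> par A V (p + q + 1)" "E' V f \<in> par A V (p + q + 1)"
    using hder_par[OF assms(1) V f] hder_par[OF assms(2) V f] hder_par[OF assms(3) V f] hder_par[OF assms(4) V f]
    by (simp_all add: add_ac)
  have "vf_add M A U D E V f = vf_add M A U D' E' V f" using assms(5) by simp
  then have "D V f \<oplus>\<^bsub>sec A V\<^esub> E V f = D' V f \<oplus>\<^bsub>sec A V\<^esub> E' V f"
    using V f V.par_closed by simp
  then show "D V f = D' V f" using V.par_decompose_unique(1) * by blast
qed

text \<open>Eliminates the description operator: any splitting into parities computes the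
  components.\<close>

lemma vf_part_eqI:
  assumes "D0 \<in> hder M A U p" "D1 \<in> hder M A U (p + 1)" "D = vf_add M A U D0 D1"
  shows "vf_part M A U p D = D0"
  unfolding vf_part_def
  by (rule the_equality) (use assms hder_decompose_unique in blast)+

lemma vf_part_hder:
  assumes D: "D \<in> hder M A U p"
  shows "vf_part M A U q D = (if q = p then D else vf_zero M A U)"
proof -
  have l: "D \<in> lin_field U" using D hder_lin_field by auto
  have "vf_add M A U D (vf_zero M A U) = D" using l lf_vf_zero by (metis vf_add_commute vf_add_zero)
  then have "vf_part M A U p D = D" using D hder_vf_zero by (intro vf_part_eqI) auto
  moreover have "vf_part M A U (p + 1) D = vf_zero M A U"
    using D hder_vf_zero vf_add_zero[OF l] by (intro vf_part_eqI) (auto simp: add.assoc)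
  ultimately show ?thesis by (cases p; cases q) auto
qed

lemma vf_part_add:
  assumes "D \<in> vf_carrier M A U" "E \<in> vf_carrier M A U"
  shows "vf_part M A U p (vf_add M A U D E) = vf_add M A U (vf_part M A U p D) (vf_part M A U p E)"
proof -
  obtain D0 D1 where D: "D0 \<in> hder M A U p" "D1 \<in> hder M A U (p + 1)" "D = vf_add M A U D0 D1"
    using vf_carrierE[OF assms(1)] .
  obtain E0 E1 where E: "E0 \<in> hder M A U p" "E1 \<in> hder M A U (p + 1)" "E = vf_add M A U E0 E1"
    using vf_carrierE[OF assms(2)] .
  have l: "D0 \<in> lin_field U" "D1 \<in> lin_field U" "E0 \<in> lin_field U" "E1 \<in> lin_field U"
    using D E hder_lin_field by auto
  have "vf_add M A U D E = vf_add M A U (vf_add M A U D0 E0) (vf_add M A U D1 E1)"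
    using l unfolding D E
    by (metis (no_types, lifting) vf_add_assoc vf_add_commute lf_vf_add)
  then have "vf_part M A U p (vf_add M A U D E) = vf_add M A U D0 E0"
    using D E by (intro vf_part_eqI) (auto intro: hder_vf_add)
  then show ?thesis using vf_part_eqI[OF D] vf_part_eqI[OF E] by simp
qed

lemma vf_part_closed: "D \<in> vf_carrier M A U \<Longrightarrow> vf_part M A U p D \<in> hder M A U p"
  by (metis vf_carrierE vf_part_eqI)

end

section \<open>The graded commutator\<close>

text \<open>The algebra behind the Leibniz rule of the commutator. The elements b and c stand for
  the mixed terms E(f) D(g) and D(f) E(g), which occur in D E and in the signed E D with opposite
  coefficients.\<close>

lemma (in superalg) cancel_cross_terms:
  assumes "a \<in> carrier R" "b \<in> carrier R" "c \<in> carrier R" "d \<in> carrier R" "a' \<in> carrier R" "d' \<in> carrier R"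
  shows "(a \<oplus> (s \<odot> b \<oplus> (t \<odot> c \<oplus> d))) \<oplus> (a' \<oplus> ((-t) \<odot> c \<oplus> ((-s) \<odot> b \<oplus> d'))) = (a \<oplus> a') \<oplus> (d \<oplus> d')"
proof -
  have z: "s \<odot> b \<oplus> (-s) \<odot> b = \<zero>" "t \<odot> c \<oplus> (-t) \<odot> c = \<zero>"
    using assms add_smult[of b s "-s"] add_smult[of c t "-t"] by auto
  have "(a \<oplus> (s \<odot> b \<oplus> (t \<odot> c \<oplus> d))) \<oplus> (a' \<oplus> ((-t) \<odot> c \<oplus> ((-s) \<odot> b \<oplus> d'))) =
     ((a \<oplus> a') \<oplus> (d \<oplus> d')) \<oplus> ((s \<odot> b \<oplus> (-s) \<odot> b) \<oplus> (t \<odot> c \<oplus> (-t) \<odot> c))"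
    using assms by (simp add: a_ac)
  then show ?thesis using z assms by simp
qed

lemma (in abelian_monoid) finsum_swap:
  assumes "finite I" "finite J" "\<And>i j. i \<in> I \<Longrightarrow> j \<in> J \<Longrightarrow> f i j \<in> carrier G"
  shows "(\<Oplus>i\<in>I. \<Oplus>j\<in>J. f i j) = (\<Oplus>j\<in>J. \<Oplus>i\<in>I. f i j)"
  using assms(1,3)
proof (induction I rule: finite_induct)
  case empty
  then show ?case by (simp add: finsum_zero)
next
  case (insert i I)
  have "(\<Oplus>i\<in>insert i I. \<Oplus>j\<in>J. f i j) = (\<Oplus>j\<in>J. f i j) \<oplus> (\<Oplus>j\<in>J. \<Oplus>i\<in>I. f i j)"
    using insert by (subst finsum_insert) (auto intro!: finsum_closed)
  also have "\<dots> = (\<Oplus>j\<in>J. f i j \<oplus> (\<Oplus>i\<in>I. f i j))"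
    using insert by (subst finsum_addf) (auto intro!: finsum_closed)
  also have "\<dots> = (\<Oplus>j\<in>J. \<Oplus>i\<in>insert i I. f i j)"
    using insert by (intro finsum_cong') (auto intro!: finsum_closed)
  finally show ?case .
qed

lemma (in ring) finsum_delta:
  assumes "finite I" "i \<in> I" "\<And>j. j \<in> I \<Longrightarrow> f j \<in> carrier R"
  shows "(\<Oplus>j\<in>I. (if j = i then \<one> else \<zero>) \<otimes> f j) = f i"
proof -
  have "(\<Oplus>j\<in>I. (if j = i then \<one> else \<zero>) \<otimes> f j) = (\<Oplus>j\<in>I. if i = j then f j else \<zero>)"
    using assms by (intro finsum_cong') auto
  also have "\<dots> = f i" using assms by (intro add.finprod_singleton) auto
  finally show ?thesis .
qed

lemma (in abelian_group) finsum_bits: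
  assumes "\<And>p. g p \<in> carrier G"
  shows "finsum G g {0, 1 :: bit} = g 0 \<oplus> g 1"
  using assms by (simp add: finsum_insert)

context superalg_sheaf
begin

lemma vf_part_res:
  assumes W: "W \<in> opens M U" and D: "D \<in> vf_carrier M A U"
  shows "vf_part M A W p (vf_res M W D) = vf_res M W (vf_part M A U p D)"
proof -
  obtain D0 D1 where D: "D0 \<in> hder M A U p" "D1 \<in> hder M A U (p + 1)" "D = vf_add M A U D0 D1"
    using vf_carrierE[OF D] .
  have "vf_part M A W p (vf_res M W D) = vf_res M W D0"
    using D W by (intro vf_part_eqI) (auto intro: hder_vf_res simp: vf_res_add)
  then show ?thesis using vf_part_eqI[OF D] by simp
qed

text \<open>A single summand of \<open>bracket\<close>, named so that linearity can be proved
  summand by summand.\<close>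

definition bracket_component ::
    "'x set \<Rightarrow> ('x, 'a) vfield \<Rightarrow> ('x, 'a) vfield \<Rightarrow> 'x set \<Rightarrow> 'a \<Rightarrow> bit \<Rightarrow> bit \<Rightarrow> 'a"
  where "bracket_component U D E V f p q =
         vf_part M A U p D V (vf_part M A U q E V f) \<ominus>\<^bsub>sec A V\<^esub>
         (psgn (p * q) \<odot>\<^bsub>sec A V\<^esub> vf_part M A U q E V (vf_part M A U p D V f))"

lemma bracket_apply: "V \<in> opens M U \<Longrightarrow> f \<in> C V \<Longrightarrow>
  bracket M A U D E V f = (\<Oplus>\<^bsub>sec A V\<^esub>p\<in>{0, 1}. \<Oplus>\<^bsub>sec A V\<^esub>q\<in>{0, 1}. bracket_component U D E V f p q)"
  by (simp add: bracket_def bracket_component_def)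

text \<open>The commutator obeys the domain convention for arbitrary arguments. Hence it falls under
  \<open>field_of_lin_field\<close>, and its additivity can be tested value by value before it is
  known to be a field.\<close>

lemma bracket_ext: "bracket M A U D E = field_of U (bracket M A U D E)"
  unfolding bracket_def field_of_def by (rule ext) (auto simp: restrict_def)

lemma vf_part_lf: "D \<in> vf_carrier M A U \<Longrightarrow> vf_part M A U p D \<in> lin_field U"
  using vf_part_closed hder_lin_field by blast

lemma bracket_component_closed:
  assumes "D \<in> vf_carrier M A U" "E \<in> vf_carrier M A U" "V \<in> opens M U" "f \<in> C V"
  shows "bracket_component U D E V f p q \<in> C V"
proof -
  interpret V: superalg "sec A V" "par A V" using superalg assms(3) .
  show ?thesis
    using assms by (auto simp: bracket_component_def lf_closed[OF vf_part_lf])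
qed

lemma bracket_component_add_left:
  assumes "D \<in> vf_carrier M A U" "D' \<in> vf_carrier M A U" "E \<in> vf_carrier M A U" "V \<in> opens M U" "f \<in> C V"
  shows "bracket_component U (vf_add M A U D D') E V f p q =
    bracket_component U D E V f p q \<oplus>\<^bsub>sec A V\<^esub> bracket_component U D' E V f p q"
proof -
  interpret V: superalg "sec A V" "par A V" using superalg assms(4) .
  show ?thesis
    using assms
    by (simp add: bracket_component_def vf_part_add lf_closed[OF vf_part_lf] lf_add[OF vf_part_lf]
       V.diff_conv V.smult_add V.a_ac)
qed

lemma bracket_component_add_right:
  assumes "D \<in> vf_carrier M A U" "E' \<in> vf_carrier M A U" "E \<in> vf_carrier M A U" "V \<in> opens M U" "f \<in> C V"
  shows "bracket_component U D (vf_add M A U E E') V f p q =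
    bracket_component U D E V f p q \<oplus>\<^bsub>sec A V\<^esub> bracket_component U D E' V f p q"
proof -
  interpret V: superalg "sec A V" "par A V" using superalg assms(4) .
  show ?thesis
    using assms
    by (simp add: bracket_component_def vf_part_add lf_closed[OF vf_part_lf] lf_add[OF vf_part_lf]
       V.diff_conv V.smult_add V.a_ac)
qed

text \<open>A homogeneous field has only one nonzero component, so at most one of the four summands
  survives.\<close>

lemma bracket_hder_apply:
  assumes D: "D \<in> hder M A U p" and E: "E \<in> hder M A U q" and V: "V \<in> opens M U" and f: "f \<in> C V"
  shows "bracket M A U D E V f =
    D V (E V f) \<oplus>\<^bsub>sec A V\<^esub> (- psgn (p * q)) \<odot>\<^bsub>sec A V\<^esub> E V (D V f)"
proof -
  interpret V: superalg "sec A V" "par A V" using superalg V .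
  have l: "D \<in> lin_field U" "E \<in> lin_field U" using D E hder_lin_field by auto
  have T: "bracket_component U D E V f r s = (if r = p \<and> s = q then
     D V (E V f) \<oplus>\<^bsub>sec A V\<^esub> (- psgn (p * q)) \<odot>\<^bsub>sec A V\<^esub> E V (D V f) else \<zero>\<^bsub>sec A V\<^esub>)" for r s
    using V f l by (auto simp: bracket_component_def vf_part_hder[OF D] vf_part_hder[OF E] lf_closed lf_zero V.diff_conv)
  have c: "D V (E V f) \<in> C V" "E V (D V f) \<in> C V" using V f l by (auto simp: lf_closed)
  then have "bracket M A U D E V f = bracket_component U D E V f 0 0 \<oplus>\<^bsub>sec A V\<^esub> bracket_component U D E V f 0 1 \<oplus>\<^bsub>sec A V\<^esub>
    (bracket_component U D E V f 1 0 \<oplus>\<^bsub>sec A V\<^esub> bracket_component U D E V f 1 1)"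
    using V f by (simp add: bracket_apply V.finsum_bits T)
  then show ?thesis using c by (cases p; cases q) (simp_all add: T)
qed

lemma bracket_add_left:
  assumes "D \<in> vf_carrier M A U" "D' \<in> vf_carrier M A U" "E \<in> vf_carrier M A U"
  shows "bracket M A U (vf_add M A U D D') E = vf_add M A U (bracket M A U D E) (bracket M A U D' E)"
proof -
  have "bracket M A U (vf_add M A U D D') E V f = vf_add M A U (bracket M A U D E) (bracket M A U D' E) V f"
    if V: "V \<in> opens M U" and f: "f \<in> C V" for V f
  proof -
    interpret V: superalg "sec A V" "par A V" using superalg V .
    show ?thesis using assms V f
      by (simp add: bracket_apply V.finsum_bits bracket_component_closed bracket_component_add_left vf_carrier_add V.a_ac)
  qed
  then show ?thesis
    unfolding vf_add_field_of by (subst bracket_ext) (auto simp: field_of_def restrict_def fun_eq_iff)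
qed

lemma bracket_add_right:
  assumes "D \<in> vf_carrier M A U" "E' \<in> vf_carrier M A U" "E \<in> vf_carrier M A U"
  shows "bracket M A U D (vf_add M A U E E') = vf_add M A U (bracket M A U D E) (bracket M A U D E')"
proof -
  have "bracket M A U D (vf_add M A U E E') V f = vf_add M A U (bracket M A U D E) (bracket M A U D E') V f"
    if V: "V \<in> opens M U" and f: "f \<in> C V" for V f
  proof -
    interpret V: superalg "sec A V" "par A V" using superalg V .
    show ?thesis using assms V f
      by (simp add: bracket_apply V.finsum_bits bracket_component_closed bracket_component_add_right vf_carrier_add V.a_ac)
  qed
  then show ?thesis
    unfolding vf_add_field_of by (subst bracket_ext) (auto simp: field_of_def restrict_def fun_eq_iff)
qed

lemma bracket_hder:
  assumes D: "D \<in> hder M A U p" and E: "E \<in> hder M A U q"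
  shows "bracket M A U D E \<in> hder M A U (p + q)"
proof (rule hderI)
  have l: "D \<in> lin_field U" "E \<in> lin_field U" using D E hder_lin_field by auto
  show "bracket M A U D E \<in> lin_field U"
  proof (subst bracket_ext, rule field_of_lin_field)
    fix V f assume V: "V \<in> opens M U" and f: "f \<in> C V"
    interpret V: superalg "sec A V" "par A V" using superalg V .
    note b = bracket_hder_apply[OF D E V]
    show "bracket M A U D E V f \<in> C V" using V f l by (simp add: b lf_closed)
    show "bracket M A U D E V (c \<odot>\<^bsub>sec A V\<^esub> f) = c \<odot>\<^bsub>sec A V\<^esub> bracket M A U D E V f" for c
      using V f l by (simp add: b lf_closed lf_smult V.smult_add mult.commute)
    show "bracket M A U D E V (f \<oplus>\<^bsub>sec A V\<^esub> h) = bracket M A U D E V f \<oplus>\<^bsub>sec A V\<^esub> bracket M A U D E V h"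
      if "h \<in> C V" for h
      using V f that l by (simp add: b lf_closed lf_add V.smult_add V.a_ac)
    show "res A V W (bracket M A U D E V f) = bracket M A U D E W (res A V W f)"
      if W: "W \<in> opens M V" for W
      using V f l W opens_trans[OF V W]
      by (simp add: b lf_closed lf_res bracket_hder_apply[OF D E] res_closed[OF opens_open[OF V] W]
         res_add[OF opens_open[OF V] W] res_smult[OF opens_open[OF V] W])
  qed
  fix V r f assume V: "V \<in> opens M U" and f: "f \<in> par A V r"
  interpret V: superalg "sec A V" "par A V" using superalg V .
  note b = bracket_hder_apply[OF D E V]
  have fC: "f \<in> C V" using f V.par_closed by simp
  have Df: "D V f \<in> par A V (p + r)" "E V f \<in> par A V (q + r)"
    using hder_par[OF D V f] hder_par[OF E V f] .
  have "D V (E V f) \<in> par A V (p + (q + r))" "E V (D V f) \<in> par A V (q + (p + r))"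
    using hder_par[OF D V Df(2)] hder_par[OF E V Df(1)] .
  then show "bracket M A U D E V f \<in> par A V (p + q + r)"
    using fC by (simp add: b add_ac V.par_add V.par_smult)
  fix g assume g: "g \<in> C V"
  \<comment> \<open>Expanding twice by Leibniz, a and d are the pure terms of D E, a' and d' those
    of the signed E D, while b' and c are the mixed terms common to both.\<close>
  define a b' c d a' d' where "a = D V (E V f) \<otimes>\<^bsub>sec A V\<^esub> g"
    and "b' = E V f \<otimes>\<^bsub>sec A V\<^esub> D V g" and "c = D V f \<otimes>\<^bsub>sec A V\<^esub> E V g"
    and "d = psgn ((p + q) * r) \<odot>\<^bsub>sec A V\<^esub> (f \<otimes>\<^bsub>sec A V\<^esub> D V (E V g))"
    and "a' = (- psgn (p * q)) \<odot>\<^bsub>sec A V\<^esub> (E V (D V f) \<otimes>\<^bsub>sec A V\<^esub> g)"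
    and "d' = (psgn ((p + q) * r) * (- psgn (p * q))) \<odot>\<^bsub>sec A V\<^esub> (f \<otimes>\<^bsub>sec A V\<^esub> E V (D V g))"
  note defs = a_def b'_def c_def d_def a'_def d'_def
  have C: "a \<in> C V" "b' \<in> C V" "c \<in> C V" "d \<in> C V" "a' \<in> C V" "d' \<in> C V"
    using fC g V l by (auto simp: defs lf_closed)
  define s t where "s = psgn (p * (q + r))" and "t = psgn (q * r)"
  have DE: "D V (E V (f \<otimes>\<^bsub>sec A V\<^esub> g)) = a \<oplus>\<^bsub>sec A V\<^esub> (s \<odot>\<^bsub>sec A V\<^esub> b' \<oplus>\<^bsub>sec A V\<^esub> (t \<odot>\<^bsub>sec A V\<^esub> c \<oplus>\<^bsub>sec A V\<^esub> d))"
    using fC g V l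
    by (simp add: hder_Leibniz[OF E V f] lf_closed lf_add lf_smult hder_Leibniz[OF D V f]
        hder_Leibniz[OF D V Df(2)] defs s_def t_def V.smult_add V.a_ac distrib_right distrib_left psgn_add mult.commute)
  \<comment> \<open>The prefactor -(-1)^{pq} turns the signs (-1)^{q(p+r)} of c and (-1)^{pr} of b'
    into -t and -s.\<close>
  have ED: "(- psgn (p * q)) \<odot>\<^bsub>sec A V\<^esub> E V (D V (f \<otimes>\<^bsub>sec A V\<^esub> g)) =
     a' \<oplus>\<^bsub>sec A V\<^esub> ((-t) \<odot>\<^bsub>sec A V\<^esub> c \<oplus>\<^bsub>sec A V\<^esub> ((-s) \<odot>\<^bsub>sec A V\<^esub> b' \<oplus>\<^bsub>sec A V\<^esub> d'))"
    using fC g V l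
    by (simp add: hder_Leibniz[OF E V f] lf_closed lf_add lf_smult hder_Leibniz[OF D V f]
        hder_Leibniz[OF E V Df(1)] defs s_def t_def V.smult_add V.a_ac distrib_right distrib_left psgn_add mult_ac)
  have "bracket M A U D E V (f \<otimes>\<^bsub>sec A V\<^esub> g) = (a \<oplus>\<^bsub>sec A V\<^esub> a') \<oplus>\<^bsub>sec A V\<^esub> (d \<oplus>\<^bsub>sec A V\<^esub> d')"
    using fC g unfolding b[OF V.m_closed[OF fC g]] DE ED by (simp add: V.cancel_cross_terms[OF C])
  also have "\<dots> = bracket M A U D E V f \<otimes>\<^bsub>sec A V\<^esub> g \<oplus>\<^bsub>sec A V\<^esub>
      psgn ((p + q) * r) \<odot>\<^bsub>sec A V\<^esub> (f \<otimes>\<^bsub>sec A V\<^esub> bracket M A U D E V g)"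
    using fC g V l by (simp add: b lf_closed V.l_distr V.r_distr V.smult_add defs)
  finally show "bracket M A U D E V (f \<otimes>\<^bsub>sec A V\<^esub> g) = bracket M A U D E V f \<otimes>\<^bsub>sec A V\<^esub> g \<oplus>\<^bsub>sec A V\<^esub>
      psgn ((p + q) * r) \<odot>\<^bsub>sec A V\<^esub> (f \<otimes>\<^bsub>sec A V\<^esub> bracket M A U D E V g)" .
qed

lemma bracket_closed:
  assumes "D \<in> vf_carrier M A U" "E \<in> vf_carrier M A U"
  shows "bracket M A U D E \<in> vf_carrier M A U"
proof -
  obtain D0 D1 where D: "D0 \<in> hder M A U 0" "D1 \<in> hder M A U (0 + 1)" "D = vf_add M A U D0 D1"
    using vf_carrierE[OF assms(1)] .
  obtain E0 E1 where E: "E0 \<in> hder M A U 0" "E1 \<in> hder M A U (0 + 1)" "E = vf_add M A U E0 E1"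
    using vf_carrierE[OF assms(2)] .
  note h = D(1,2)[THEN hder_vf_carrier] E(1,2)[THEN hder_vf_carrier]
  have "bracket M A U D' E' \<in> vf_carrier M A U" if "D' \<in> {D0, D1}" "E' \<in> {E0, E1}" for D' E'
    using that bracket_hder D(1,2) E(1,2) by (blast intro: hder_vf_carrier)
  then show ?thesis
    using h unfolding D(3) E(3)
    by (simp add: bracket_add_left bracket_add_right vf_carrier_add)
qed

lemma bracket_res:
  assumes W: "W \<in> opens M U" and D: "D \<in> vf_carrier M A U" and E: "E \<in> vf_carrier M A U"
  shows "vf_res M W (bracket M A U D E) = bracket M A W (vf_res M W D) (vf_res M W E)"
  unfolding bracket_def vf_res_def[of _ _ "restrict _ _"]
  using opens_trans[OF W]
  by (intro restrict_ext) (simp add: vf_part_res[OF W D] vf_part_res[OF W E])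

lemma bracket_lmult_right:
  assumes U: "openin M U" and D: "D \<in> hder M A U p" and f: "f \<in> par A U q" and E: "E \<in> hder M A U r"
  shows "bracket M A U D (lmult U f E) =
    vf_add M A U (lmult U (D U f) E) (rmult U (psgn (p * q)) (lmult U f (bracket M A U D E)))"
proof (rule lf_eqI)
  interpret U: superalg "sec A U" "par A U" using superalg' U .
  have fC: "f \<in> C U" using f U.par_closed by simp
  have fE: "lmult U f E \<in> hder M A U (q + r)" using hder_lmult[OF E U f] .
  have l: "D \<in> lin_field U" "E \<in> lin_field U" using D E hder_lin_field by auto
  have Df: "D U f \<in> C U" using l fC U by (simp add: lf_closed)
  have lb: "bracket M A U D E \<in> lin_field U" using bracket_hder[OF D E] hder_lin_field by auto
  show "bracket M A U D (lmult U f E) \<in> lin_field U" using bracket_hder[OF D fE] hder_lin_field by auto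
  show "vf_add M A U (lmult U (D U f) E) (rmult U (psgn (p * q)) (lmult U f (bracket M A U D E))) \<in> lin_field U"
    using l lb fC U Df by (auto intro!: lf_vf_add lf_lmult lf_rmult)
  fix V h assume V: "V \<in> opens M U" and h: "h \<in> C V"
  interpret V: superalg "sec A V" "par A V" using superalg V .
  have fV: "res A U V f \<in> par A V q" "res A U V f \<in> C V" using res_par[OF U V f] res_closed[OF U V fC] by auto
  have r: "res A U V (D U f) = D V (res A U V f)" using l U V fC by (simp add: lf_res)
  show "bracket M A U D (lmult U f E) V h = vf_add M A U (lmult U (D U f) E)
      (rmult U (psgn (p * q)) (lmult U f (bracket M A U D E))) V h"
    using V h l fV
    by (simp add: bracket_hder_apply[OF D fE] bracket_hder_apply[OF D E] lf_closed hder_Leibniz[OF D V fV(1)] r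
      V.smult_add V.r_distr V.a_ac distrib_left psgn_add)
qed

text \<open>A connection is linear in its lower argument, the commutator is not. The remainder E(f)
  D found here is the source of the term D(f) in the divergence.\<close>

lemma bracket_lmult_left:
  assumes U: "openin M U" and D: "D \<in> hder M A U p" and f: "f \<in> par A U q" and E: "E \<in> hder M A U r"
  shows "bracket M A U (lmult U f D) E =
    vf_add M A U (lmult U f (bracket M A U D E)) (rmult U (- psgn ((q + p) * r)) (lmult U (E U f) D))"
proof (rule lf_eqI)
  interpret U: superalg "sec A U" "par A U" using superalg' U .
  have fC: "f \<in> C U" using f U.par_closed by simp
  have fD: "lmult U f D \<in> hder M A U (q + p)" using hder_lmult[OF D U f] .
  have l: "D \<in> lin_field U" "E \<in> lin_field U" using D E hder_lin_field by auto
  have Ef: "E U f \<in> C U" using l fC U by (simp add: lf_closed)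
  have lb: "bracket M A U D E \<in> lin_field U" using bracket_hder[OF D E] hder_lin_field by auto
  show "bracket M A U (lmult U f D) E \<in> lin_field U" using bracket_hder[OF fD E] hder_lin_field by auto
  show "vf_add M A U (lmult U f (bracket M A U D E)) (rmult U (- psgn ((q + p) * r)) (lmult U (E U f) D)) \<in> lin_field U"
    using l lb fC U Ef by (auto intro!: lf_vf_add lf_lmult lf_rmult)
  fix V h assume V: "V \<in> opens M U" and h: "h \<in> C V"
  interpret V: superalg "sec A V" "par A V" using superalg V .
  have fV: "res A U V f \<in> par A V q" "res A U V f \<in> C V" using res_par[OF U V f] res_closed[OF U V fC] by auto
  have r: "res A U V (E U f) = E V (res A U V f)" using l U V fC by (simp add: lf_res)
  show "bracket M A U (lmult U f D) E V h = vf_add M A U (lmult U f (bracket M A U D E))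
      (rmult U (- psgn ((q + p) * r)) (lmult U (E U f) D)) V h"
    using V h l fV
    by (simp add: bracket_hder_apply[OF fD E] bracket_hder_apply[OF D E] lf_closed hder_Leibniz[OF E V fV(1)] r
      V.smult_add V.r_distr V.a_ac distrib_left distrib_right psgn_add mult_ac)
qed

end

section \<open>Coordinates with respect to a basis\<close>

context superalg_sheaf
begin

lemma rmult_add:
  assumes "D \<in> lin_field U" "E \<in> lin_field U"
  shows "rmult U c (vf_add M A U D E) = vf_add M A U (rmult U c D) (rmult U c E)"
proof (rule lf_eqI)
  fix V f assume V: "V \<in> opens M U" and f: "f \<in> C V"
  interpret V: superalg "sec A V" "par A V" using superalg V .
  show "rmult U c (vf_add M A U D E) V f = vf_add M A U (rmult U c D) (rmult U c E) V f"
    using V f assms by (simp add: lf_closed V.smult_add)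
qed (use assms in \<open>auto intro: lf_vf_add lf_rmult\<close>)

lemma vf_part_rmult:
  assumes "D \<in> vf_carrier M A U"
  shows "vf_part M A U p (rmult U c D) = rmult U c (vf_part M A U p D)"
proof -
  obtain D0 D1 where D: "D0 \<in> hder M A U p" "D1 \<in> hder M A U (p + 1)" "D = vf_add M A U D0 D1"
    using vf_carrierE[OF assms(1)] .
  have "D0 \<in> lin_field U" "D1 \<in> lin_field U" using D hder_lin_field by auto
  then have "vf_part M A U p (rmult U c D) = rmult U c D0"
    using D by (intro vf_part_eqI) (auto intro: hder_rmult simp: rmult_add)
  then show ?thesis using vf_part_eqI[OF D] by simp
qed

lemma bracket_component_rmult:
  assumes "D \<in> vf_carrier M A U" "E \<in> vf_carrier M A U" "V \<in> opens M U" "f \<in> C V"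
  shows "bracket_component U (rmult U c D) E V f p q = c \<odot>\<^bsub>sec A V\<^esub> bracket_component U D E V f p q"
proof -
  interpret V: superalg "sec A V" "par A V" using superalg assms(3) .
  show ?thesis
    using assms
    by (simp add: bracket_component_def vf_part_rmult lf_closed[OF vf_part_lf] lf_smult[OF vf_part_lf]
       V.diff_conv V.smult_add mult.commute)
qed

lemma bracket_rmult_left:
  assumes "D \<in> vf_carrier M A U" "E \<in> vf_carrier M A U"
  shows "bracket M A U (rmult U c D) E = rmult U c (bracket M A U D E)"
proof -
  have "bracket M A U (rmult U c D) E V f = rmult U c (bracket M A U D E) V f"
    if V: "V \<in> opens M U" and f: "f \<in> C V" for V f
  proof -
    interpret V: superalg "sec A V" "par A V" using superalg V .
    show ?thesis using assms V f
      by (simp add: bracket_apply V.finsum_bits bracket_component_closed bracket_component_rmult vf_carrier_rmult V.smult_add)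
  qed
  then show ?thesis
    unfolding rmult_def by (subst bracket_ext) (auto simp: field_of_def restrict_def fun_eq_iff)
qed

section \<open>Linear combinations of fields with coefficients on the left\<close>

definition lincomb :: "'x set \<Rightarrow> nat \<Rightarrow> (nat \<Rightarrow> ('x, 'a) vfield) \<Rightarrow> (nat \<Rightarrow> 'a) \<Rightarrow> ('x, 'a) vfield"
  where "lincomb V k e c = finsum (Der M A V) (\<lambda>b. lmult V (c b) (e b)) {..<k}"

text \<open>The content of \<open>homogeneous_basis\<close> over one open set. Keeping smaller open
  sets out of it makes the change of basis plain linear algebra over the sections on V.\<close>

definition basis_at :: "'x set \<Rightarrow> nat \<Rightarrow> (nat \<Rightarrow> bit) \<Rightarrow> (nat \<Rightarrow> ('x, 'a) vfield) \<Rightarrow> bool"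
  where "basis_at V k p e \<longleftrightarrow> openin M V \<and> (\<forall>a<k. e a \<in> hder M A V (p a)) \<and>
    (\<forall>E\<in>vf_carrier M A V. \<exists>!c. c \<in> {..<k} \<rightarrow>\<^sub>E C V \<and> E = lincomb V k e c)"

lemma lincomb_cong:
  assumes "openin M V" "\<And>b. b < k \<Longrightarrow> c b = c' b" "\<And>b. b < k \<Longrightarrow> e b = e' b"
    "\<And>b. b < k \<Longrightarrow> e b \<in> vf_carrier M A V" "\<And>b. b < k \<Longrightarrow> c b \<in> C V"
  shows "lincomb V k e c = lincomb V k e' c'"
proof -
  interpret Der: abelian_group "Der M A V" by (rule Der_abelian_group)
  show ?thesis unfolding lincomb_def
    using assms by (intro Der.finsum_cong') (auto simp: Der_simps intro: vf_carrier_lmult)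
qed

lemma is_coords_lincomb:
  "is_coords M A W k e E c \<longleftrightarrow> c \<in> {..<k} \<rightarrow>\<^sub>E C W \<and> E = lincomb W k (\<lambda>b. vf_res M W (e b)) c"
  by (simp add: is_coords_def lincomb_def Der_simps)

lemma homogeneous_basis_basis_at_res:
  assumes "homogeneous_basis M A V k p e" "W \<in> opens M V"
  shows "basis_at W k p (\<lambda>b. vf_res M W (e b))"
  using assms opens_open hder_vf_res
  unfolding basis_at_def homogeneous_basis_def is_coords_lincomb Der_simps by blast

text \<open>\<open>is_coords\<close> restricts the basis fields even when the open set is the one
  they live on. By extensionality of fields this restriction is the identity.\<close>

lemma lincomb_vf_res_self:
  assumes "openin M V" "\<forall>a<k. e a \<in> hder M A V (p a)" "c \<in> {..<k} \<rightarrow>\<^sub>E C V"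
  shows "lincomb V k (\<lambda>b. vf_res M V (e b)) c = lincomb V k e c"
proof (rule lincomb_cong)
  fix b assume b: "b < k"
  then have "e b \<in> hder M A V (p b)" using assms by auto
  then show "vf_res M V (e b) = e b" using hder_lin_field by (blast intro: vf_res_self)
  then show "vf_res M V (e b) \<in> vf_carrier M A V" using \<open>e b \<in> hder M A V (p b)\<close> by (simp add: hder_vf_carrier)
  show "c b \<in> C V" using assms b by auto
qed (use assms in auto)

lemma homogeneous_basis_basis_at:
  assumes h: "homogeneous_basis M A V k p e" and V: "openin M V"
  shows "basis_at V k p e"
  unfolding basis_at_def
proof (intro conjI ballI)
  show e: "\<forall>a<k. e a \<in> hder M A V (p a)" using h by (simp add: homogeneous_basis_def)
  fix E assume "E \<in> vf_carrier M A V"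
  then have "\<exists>!c. is_coords M A V k e E c" using h V by (auto simp: homogeneous_basis_def Der_simps)
  then show "\<exists>!c. c \<in> {..<k} \<rightarrow>\<^sub>E C V \<and> E = lincomb V k e c"
    unfolding is_coords_lincomb using lincomb_vf_res_self[OF V e] by (smt (verit))
qed (use V in auto)

definition basis_coord :: "'x set \<Rightarrow> nat \<Rightarrow> (nat \<Rightarrow> ('x, 'a) vfield) \<Rightarrow> ('x, 'a) vfield \<Rightarrow> nat \<Rightarrow> 'a"
  where "basis_coord V k e E = (THE c. c \<in> {..<k} \<rightarrow>\<^sub>E C V \<and> E = lincomb V k e c)"

lemma coords_basis_coord:
  assumes "basis_at V k p e"
  shows "coords M A V k e E = basis_coord V k e E"
proof -
  have "is_coords M A V k e E c \<longleftrightarrow> c \<in> {..<k} \<rightarrow>\<^sub>E C V \<and> E = lincomb V k e c" for c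
    unfolding is_coords_lincomb
    using lincomb_vf_res_self[of V k e p c] assms by (auto simp: basis_at_def)
  then show ?thesis by (simp add: coords_def basis_coord_def)
qed

context
  fixes V and k :: nat and e
  assumes V: "openin M V" and e: "\<And>b. b < k \<Longrightarrow> e b \<in> vf_carrier M A V"
begin

lemma lincomb_closed: "(\<And>b. b < k \<Longrightarrow> c b \<in> C V) \<Longrightarrow> lincomb V k e c \<in> vf_carrier M A V"
  unfolding lincomb_def by (rule Der_finsum_closed) (use V e in \<open>auto intro: vf_carrier_lmult\<close>)

lemma lincomb_apply:
  assumes "\<And>b. b < k \<Longrightarrow> c b \<in> C V" "W \<in> opens M V" "f \<in> C W"
  shows "lincomb V k e c W f = (\<Oplus>\<^bsub>sec A W\<^esub>b\<in>{..<k}. res A V W (c b) \<otimes>\<^bsub>sec A W\<^esub> e b W f)"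
  unfolding lincomb_def using assms V e
  by (subst Der_finsum_apply) (auto intro: vf_carrier_lmult)

lemma lincomb_apply_closed:
  assumes "\<And>b. b < k \<Longrightarrow> c b \<in> C V" "W \<in> opens M V" "f \<in> C W" "b < k"
  shows "res A V W (c b) \<otimes>\<^bsub>sec A W\<^esub> e b W f \<in> C W"
proof -
  interpret W: superalg "sec A W" "par A W" using superalg assms(2) .
  have "e b \<in> lin_field V" using e[OF assms(4)] vf_carrier_lin_field by blast
  then show ?thesis using res_closed[OF V assms(2) assms(1)[OF assms(4)]] assms(2,3)
    by (simp add: lf_closed)
qed

lemma lincomb_add:
  assumes "\<And>b. b < k \<Longrightarrow> c b \<in> C V" "\<And>b. b < k \<Longrightarrow> d b \<in> C V"
  shows "lincomb V k e (\<lambda>b. c b \<oplus>\<^bsub>sec A V\<^esub> d b) = vf_add M A V (lincomb V k e c) (lincomb V k e d)"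
proof (rule lf_eqI)
  interpret V: superalg "sec A V" "par A V" using superalg' V .
  note l = vf_carrier_lin_field[THEN subsetD]
  show "lincomb V k e (\<lambda>b. c b \<oplus>\<^bsub>sec A V\<^esub> d b) \<in> lin_field V"
    "vf_add M A V (lincomb V k e c) (lincomb V k e d) \<in> lin_field V"
    using assms by (auto intro!: l lincomb_closed vf_carrier_add)
  fix W f assume W: "W \<in> opens M V" and f: "f \<in> C W"
  interpret W: superalg "sec A W" "par A W" using superalg W .
  have "e b W f \<in> C W" if "b < k" for b using lf_closed[OF l[OF e[OF that]] W f] .
  then show "lincomb V k e (\<lambda>b. c b \<oplus>\<^bsub>sec A V\<^esub> d b) W f = vf_add M A V (lincomb V k e c) (lincomb V k e d) W f"
    using assms W f V
    by (simp add: lincomb_apply lincomb_apply_closed flip: W.finsum_addf)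
      (intro W.finsum_cong', auto simp: res_add res_closed W.l_distr)
qed

text \<open>Coefficients stand on the left, so left multiplication passes through by associativity
  and produces no sign.\<close>

lemma lincomb_lmult:
  assumes "\<And>b. b < k \<Longrightarrow> c b \<in> C V" "g \<in> C V"
  shows "lincomb V k e (\<lambda>b. g \<otimes>\<^bsub>sec A V\<^esub> c b) = lmult V g (lincomb V k e c)"
proof (rule lf_eqI)
  interpret V: superalg "sec A V" "par A V" using superalg' V .
  note l = vf_carrier_lin_field[THEN subsetD]
  show "lincomb V k e (\<lambda>b. g \<otimes>\<^bsub>sec A V\<^esub> c b) \<in> lin_field V"
    "lmult V g (lincomb V k e c) \<in> lin_field V"
    using assms V by (auto intro!: l lincomb_closed vf_carrier_lmult)
  fix W f assume W: "W \<in> opens M V" and f: "f \<in> C W"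
  interpret W: superalg "sec A W" "par A W" using superalg W .
  have "e b W f \<in> C W" if "b < k" for b using lf_closed[OF l[OF e[OF that]] W f] .
  then show "lincomb V k e (\<lambda>b. g \<otimes>\<^bsub>sec A V\<^esub> c b) W f = lmult V g (lincomb V k e c) W f"
    using assms W f V
    by (simp add: lincomb_apply lincomb_apply_closed W.finsum_rdistr res_closed)
      (intro W.finsum_cong', auto simp: res_mult res_closed W.m_assoc)
qed

lemma lincomb_rmult:
  assumes "\<And>b. b < k \<Longrightarrow> c b \<in> C V"
  shows "lincomb V k e (\<lambda>b. r \<odot>\<^bsub>sec A V\<^esub> c b) = rmult V r (lincomb V k e c)"
proof (rule lf_eqI)
  interpret V: superalg "sec A V" "par A V" using superalg' V .
  note l = vf_carrier_lin_field[THEN subsetD]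
  show "lincomb V k e (\<lambda>b. r \<odot>\<^bsub>sec A V\<^esub> c b) \<in> lin_field V"
    "rmult V r (lincomb V k e c) \<in> lin_field V"
    using assms V by (auto intro!: l lincomb_closed vf_carrier_rmult)
  fix W f assume W: "W \<in> opens M V" and f: "f \<in> C W"
  interpret W: superalg "sec A W" "par A W" using superalg W .
  have "e b W f \<in> C W" if "b < k" for b using lf_closed[OF l[OF e[OF that]] W f] .
  then show "lincomb V k e (\<lambda>b. r \<odot>\<^bsub>sec A V\<^esub> c b) W f = rmult V r (lincomb V k e c) W f"
    using assms W f V
    by (simp add: lincomb_apply lincomb_apply_closed, subst W.smult_finsum)
      (auto intro!: W.finsum_cong' simp: res_smult res_closed)
qed

end

section \<open>Coordinates of a field in a fixed homogeneous basis\<close>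

context
  fixes V and k :: nat and p e
  assumes basis: "basis_at V k p e"
begin

lemma basis_open: "openin M V" using basis by (simp add: basis_at_def)

lemma basis_hder: "b < k \<Longrightarrow> e b \<in> hder M A V (p b)" using basis by (simp add: basis_at_def)

lemma basis_vf: "b < k \<Longrightarrow> e b \<in> vf_carrier M A V" using basis_hder hder_vf_carrier by blast

lemma basis_coord_spec:
  assumes "E \<in> vf_carrier M A V"
  shows "basis_coord V k e E \<in> {..<k} \<rightarrow>\<^sub>E C V" "lincomb V k e (basis_coord V k e E) = E"
proof -
  have "\<exists>!c. c \<in> {..<k} \<rightarrow>\<^sub>E C V \<and> E = lincomb V k e c" using basis assms by (simp add: basis_at_def)
  from theI'[OF this] show "basis_coord V k e E \<in> {..<k} \<rightarrow>\<^sub>E C V" "lincomb V k e (basis_coord V k e E) = E"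
    by (simp_all add: basis_coord_def)
qed

lemma basis_coord_closed: "E \<in> vf_carrier M A V \<Longrightarrow> b < k \<Longrightarrow> basis_coord V k e E b \<in> C V"
  using basis_coord_spec(1) by auto

lemma basis_coord_eqI:
  assumes c: "\<And>b. b < k \<Longrightarrow> c b \<in> C V" and E: "E = lincomb V k e c" and b: "b < k"
  shows "basis_coord V k e E b = c b"
proof -
  have EV: "E \<in> vf_carrier M A V" using lincomb_closed[OF basis_open basis_vf c] E by simp
  \<comment> \<open>Coordinates are unique only among functions that are \<open>undefined\<close>
    from k on, so c is first cut down to the index range.\<close>
  have "E = lincomb V k e (restrict c {..<k})"
    unfolding E by (rule lincomb_cong) (use basis_open basis_vf c in auto)
  moreover have "restrict c {..<k} \<in> {..<k} \<rightarrow>\<^sub>E C V" using c by auto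
  moreover have "\<exists>!c. c \<in> {..<k} \<rightarrow>\<^sub>E C V \<and> E = lincomb V k e c" using basis EV by (simp add: basis_at_def)
  ultimately have "basis_coord V k e E = restrict c {..<k}" using basis_coord_spec[OF EV] by metis
  then show ?thesis using b by simp
qed

lemma basis_coord_add:
  assumes "E \<in> vf_carrier M A V" "F \<in> vf_carrier M A V" "b < k"
  shows "basis_coord V k e (vf_add M A V E F) b = basis_coord V k e E b \<oplus>\<^bsub>sec A V\<^esub> basis_coord V k e F b"
proof -
  interpret V: superalg "sec A V" "par A V" using superalg' basis_open .
  show ?thesis
    by (rule basis_coord_eqI) (use assms basis_coord_spec(2) in \<open>auto simp: basis_coord_closed lincomb_add[OF basis_open basis_vf]\<close>)
qed

lemma basis_coord_rmult:
  assumes "E \<in> vf_carrier M A V" "b < k"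
  shows "basis_coord V k e (rmult V r E) b = r \<odot>\<^bsub>sec A V\<^esub> basis_coord V k e E b"
proof -
  interpret V: superalg "sec A V" "par A V" using superalg' basis_open .
  show ?thesis
    by (rule basis_coord_eqI) (use assms basis_coord_spec(2) in \<open>auto simp: basis_coord_closed lincomb_rmult[OF basis_open basis_vf]\<close>)
qed

lemma basis_coord_lmult:
  assumes "E \<in> vf_carrier M A V" "b < k" "g \<in> C V"
  shows "basis_coord V k e (lmult V g E) b = g \<otimes>\<^bsub>sec A V\<^esub> basis_coord V k e E b"
proof -
  interpret V: superalg "sec A V" "par A V" using superalg' basis_open .
  show ?thesis
    by (rule basis_coord_eqI) (use assms basis_coord_spec(2) in \<open>auto simp: basis_coord_closed lincomb_lmult[OF basis_open basis_vf]\<close>)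
qed

text \<open>Coordinates are left linear, so those of a combination of any other family are a matrix
  product. This is the form in which a change of basis uses it.\<close>

lemma basis_coord_lincomb:
  assumes "b < k" "\<And>a. a < k' \<Longrightarrow> c a \<in> C V" "\<And>a. a < k' \<Longrightarrow> e' a \<in> vf_carrier M A V"
  shows "basis_coord V k e (lincomb V k' e' c) b = (\<Oplus>\<^bsub>sec A V\<^esub>a\<in>{..<k'}. c a \<otimes>\<^bsub>sec A V\<^esub> basis_coord V k e (e' a) b)"
proof -
  interpret V: superalg "sec A V" "par A V" using superalg' basis_open .
  have "basis_coord V k e (lincomb V k' e' c) b = (\<Oplus>\<^bsub>sec A V\<^esub>a\<in>{..<k'}. basis_coord V k e (lmult V (c a) (e' a)) b)"
    unfolding lincomb_def
    by (rule additive_finsum[OF Der_abelian_group V.is_abelian_group])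
      (use assms basis_open in \<open>auto simp: Der_simps basis_coord_closed basis_coord_add intro: vf_carrier_lmult\<close>)
  also have "\<dots> = (\<Oplus>\<^bsub>sec A V\<^esub>a\<in>{..<k'}. c a \<otimes>\<^bsub>sec A V\<^esub> basis_coord V k e (e' a) b)"
    using assms by (intro V.finsum_cong') (auto simp: basis_coord_lmult basis_coord_closed)
  finally show ?thesis .
qed

lemma lincomb_hder:
  assumes "\<And>b. b < k \<Longrightarrow> c b \<in> par A V (q + p b)"
  shows "lincomb V k e c \<in> hder M A V q"
proof -
  have "lmult V (c b) (e b) \<in> hder M A V q" if "b < k" for b
    using hder_lmult[OF basis_hder[OF that] basis_open assms[OF that]] by (simp add: add.assoc)
  moreover have "finsum (Der M A V) D I \<in> hder M A V q"
    if "finite I" "\<And>i. i \<in> I \<Longrightarrow> D i \<in> hder M A V q" for D and I :: "nat set"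
    using that
  proof (induction I rule: finite_induct)
    interpret Der: abelian_group "Der M A V" by (rule Der_abelian_group)
    {
      case empty
      show ?case by (simp add: Der_simps hder_vf_zero)
    next
      case (insert i I)
      have "finsum (Der M A V) D (insert i I) = vf_add M A V (D i) (finsum (Der M A V) D I)"
        using insert hder_vf_carrier by (subst Der.finsum_insert) (auto simp: Der_simps)
      then show ?case using insert by (simp add: hder_vf_add)
    }
  qed
  note this[of "{..<k}" "\<lambda>b. lmult V (c b) (e b)"]
  ultimately show ?thesis unfolding lincomb_def by auto
qed

text \<open>Split each coordinate into its part of degree q + |e_b| and the rest. The first parts
  combine to the degree q component of E, which is E itself, so by uniqueness of coordinates they
  are the whole coordinates.\<close>

lemma basis_coord_par:
  assumes E: "E \<in> hder M A V q" and b: "b < k"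
  shows "basis_coord V k e E b \<in> par A V (q + p b)"
proof -
  interpret V: superalg "sec A V" "par A V" using superalg' basis_open .
  have EV: "E \<in> vf_carrier M A V" using E by (rule hder_vf_carrier)
  have El: "E \<in> lin_field V" using E hder_lin_field by auto
  have "\<exists>y z. y \<in> par A V (q + p b) \<and> z \<in> par A V (q + p b + 1) \<and> basis_coord V k e E b = y \<oplus>\<^bsub>sec A V\<^esub> z" if "b < k" for b
    using V.par_decompose[OF basis_coord_closed[OF EV that]] by metis
  then obtain y z where yz: "\<And>b. b < k \<Longrightarrow> y b \<in> par A V (q + p b)" "\<And>b. b < k \<Longrightarrow> z b \<in> par A V (q + p b + 1)"
      "\<And>b. b < k \<Longrightarrow> basis_coord V k e E b = y b \<oplus>\<^bsub>sec A V\<^esub> z b"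
    by metis
  have yC: "y b \<in> C V" "z b \<in> C V" if "b < k" for b using yz(1,2)[OF that] V.par_closed by auto
  have Y: "lincomb V k e y \<in> hder M A V q" using yz(1) by (rule lincomb_hder)
  have Z: "lincomb V k e z \<in> hder M A V (q + 1)"
    using yz(2) by (intro lincomb_hder) (simp add: add_ac)
  have "E = lincomb V k e (basis_coord V k e E)" using basis_coord_spec(2)[OF EV] by simp
  also have "\<dots> = lincomb V k e (\<lambda>b. y b \<oplus>\<^bsub>sec A V\<^esub> z b)"
    by (rule lincomb_cong) (use basis_open basis_vf yz basis_coord_closed[OF EV] in auto)
  also have "\<dots> = vf_add M A V (lincomb V k e y) (lincomb V k e z)"
    by (rule lincomb_add) (use basis_open basis_vf yC in auto)
  finally have "vf_part M A V q E = lincomb V k e y" using Y Z by (intro vf_part_eqI)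
  then have "E = lincomb V k e y" by (simp add: vf_part_hder[OF E])
  then have "basis_coord V k e E b = y b" using yC b by (intro basis_coord_eqI) auto
  then show ?thesis using yz(1) b by simp
qed

lemma basis_coord_basis:
  assumes a: "a < k" and b: "b < k"
  shows "basis_coord V k e (e a) b = (if b = a then \<one>\<^bsub>sec A V\<^esub> else \<zero>\<^bsub>sec A V\<^esub>)"
proof (rule basis_coord_eqI[OF _ _ b])
  interpret V: superalg "sec A V" "par A V" using superalg' basis_open .
  show c: "(if b = a then \<one>\<^bsub>sec A V\<^esub> else \<zero>\<^bsub>sec A V\<^esub>) \<in> C V" for b by simp
  note l = vf_carrier_lin_field[THEN subsetD]
  show "e a = lincomb V k e (\<lambda>b. if b = a then \<one>\<^bsub>sec A V\<^esub> else \<zero>\<^bsub>sec A V\<^esub>)"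
  proof (rule lf_eqI)
    show "e a \<in> lin_field V" using a by (simp add: basis_vf l)
    show "lincomb V k e (\<lambda>b. if b = a then \<one>\<^bsub>sec A V\<^esub> else \<zero>\<^bsub>sec A V\<^esub>) \<in> lin_field V"
      using c by (intro l lincomb_closed[OF basis_open basis_vf])
    fix W f assume W: "W \<in> opens M V" and f: "f \<in> C W"
    interpret W: superalg "sec A W" "par A W" using superalg W .
    have eC: "e b W f \<in> C W" if "b < k" for b using lf_closed[OF l[OF basis_vf[OF that]] W f] .
    have "lincomb V k e (\<lambda>b. if b = a then \<one>\<^bsub>sec A V\<^esub> else \<zero>\<^bsub>sec A V\<^esub>) W f =
      (\<Oplus>\<^bsub>sec A W\<^esub>b\<in>{..<k}. res A V W (if b = a then \<one>\<^bsub>sec A V\<^esub> else \<zero>\<^bsub>sec A V\<^esub>) \<otimes>\<^bsub>sec A W\<^esub> e b W f)"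
      by (rule lincomb_apply) (use basis_open basis_vf c W f in auto)
    also have "\<dots> =
      (\<Oplus>\<^bsub>sec A W\<^esub>b\<in>{..<k}. (if b = a then \<one>\<^bsub>sec A W\<^esub> else \<zero>\<^bsub>sec A W\<^esub>) \<otimes>\<^bsub>sec A W\<^esub> e b W f)"
      by (rule W.finsum_cong') (use W eC basis_open in \<open>auto simp: res_one res_zero\<close>)
    also have "\<dots> = e a W f" using eC a by (intro W.finsum_delta) auto
    finally show "e a W f = lincomb V k e (\<lambda>b. if b = a then \<one>\<^bsub>sec A V\<^esub> else \<zero>\<^bsub>sec A V\<^esub>) W f" by simp
  qed
qed

end

text \<open>\<open>basis_at\<close> over V says nothing about W, hence the separate basis hypothesis
  there. Evaluated on sections over a smaller open set, both expansions are the same sum, since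
  restricting a field only drops members of the family.\<close>

lemma basis_coord_res:
  assumes basis: "basis_at V k p e" and W: "W \<in> opens M V" and basisW: "basis_at W k p (\<lambda>b. vf_res M W (e b))"
    and E: "E \<in> vf_carrier M A V" and b: "b < k"
  shows "basis_coord W k (\<lambda>b. vf_res M W (e b)) (vf_res M W E) b = res A V W (basis_coord V k e E b)"
proof -
  note l = vf_carrier_lin_field[THEN subsetD]
  note o = basis_open[OF basis] opens_open[OF W]
  have r: "vf_res M W (e b) \<in> vf_carrier M A W" if "b < k" for b
    using basis_vf[OF basis that] W by (simp add: vf_res_carrier)
  have c: "res A V W (basis_coord V k e E b) \<in> C W" if "b < k" for b
    using o W basis_coord_closed[OF basis E that] by (simp add: res_closed)
  have "vf_res M W E = lincomb W k (\<lambda>b. vf_res M W (e b)) (\<lambda>b. res A V W (basis_coord V k e E b))"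
  proof (rule lf_eqI)
    show "vf_res M W E \<in> lin_field W" using E W l lf_vf_res by blast
    show "lincomb W k (\<lambda>b. vf_res M W (e b)) (\<lambda>b. res A V W (basis_coord V k e E b)) \<in> lin_field W"
      by (rule l, rule lincomb_closed[OF o(2) r c])
    fix W' f assume W': "W' \<in> opens M W" and f: "f \<in> C W'"
    interpret W': superalg "sec A W'" "par A W'" using superalg W' .
    have W'V: "W' \<in> opens M V" using opens_trans[OF W W'] .
    have "vf_res M W E W' f = lincomb V k e (basis_coord V k e E) W' f"
      using W' by (simp add: basis_coord_spec(2)[OF basis E])
    also have "\<dots> = (\<Oplus>\<^bsub>sec A W'\<^esub>b\<in>{..<k}. res A V W' (basis_coord V k e E b) \<otimes>\<^bsub>sec A W'\<^esub> e b W' f)"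
      by (rule lincomb_apply[OF o(1) basis_vf[OF basis] basis_coord_closed[OF basis E] W'V f])
    also have "\<dots> = (\<Oplus>\<^bsub>sec A W'\<^esub>b\<in>{..<k}. res A W W' (res A V W (basis_coord V k e E b)) \<otimes>\<^bsub>sec A W'\<^esub> vf_res M W (e b) W' f)"
      by (rule W'.finsum_cong')
        (use W W' o(1) basis_coord_closed[OF basis E] res_closed[OF o(1) W'V] lf_closed[OF l[OF basis_vf[OF basis]] W'V f] in
           \<open>auto simp: res_res\<close>)
    also have "\<dots> = lincomb W k (\<lambda>b. vf_res M W (e b)) (\<lambda>b. res A V W (basis_coord V k e E b)) W' f"
      by (rule lincomb_apply[OF o(2) r c W' f, symmetric])
    finally show "vf_res M W E W' f = lincomb W k (\<lambda>b. vf_res M W (e b)) (\<lambda>b. res A V W (basis_coord V k e E b)) W' f" .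
  qed
  then show ?thesis
    using basis_coord_eqI[OF basisW, of "\<lambda>b. res A V W (basis_coord V k e E b)", OF c] b by simp
qed

end

section \<open>The supertrace of $\nabla_D - \mathrm{ad}_D$\<close>

text \<open>Here a is the value of D(f) E, the derivative term that the connection and the
  commutator contribute with opposite signs.\<close>

lemma (in superalg) cancel_first:
  assumes "a \<in> carrier R" "x \<in> carrier R" "y \<in> carrier R"
  shows "(a \<oplus> x) \<oplus> ((-1) \<odot> a \<oplus> y) = x \<oplus> y"
proof -
  have "(a \<oplus> x) \<oplus> ((-1) \<odot> a \<oplus> y) = (a \<oplus> (-1) \<odot> a) \<oplus> (x \<oplus> y)"
    using assms by (simp add: a_ac del: add_minus_self)
  then show ?thesis using assms by simp
qed

section \<open>Rules for a graded connection over a fixed open set\<close>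

locale graded_conn = superalg_sheaf M A
  for M :: "'x topology" and A :: "('x, 'a) superalgebra_sheaf" +
  fixes nabla :: "'x set \<Rightarrow> ('x, 'a) vfield \<Rightarrow> ('x, 'a) vfield \<Rightarrow> ('x, 'a) vfield"
  assumes conn: "graded_connection M A nabla"
begin

context
  fixes U assumes U: "openin M U"
begin

lemma nabla_linear_right: "D \<in> vf_carrier M A U \<Longrightarrow> real_linear (Der_real M A U) (Der_real M A U) (nabla U D)"
  using conn U by (simp add: graded_connection_def Der_simps)

lemma nabla_linear_left: "E \<in> vf_carrier M A U \<Longrightarrow> real_linear (Der_real M A U) (Der_real M A U) (\<lambda>D. nabla U D E)"
  using conn U by (simp add: graded_connection_def Der_simps)

lemma nabla_closed: "D \<in> vf_carrier M A U \<Longrightarrow> E \<in> vf_carrier M A U \<Longrightarrow> nabla U D E \<in> vf_carrier M A U"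
  using nabla_linear_right[of D] by (auto simp: real_linear_def Der_simps)

lemma nabla_add_right: "D \<in> vf_carrier M A U \<Longrightarrow> E \<in> vf_carrier M A U \<Longrightarrow> F \<in> vf_carrier M A U \<Longrightarrow>
   nabla U D (vf_add M A U E F) = vf_add M A U (nabla U D E) (nabla U D F)"
  using nabla_linear_right[of D] by (auto simp: real_linear_def Der_simps)

lemma nabla_add_left: "D \<in> vf_carrier M A U \<Longrightarrow> E \<in> vf_carrier M A U \<Longrightarrow> D' \<in> vf_carrier M A U \<Longrightarrow>
   nabla U (vf_add M A U D D') E = vf_add M A U (nabla U D E) (nabla U D' E)"
  using nabla_linear_left[of E] by (auto simp: real_linear_def Der_simps)

lemma nabla_rmult_left: "D \<in> vf_carrier M A U \<Longrightarrow> E \<in> vf_carrier M A U \<Longrightarrow>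
   nabla U (rmult U c D) E = rmult U c (nabla U D E)"
  using nabla_linear_left[of E] by (auto simp: real_linear_def Der_simps)

lemma nabla_hder: "D \<in> hder M A U p \<Longrightarrow> E \<in> hder M A U q \<Longrightarrow> nabla U D E \<in> hder M A U (p + q)"
  using conn U by (simp add: graded_connection_def)

lemma nabla_lmult_left: "f \<in> C U \<Longrightarrow> D \<in> vf_carrier M A U \<Longrightarrow> E \<in> vf_carrier M A U \<Longrightarrow>
    nabla U (lmult U f D) E = lmult U f (nabla U D E)"
  using conn U by (simp add: graded_connection_def Der_simps)

lemma nabla_lmult_right: "f \<in> par A U q \<Longrightarrow> D \<in> hder M A U p \<Longrightarrow> E \<in> vf_carrier M A U \<Longrightarrow>
    nabla U D (lmult U f E) = vf_add M A U (lmult U (D U f) E) (lmult U (psgn (p * q) \<odot>\<^bsub>sec A U\<^esub> f) (nabla U D E))"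
  using conn U by (simp add: graded_connection_def Der_simps)

lemma nabla_res: "W \<in> opens M U \<Longrightarrow> D \<in> vf_carrier M A U \<Longrightarrow> E \<in> vf_carrier M A U \<Longrightarrow>
    vf_res M W (nabla U D E) = nabla W (vf_res M W D) (vf_res M W E)"
  using conn U by (simp add: graded_connection_def Der_simps opens_def)

end

section \<open>The graded linear map F and its dependence on both arguments\<close>

definition nabla_ad :: "'x set \<Rightarrow> ('x, 'a) vfield \<Rightarrow> ('x, 'a) vfield \<Rightarrow> ('x, 'a) vfield"
  where "nabla_ad U D E = vf_add M A U (nabla U D E) (rmult U (-1) (bracket M A U D E))"

context
  fixes U assumes U: "openin M U"
begin

lemma nabla_ad_eq: "D \<in> vf_carrier M A U \<Longrightarrow> E \<in> vf_carrier M A U \<Longrightarrow>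
   nabla U D E \<ominus>\<^bsub>Der M A U\<^esub> bracket M A U D E = nabla_ad U D E"
  using U by (simp add: Der_diff nabla_closed bracket_closed nabla_ad_def)

lemma nabla_ad_hder: "D \<in> hder M A U p \<Longrightarrow> E \<in> hder M A U q \<Longrightarrow> nabla_ad U D E \<in> hder M A U (p + q)"
  unfolding nabla_ad_def using U by (intro hder_vf_add hder_rmult nabla_hder bracket_hder)

lemma nabla_ad_closed: "D \<in> vf_carrier M A U \<Longrightarrow> E \<in> vf_carrier M A U \<Longrightarrow> nabla_ad U D E \<in> vf_carrier M A U"
  unfolding nabla_ad_def using U by (intro vf_carrier_add vf_carrier_rmult nabla_closed bracket_closed)

lemma nabla_ad_res: "W \<in> opens M U \<Longrightarrow> D \<in> vf_carrier M A U \<Longrightarrow> E \<in> vf_carrier M A U \<Longrightarrow>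
    vf_res M W (nabla_ad U D E) = nabla_ad W (vf_res M W D) (vf_res M W E)"
  using U by (simp add: nabla_ad_def vf_res_add vf_res_rmult nabla_res bracket_res)

lemma vf_add_swap:
  assumes "a \<in> lin_field U" "b \<in> lin_field U" "c \<in> lin_field U" "d \<in> lin_field U"
  shows "vf_add M A U (vf_add M A U a b) (vf_add M A U c d) = vf_add M A U (vf_add M A U a c) (vf_add M A U b d)"
proof (rule lf_eqI)
  fix V f assume V: "V \<in> opens M U" and f: "f \<in> C V"
  interpret V: superalg "sec A V" "par A V" using superalg V .
  show "vf_add M A U (vf_add M A U a b) (vf_add M A U c d) V f = vf_add M A U (vf_add M A U a c) (vf_add M A U b d) V f"
    using V f assms by (simp add: lf_closed V.a_ac)
qed (use assms in \<open>auto intro!: lf_vf_add\<close>)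

lemma nabla_ad_add_right:
  assumes "D \<in> vf_carrier M A U" "E \<in> vf_carrier M A U" "F \<in> vf_carrier M A U"
  shows "nabla_ad U D (vf_add M A U E F) = vf_add M A U (nabla_ad U D E) (nabla_ad U D F)"
proof -
  note l = vf_carrier_lin_field[THEN subsetD]
  show ?thesis using assms U
    by (simp add: nabla_ad_def nabla_add_right bracket_add_right rmult_add l bracket_closed nabla_closed vf_add_swap lf_rmult)
qed

lemma nabla_ad_add_left:
  assumes "D \<in> vf_carrier M A U" "E \<in> vf_carrier M A U" "D' \<in> vf_carrier M A U"
  shows "nabla_ad U (vf_add M A U D D') E = vf_add M A U (nabla_ad U D E) (nabla_ad U D' E)"
proof -
  note l = vf_carrier_lin_field[THEN subsetD]
  show ?thesis using assms U
    by (simp add: nabla_ad_def nabla_add_left bracket_add_left rmult_add l bracket_closed nabla_closed vf_add_swap lf_rmult)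
qed

lemma rmult_rmult: "D \<in> lin_field U \<Longrightarrow> rmult U c (rmult U d D) = rmult U (c * d) D"
proof (rule lf_eqI)
  fix V f assume V: "V \<in> opens M U" and f: "f \<in> C V" and D: "D \<in> lin_field U"
  interpret V: superalg "sec A V" "par A V" using superalg V .
  show "rmult U c (rmult U d D) V f = rmult U (c * d) D V f"
    using V f D by (simp add: lf_closed)
qed (auto intro: lf_rmult)

lemma nabla_ad_rmult_left:
  assumes "D \<in> vf_carrier M A U" "E \<in> vf_carrier M A U"
  shows "nabla_ad U (rmult U c D) E = rmult U c (nabla_ad U D E)"
proof -
  note l = vf_carrier_lin_field[THEN subsetD]
  show ?thesis using assms U
    by (simp add: nabla_ad_def nabla_rmult_left bracket_rmult_left rmult_add l bracket_closed nabla_closed lf_rmult rmult_rmult)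
qed

lemma nabla_ad_lmult_right:
  assumes D: "D \<in> hder M A U p" and f: "f \<in> par A U q" and E: "E \<in> hder M A U r"
  shows "nabla_ad U D (lmult U f E) = lmult U (psgn (p * q) \<odot>\<^bsub>sec A U\<^esub> f) (nabla_ad U D E)"
proof (rule lf_eqI)
  interpret U: superalg "sec A U" "par A U" using superalg' U .
  note l = vf_carrier_lin_field[THEN subsetD]
  have fC: "f \<in> C U" using f U.par_closed by simp
  have c: "D \<in> vf_carrier M A U" "E \<in> vf_carrier M A U" using D E by (auto intro: hder_vf_carrier)
  note nb = nabla_closed[OF U c] bracket_closed[OF c]
  show "nabla_ad U D (lmult U f E) \<in> lin_field U" "lmult U (psgn (p * q) \<odot>\<^bsub>sec A U\<^esub> f) (nabla_ad U D E) \<in> lin_field U"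
    using c fC U by (auto intro!: l nabla_ad_closed vf_carrier_lmult)
  fix V h assume V: "V \<in> opens M U" and h: "h \<in> C V"
  interpret V: superalg "sec A V" "par A V" using superalg V .
  have fV: "res A U V f \<in> C V" using res_closed[OF U V fC] by auto
  have Df: "D U f \<in> C U" using l[OF c(1)] fC U by (simp add: lf_closed)
  have DfV: "res A U V (D U f) \<in> C V" using res_closed[OF U V Df] by auto
  show "nabla_ad U D (lmult U f E) V h = lmult U (psgn (p * q) \<odot>\<^bsub>sec A U\<^esub> f) (nabla_ad U D E) V h"
    unfolding nabla_ad_def nabla_lmult_right[OF U f D c(2)] bracket_lmult_right[OF U D f E]
    using V h fV fC DfV nb[THEN l] c[THEN l]
    by (simp add: lf_closed res_smult[OF U V] V.cancel_first V.r_distr V.smult_add)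
qed

text \<open>The connection contributes no derivative of f. The negative remainder of
  \<open>bracket_lmult_left\<close> enters through -ad and therefore becomes positive.\<close>

lemma nabla_ad_lmult_left:
  assumes D: "D \<in> hder M A U p" and f: "f \<in> par A U q" and E: "E \<in> hder M A U r"
  shows "nabla_ad U (lmult U f D) E = vf_add M A U (lmult U f (nabla_ad U D E))
    (rmult U (psgn ((q + p) * r)) (lmult U (E U f) D))"
proof (rule lf_eqI)
  interpret U: superalg "sec A U" "par A U" using superalg' U .
  note l = vf_carrier_lin_field[THEN subsetD]
  have fC: "f \<in> C U" using f U.par_closed by simp
  have c: "D \<in> vf_carrier M A U" "E \<in> vf_carrier M A U" using D E by (auto intro: hder_vf_carrier)
  note nb = nabla_closed[OF U c] bracket_closed[OF c]
  have Ef: "E U f \<in> C U" using l[OF c(2)] fC U by (simp add: lf_closed)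
  show "nabla_ad U (lmult U f D) E \<in> lin_field U" "vf_add M A U (lmult U f (nabla_ad U D E))
    (rmult U (psgn ((q + p) * r)) (lmult U (E U f) D)) \<in> lin_field U"
    using c fC U Ef by (auto intro!: l nabla_ad_closed vf_carrier_lmult vf_carrier_add vf_carrier_rmult)
  fix V h assume V: "V \<in> opens M U" and h: "h \<in> C V"
  interpret V: superalg "sec A V" "par A V" using superalg V .
  have fV: "res A U V f \<in> C V" using res_closed[OF U V fC] by auto
  have EfV: "res A U V (E U f) \<in> C V" using res_closed[OF U V Ef] by auto
  show "nabla_ad U (lmult U f D) E V h = vf_add M A U (lmult U f (nabla_ad U D E))
    (rmult U (psgn ((q + p) * r)) (lmult U (E U f) D)) V h"
    unfolding nabla_ad_def nabla_lmult_left[OF U fC c] bracket_lmult_left[OF U D f E]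
    using V h fV fC EfV nb[THEN l] c[THEN l]
    by (simp add: lf_closed V.r_distr V.smult_add V.a_ac)
qed

end

text \<open>One signed sum instead of an even and an odd one, so that signs can be tracked term by
  term under a change of basis. The argument is D, since F enters only through its values on the
  basis.\<close>

definition basis_strace :: "'x set \<Rightarrow> nat \<Rightarrow> (nat \<Rightarrow> bit) \<Rightarrow> (nat \<Rightarrow> ('x, 'a) vfield) \<Rightarrow> ('x, 'a) vfield \<Rightarrow> 'a"
  where "basis_strace V k p e D = (\<Oplus>\<^bsub>sec A V\<^esub>a\<in>{..<k}. psgn (p a) \<odot>\<^bsub>sec A V\<^esub> basis_coord V k e (nabla_ad V D (e a)) a)"

context
  fixes V and k :: nat and p e
  assumes basis: "basis_at V k p e"
begin

interpretation V: superalg "sec A V" "par A V" using superalg' basis_open[OF basis] .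

lemma nabla_ad_basis_closed: "D \<in> vf_carrier M A V \<Longrightarrow> a < k \<Longrightarrow> nabla_ad V D (e a) \<in> vf_carrier M A V"
  using basis_open[OF basis] basis_vf[OF basis] by (simp add: nabla_ad_closed)

text \<open>The even indices carry sign +1 and the odd ones -1, and together they exhaust the index
  range. F is compared with \<open>nabla_ad\<close> on the basis fields alone, because a basis
  expression sees nothing else.\<close>

lemma basis_supertrace_basis_strace:
  assumes D: "D \<in> vf_carrier M A V" and F: "\<And>a. a < k \<Longrightarrow> F (e a) = nabla_ad V D (e a)"
  shows "basis_supertrace M A V k p e F = basis_strace V k p e D"
proof -
  define t where "t a = basis_coord V k e (nabla_ad V D (e a)) a" for a
  have t: "t a \<in> C V" if "a < k" for a
    unfolding t_def using that nabla_ad_basis_closed[OF D that] by (simp add: basis_coord_closed[OF basis])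
  have f: "coords M A V k e (F (e a)) a = t a" if "a < k" for a
    using that F by (simp add: coords_basis_coord[OF basis] t_def)
  have s0: "finsum (sec A V) (\<lambda>a. coords M A V k e (F (e a)) a) {a. a < k \<and> p a = 0} =
     finsum (sec A V) (\<lambda>a. psgn (p a) \<odot>\<^bsub>sec A V\<^esub> t a) {a. a < k \<and> p a = 0}"
    by (rule V.finsum_cong') (use t f in auto)
  have s1: "finsum (sec A V) (\<lambda>a. coords M A V k e (F (e a)) a) {a. a < k \<and> p a = 1} =
     finsum (sec A V) t {a. a < k \<and> p a = 1}"
    by (rule V.finsum_cong') (use t f in auto)
  have "(-1) \<odot>\<^bsub>sec A V\<^esub> finsum (sec A V) t {a. a < k \<and> p a = 1} =
     finsum (sec A V) (\<lambda>a. (-1) \<odot>\<^bsub>sec A V\<^esub> t a) {a. a < k \<and> p a = 1}"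
    by (rule V.smult_finsum) (use t in auto)
  also have "\<dots> = finsum (sec A V) (\<lambda>a. psgn (p a) \<odot>\<^bsub>sec A V\<^esub> t a) {a. a < k \<and> p a = 1}"
    by (rule V.finsum_cong') (use t in auto)
  finally have "basis_supertrace M A V k p e F =
     finsum (sec A V) (\<lambda>a. psgn (p a) \<odot>\<^bsub>sec A V\<^esub> t a) {a. a < k \<and> p a = 0} \<oplus>\<^bsub>sec A V\<^esub>
     finsum (sec A V) (\<lambda>a. psgn (p a) \<odot>\<^bsub>sec A V\<^esub> t a) {a. a < k \<and> p a = 1}"
    unfolding basis_supertrace_def s0 s1
    by (subst V.diff_conv) (use t in \<open>auto intro!: V.finsum_closed\<close>)
  also have "\<dots> = finsum (sec A V) (\<lambda>a. psgn (p a) \<odot>\<^bsub>sec A V\<^esub> t a) ({a. a < k \<and> p a = 0} \<union> {a. a < k \<and> p a = 1})"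
    by (rule V.finsum_Un_disjoint[symmetric]) (use t in auto)
  also have "{a. a < k \<and> p a = 0} \<union> {a. a < k \<and> p a = 1} = {..<k}"
    using bit_not_zero_iff by auto
  finally show ?thesis by (simp add: basis_strace_def t_def)
qed

lemma basis_strace_term_closed: "D \<in> vf_carrier M A V \<Longrightarrow> a < k \<Longrightarrow> psgn (p a) \<odot>\<^bsub>sec A V\<^esub> basis_coord V k e (nabla_ad V D (e a)) a \<in> C V"
  using nabla_ad_basis_closed by (simp add: basis_coord_closed[OF basis])

lemma basis_strace_closed: "D \<in> vf_carrier M A V \<Longrightarrow> basis_strace V k p e D \<in> C V"
  unfolding basis_strace_def by (rule V.finsum_closed) (auto intro: basis_strace_term_closed)

lemma basis_strace_add:
  assumes D: "D \<in> vf_carrier M A V" and E: "E \<in> vf_carrier M A V"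
  shows "basis_strace V k p e (vf_add M A V D E) = basis_strace V k p e D \<oplus>\<^bsub>sec A V\<^esub> basis_strace V k p e E"
proof -
  have "basis_strace V k p e (vf_add M A V D E) = (\<Oplus>\<^bsub>sec A V\<^esub>a\<in>{..<k}.
     psgn (p a) \<odot>\<^bsub>sec A V\<^esub> basis_coord V k e (nabla_ad V D (e a)) a \<oplus>\<^bsub>sec A V\<^esub> psgn (p a) \<odot>\<^bsub>sec A V\<^esub> basis_coord V k e (nabla_ad V E (e a)) a)"
    unfolding basis_strace_def using D E basis_open[OF basis] basis_vf[OF basis]
    by (intro V.finsum_cong')
      (auto simp: nabla_ad_add_left nabla_ad_closed basis_coord_add[OF basis] basis_coord_closed[OF basis] V.smult_add)
  also have "\<dots> = basis_strace V k p e D \<oplus>\<^bsub>sec A V\<^esub> basis_strace V k p e E"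
    unfolding basis_strace_def by (rule V.finsum_addf) (use D E basis_strace_term_closed in auto)
  finally show ?thesis .
qed

lemma basis_strace_rmult:
  assumes D: "D \<in> vf_carrier M A V"
  shows "basis_strace V k p e (rmult V c D) = c \<odot>\<^bsub>sec A V\<^esub> basis_strace V k p e D"
  unfolding basis_strace_def using D basis_open[OF basis] basis_vf[OF basis]
  by (subst V.smult_finsum)
    (auto intro!: V.finsum_cong' basis_strace_term_closed
      simp: nabla_ad_rmult_left nabla_ad_closed basis_coord_rmult[OF basis] basis_coord_closed[OF basis] mult.commute)

text \<open>A diagonal entry has degree q + |e_a| + |e_a| = q.\<close>

lemma basis_strace_par:
  assumes D: "D \<in> hder M A V q"
  shows "basis_strace V k p e D \<in> par A V q"
  unfolding basis_strace_def
proof (rule V.par_finsum, rule V.par_smult)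
  fix a assume a: "a \<in> {..<k}"
  have "nabla_ad V D (e a) \<in> hder M A V (q + p a)"
    using D a basis_open[OF basis] basis_hder[OF basis] by (auto intro: nabla_ad_hder)
  from basis_coord_par[OF basis this, of a] a show "basis_coord V k e (nabla_ad V D (e a)) a \<in> par A V q"
    by (simp add: add.assoc)
qed

lemma lincomb_basis_coord_apply:
  assumes D: "D \<in> vf_carrier M A V" and f: "f \<in> C V"
  shows "(\<Oplus>\<^bsub>sec A V\<^esub>b\<in>{..<k}. basis_coord V k e D b \<otimes>\<^bsub>sec A V\<^esub> e b V f) = D V f"
proof -
  note V = basis_open[OF basis]
  have eC: "e b V f \<in> C V" if "b < k" for b
    using lf_closed[OF _ _ f, of "e b" V] basis_vf[OF basis that] vf_carrier_lin_field V by auto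
  have "D V f = lincomb V k e (basis_coord V k e D) V f" by (simp add: basis_coord_spec(2)[OF basis D])
  also have "\<dots> = (\<Oplus>\<^bsub>sec A V\<^esub>b\<in>{..<k}. res A V V (basis_coord V k e D b) \<otimes>\<^bsub>sec A V\<^esub> e b V f)"
    by (rule lincomb_apply) (use V basis_vf[OF basis] basis_coord_closed[OF basis D] f in auto)
  also have "\<dots> = (\<Oplus>\<^bsub>sec A V\<^esub>b\<in>{..<k}. basis_coord V k e D b \<otimes>\<^bsub>sec A V\<^esub> e b V f)"
    by (rule V.finsum_cong') (use V basis_coord_closed[OF basis D] eC in \<open>auto simp: res_self\<close>)
  finally show ?thesis by simp
qed

text \<open>The remainder in \<open>nabla_ad_lmult_left\<close> has e_a(f) D^a as its a-th
  coordinate, up to sign. Rewritten as D^a e_a(f) with a sign free of a, these terms sum to D(f) by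
  expanding D in the basis.\<close>

lemma basis_strace_lmult:
  assumes D: "D \<in> hder M A V r" and f: "f \<in> par A V q"
  shows "basis_strace V k p e (lmult V f D) = f \<otimes>\<^bsub>sec A V\<^esub> basis_strace V k p e D \<oplus>\<^bsub>sec A V\<^esub> psgn (q * r) \<odot>\<^bsub>sec A V\<^esub> D V f"
proof -
  note V = basis_open[OF basis]
  have DC: "D \<in> vf_carrier M A V" using D by (rule hder_vf_carrier)
  have fC: "f \<in> C V" using f V.par_closed by auto
  have ef: "e a V f \<in> par A V (p a + q)" if "a < k" for a
    using hder_par[OF basis_hder[OF basis that] _ f] V by simp
  have cD: "basis_coord V k e D a \<in> par A V (r + p a)" if "a < k" for a
    using basis_coord_par[OF basis D that] .
  have C: "basis_coord V k e (nabla_ad V D (e a)) b \<in> C V" "e a V f \<in> C V" "basis_coord V k e D a \<in> C V" if "a < k" "b < k" for a b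
    using ef[OF that(1)] cD[OF that(1)] that V.par_closed nabla_ad_basis_closed[OF DC that(1)]
    by (auto simp: basis_coord_closed[OF basis])
  have trm: "psgn (p a) \<odot>\<^bsub>sec A V\<^esub> basis_coord V k e (nabla_ad V (lmult V f D) (e a)) a =
     f \<otimes>\<^bsub>sec A V\<^esub> (psgn (p a) \<odot>\<^bsub>sec A V\<^esub> basis_coord V k e (nabla_ad V D (e a)) a) \<oplus>\<^bsub>sec A V\<^esub>
     psgn (q * r) \<odot>\<^bsub>sec A V\<^esub> (basis_coord V k e D a \<otimes>\<^bsub>sec A V\<^esub> e a V f)" if a: "a < k" for a
  proof -
    have eC: "e a \<in> vf_carrier M A V" using basis_vf[OF basis a] .
    have cl: "lmult V f (nabla_ad V D (e a)) \<in> vf_carrier M A V" "lmult V (e a V f) D \<in> vf_carrier M A V"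
      using eC DC fC C[OF a a] V nabla_ad_basis_closed[OF DC a] by (auto intro!: vf_carrier_lmult)
    have "basis_coord V k e (nabla_ad V (lmult V f D) (e a)) a = f \<otimes>\<^bsub>sec A V\<^esub> basis_coord V k e (nabla_ad V D (e a)) a \<oplus>\<^bsub>sec A V\<^esub>
       psgn ((q + r) * p a) \<odot>\<^bsub>sec A V\<^esub> (e a V f \<otimes>\<^bsub>sec A V\<^esub> basis_coord V k e D a)"
      unfolding nabla_ad_lmult_left[OF V D f basis_hder[OF basis a]]
      using a cl C[OF a a] fC DC nabla_ad_basis_closed[OF DC a]
      by (simp add: basis_coord_add[OF basis] basis_coord_rmult[OF basis] basis_coord_lmult[OF basis] vf_carrier_rmult)
    moreover have "e a V f \<otimes>\<^bsub>sec A V\<^esub> basis_coord V k e D a =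
        psgn ((r + p a) * (p a + q)) \<odot>\<^bsub>sec A V\<^esub> (basis_coord V k e D a \<otimes>\<^bsub>sec A V\<^esub> e a V f)"
      by (rule V.par_commute[OF cD[OF a] ef[OF a]])
    \<comment> \<open>The three factors come from the supertrace, from the remainder term and from
      exchanging e_a(f) with D^a.\<close>
    moreover have "psgn (p a) * (psgn ((q + r) * p a) * psgn ((r + p a) * (p a + q))) = psgn (q * r)"
      by (cases "p a"; cases q; cases r) auto
    ultimately show ?thesis using C[OF a a] fC by (simp add: V.smult_add)
  qed
  have "basis_strace V k p e (lmult V f D) = (\<Oplus>\<^bsub>sec A V\<^esub>a\<in>{..<k}.
     f \<otimes>\<^bsub>sec A V\<^esub> (psgn (p a) \<odot>\<^bsub>sec A V\<^esub> basis_coord V k e (nabla_ad V D (e a)) a) \<oplus>\<^bsub>sec A V\<^esub>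
     psgn (q * r) \<odot>\<^bsub>sec A V\<^esub> (basis_coord V k e D a \<otimes>\<^bsub>sec A V\<^esub> e a V f))"
    unfolding basis_strace_def by (rule V.finsum_cong') (use C fC in \<open>auto simp: trm\<close>)
  also have "\<dots> = (\<Oplus>\<^bsub>sec A V\<^esub>a\<in>{..<k}. f \<otimes>\<^bsub>sec A V\<^esub> (psgn (p a) \<odot>\<^bsub>sec A V\<^esub> basis_coord V k e (nabla_ad V D (e a)) a)) \<oplus>\<^bsub>sec A V\<^esub>
     (\<Oplus>\<^bsub>sec A V\<^esub>a\<in>{..<k}. psgn (q * r) \<odot>\<^bsub>sec A V\<^esub> (basis_coord V k e D a \<otimes>\<^bsub>sec A V\<^esub> e a V f))"
    by (rule V.finsum_addf) (use C fC in auto)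
  also have "(\<Oplus>\<^bsub>sec A V\<^esub>a\<in>{..<k}. f \<otimes>\<^bsub>sec A V\<^esub> (psgn (p a) \<odot>\<^bsub>sec A V\<^esub> basis_coord V k e (nabla_ad V D (e a)) a)) =
      f \<otimes>\<^bsub>sec A V\<^esub> basis_strace V k p e D"
    unfolding basis_strace_def by (rule V.finsum_rdistr[symmetric]) (use C fC in auto)
  also have "(\<Oplus>\<^bsub>sec A V\<^esub>a\<in>{..<k}. psgn (q * r) \<odot>\<^bsub>sec A V\<^esub> (basis_coord V k e D a \<otimes>\<^bsub>sec A V\<^esub> e a V f)) =
      psgn (q * r) \<odot>\<^bsub>sec A V\<^esub> D V f"
    using C by (subst V.smult_finsum[symmetric]) (auto simp: lincomb_basis_coord_apply[OF DC fC])
  finally show ?thesis .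
qed

end

lemma basis_strace_res:
  assumes basis: "basis_at V k p e" and W: "W \<in> opens M V"
    and basisW: "basis_at W k p (\<lambda>b. vf_res M W (e b))" and D: "D \<in> vf_carrier M A V"
  shows "res A V W (basis_strace V k p e D) = basis_strace W k p (\<lambda>b. vf_res M W (e b)) (vf_res M W D)"
proof -
  note V = basis_open[OF basis]
  interpret W: superalg "sec A W" "par A W" using superalg W .
  have "res A V W (basis_strace V k p e D) = (\<Oplus>\<^bsub>sec A W\<^esub>a\<in>{..<k}.
     res A V W (psgn (p a) \<odot>\<^bsub>sec A V\<^esub> basis_coord V k e (nabla_ad V D (e a)) a))"
    unfolding basis_strace_def by (rule res_finsum) (use V W basis_strace_term_closed[OF basis D] in auto)
  also have "\<dots> = basis_strace W k p (\<lambda>b. vf_res M W (e b)) (vf_res M W D)"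
    unfolding basis_strace_def
  proof (rule W.finsum_cong')
    fix a assume "a \<in> {..<k}"
    then have a: "a < k" by simp
    have "vf_res M W (nabla_ad V D (e a)) = nabla_ad W (vf_res M W D) (vf_res M W (e a))"
      using V W D basis_vf[OF basis a] by (rule nabla_ad_res)
    then show "res A V W (psgn (p a) \<odot>\<^bsub>sec A V\<^esub> basis_coord V k e (nabla_ad V D (e a)) a) =
      psgn (p a) \<odot>\<^bsub>sec A W\<^esub> basis_coord W k (\<lambda>b. vf_res M W (e b)) (nabla_ad W (vf_res M W D) (vf_res M W (e a))) a"
      using basis_coord_res[OF basis W basisW nabla_ad_basis_closed[OF basis D a] a] V W
         basis_coord_closed[OF basis nabla_ad_basis_closed[OF basis D a] a]
      by (simp add: res_smult)
  next
    show "(\<lambda>a. psgn (p a) \<odot>\<^bsub>sec A W\<^esub> basis_coord W k (\<lambda>b. vf_res M W (e b)) (nabla_ad W (vf_res M W D) (vf_res M W (e a))) a) \<in> {..<k} \<rightarrow> C W"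
      using basis_strace_term_closed[OF basisW vf_res_carrier[OF W D]] by auto
  qed simp
  finally show ?thesis .
qed

text \<open>
  For a change of basis $e'_a = \sum_b g_a^b e_b$, $e_c = \sum_a h_c^a e'_a$ one has
  $F(e'_a) = \sum_b (-1)^{|F|(|a|+|b|)} g_a^b F(e_b)$; moving $h_c^a$ to the front in
  $g_a^b F_b^c h_c^a$ turns the signs into $(-1)^{|c|+|F|(|b|+|c|)}$, which does not depend on \<open>a\<close>.
\<close>

lemma basis_strace_independent_hder:
  assumes basis: "basis_at V k p e" and basis': "basis_at V k' p' e'" and D: "D \<in> hder M A V q"
  shows "basis_strace V k' p' e' D = basis_strace V k p e D"
proof -
  note V = basis_open[OF basis]
  interpret V: superalg "sec A V" "par A V" using superalg' V .
  have DC: "D \<in> vf_carrier M A V" using D by (rule hder_vf_carrier)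
  define g where "g a b = basis_coord V k e (e' a) b" for a b
  define h where "h c a = basis_coord V k' e' (e c) a" for c a
  define F where "F b c = basis_coord V k e (nabla_ad V D (e b)) c" for b c
  have gp: "g a b \<in> par A V (p' a + p b)" if "a < k'" "b < k" for a b
    unfolding g_def using basis_coord_par[OF basis basis_hder[OF basis' that(1)] that(2)] .
  have hp: "h c a \<in> par A V (p c + p' a)" if "a < k'" "c < k" for a c
    unfolding h_def using basis_coord_par[OF basis' basis_hder[OF basis that(2)] that(1)] .
  have Fp: "F b c \<in> par A V (q + p b + p c)" if "b < k" "c < k" for b c
    unfolding F_def using basis_coord_par[OF basis nabla_ad_hder[OF V D basis_hder[OF basis that(1)]] that(2)] .
  have C: "g a b \<in> C V" "h b a \<in> C V" "F b c \<in> C V" if "a < k'" "b < k" "c < k" for a b c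
    using gp hp Fp that V.par_closed by blast+
  have FC: "F b c \<in> C V" if "b < k" "c < k" for b c
    using Fp that V.par_closed by blast
  have eC: "e b \<in> vf_carrier M A V" if "b < k" for b using basis_vf[OF basis that] .
  have e'C: "e' b \<in> vf_carrier M A V" if "b < k'" for b using basis_vf[OF basis' that] .
  \<comment> \<open>Expanding e_c in the primed basis and the result back in the original one yields
    h g = 1, in the order in which the two factors stand in T below.\<close>
  have hg: "(\<Oplus>\<^bsub>sec A V\<^esub>a\<in>{..<k'}. h c a \<otimes>\<^bsub>sec A V\<^esub> g a b) = (if b = c then \<one>\<^bsub>sec A V\<^esub> else \<zero>\<^bsub>sec A V\<^esub>)"
    if "b < k" "c < k" for b c
  proof -
    have "basis_coord V k e (e c) b = basis_coord V k e (lincomb V k' e' (h c)) b"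
      unfolding h_def by (simp add: basis_coord_spec(2)[OF basis' eC[OF that(2)]])
    also have "\<dots> = (\<Oplus>\<^bsub>sec A V\<^esub>a\<in>{..<k'}. h c a \<otimes>\<^bsub>sec A V\<^esub> g a b)"
      unfolding g_def by (rule basis_coord_lincomb[OF basis]) (use that C e'C in auto)
    finally show ?thesis using that by (simp add: basis_coord_basis[OF basis])
  qed
  have nabla_ad': "nabla_ad V D (e' a) = lincomb V k (\<lambda>b. nabla_ad V D (e b)) (\<lambda>b. psgn (q * (p' a + p b)) \<odot>\<^bsub>sec A V\<^esub> g a b)"
    if a: "a < k'" for a
  proof -
    have "nabla_ad V D (e' a) = nabla_ad V D (finsum (Der M A V) (\<lambda>b. lmult V (g a b) (e b)) {..<k})"
      using basis_coord_spec(2)[OF basis e'C[OF a]] by (simp add: g_def[abs_def] lincomb_def)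
    also have "\<dots> = finsum (Der M A V) (\<lambda>b. nabla_ad V D (lmult V (g a b) (e b))) {..<k}"
      by (rule additive_finsum[OF Der_abelian_group Der_abelian_group])
        (use V DC C a eC in \<open>auto simp: Der_simps nabla_ad_closed nabla_ad_add_right intro!: vf_carrier_lmult\<close>)
    also have "\<dots> = lincomb V k (\<lambda>b. nabla_ad V D (e b)) (\<lambda>b. psgn (q * (p' a + p b)) \<odot>\<^bsub>sec A V\<^esub> g a b)"
      unfolding lincomb_def
    proof (rule abelian_monoid.finsum_cong'[OF abelian_group.axioms(1)[OF Der_abelian_group]])
      fix b assume "b \<in> {..<k}"
      then show "nabla_ad V D (lmult V (g a b) (e b)) = lmult V (psgn (q * (p' a + p b)) \<odot>\<^bsub>sec A V\<^esub> g a b) (nabla_ad V D (e b))"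
        using nabla_ad_lmult_right[OF V D gp basis_hder[OF basis]] a by auto
    qed (use V DC C a eC in \<open>auto simp: Der_simps nabla_ad_closed intro!: vf_carrier_lmult\<close>)
    finally show ?thesis .
  qed
  have F': "basis_coord V k' e' (nabla_ad V D (e b)) a = (\<Oplus>\<^bsub>sec A V\<^esub>c\<in>{..<k}. F b c \<otimes>\<^bsub>sec A V\<^esub> h c a)"
    if "a < k'" "b < k" for a b
  proof -
    have "basis_coord V k' e' (nabla_ad V D (e b)) a = basis_coord V k' e' (lincomb V k e (F b)) a"
      unfolding F_def by (simp add: basis_coord_spec(2)[OF basis nabla_ad_basis_closed[OF basis DC that(2)]])
    also have "\<dots> = (\<Oplus>\<^bsub>sec A V\<^esub>c\<in>{..<k}. F b c \<otimes>\<^bsub>sec A V\<^esub> h c a)"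
      unfolding h_def by (rule basis_coord_lincomb[OF basis']) (use that FC eC in auto)
    finally show ?thesis .
  qed
  define s where "s c b = psgn (p c) * psgn (q * (p b + p c))" for b c
  define T where "T a b c = s c b \<odot>\<^bsub>sec A V\<^esub> (h c a \<otimes>\<^bsub>sec A V\<^esub> g a b \<otimes>\<^bsub>sec A V\<^esub> F b c)" for a b c
  have TC: "T a b c \<in> C V" if "a < k'" "b < k" "c < k" for a b c
    unfolding T_def using C[of a b c] C[of a c b] that by simp
  have trm: "psgn (p' a) \<odot>\<^bsub>sec A V\<^esub> ((psgn (q * (p' a + p b)) \<odot>\<^bsub>sec A V\<^esub> g a b) \<otimes>\<^bsub>sec A V\<^esub> (F b c \<otimes>\<^bsub>sec A V\<^esub> h c a)) = T a b c"
    if "a < k'" "b < k" "c < k" for a b c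
  proof -
    have gF: "g a b \<otimes>\<^bsub>sec A V\<^esub> F b c \<in> par A V ((p' a + p b) + (q + p b + p c))"
      using V.par_mult[OF gp Fp] that by blast
    have "g a b \<otimes>\<^bsub>sec A V\<^esub> (F b c \<otimes>\<^bsub>sec A V\<^esub> h c a) = (g a b \<otimes>\<^bsub>sec A V\<^esub> F b c) \<otimes>\<^bsub>sec A V\<^esub> h c a"
      using C[of a b c] C[of a c b] that by (simp add: V.m_assoc)
    also have "\<dots> = psgn ((p c + p' a) * ((p' a + p b) + (q + p b + p c))) \<odot>\<^bsub>sec A V\<^esub> (h c a \<otimes>\<^bsub>sec A V\<^esub> (g a b \<otimes>\<^bsub>sec A V\<^esub> F b c))"
      by (rule V.par_commute[OF hp gF]) (use that in auto)
    finally have 1: "g a b \<otimes>\<^bsub>sec A V\<^esub> (F b c \<otimes>\<^bsub>sec A V\<^esub> h c a) =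
       psgn ((p c + p' a) * ((p' a + p b) + (q + p b + p c))) \<odot>\<^bsub>sec A V\<^esub> (h c a \<otimes>\<^bsub>sec A V\<^esub> g a b \<otimes>\<^bsub>sec A V\<^esub> F b c)"
      using C[of a b c] C[of a c b] that by (simp add: V.m_assoc)
    have "psgn (p' a) * (psgn (q * (p' a + p b)) * psgn ((p c + p' a) * ((p' a + p b) + (q + p b + p c)))) = s c b"
      unfolding s_def by (cases "p' a"; cases q; cases "p b"; cases "p c") auto
    with 1 show ?thesis using C[of a b c] C[of a c b] that by (simp add: T_def)
  qed
  have "psgn (p' a) \<odot>\<^bsub>sec A V\<^esub> basis_coord V k' e' (nabla_ad V D (e' a)) a =
      (\<Oplus>\<^bsub>sec A V\<^esub>b\<in>{..<k}. \<Oplus>\<^bsub>sec A V\<^esub>c\<in>{..<k}. T a b c)" if a: "a < k'" for a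
  proof -
    have "basis_coord V k' e' (nabla_ad V D (e' a)) a = (\<Oplus>\<^bsub>sec A V\<^esub>b\<in>{..<k}.
       (psgn (q * (p' a + p b)) \<odot>\<^bsub>sec A V\<^esub> g a b) \<otimes>\<^bsub>sec A V\<^esub> basis_coord V k' e' (nabla_ad V D (e b)) a)"
      unfolding nabla_ad'[OF a]
      by (rule basis_coord_lincomb[OF basis']) (use a C nabla_ad_basis_closed[OF basis DC] in auto)
    also have "\<dots> = (\<Oplus>\<^bsub>sec A V\<^esub>b\<in>{..<k}. \<Oplus>\<^bsub>sec A V\<^esub>c\<in>{..<k}.
       (psgn (q * (p' a + p b)) \<odot>\<^bsub>sec A V\<^esub> g a b) \<otimes>\<^bsub>sec A V\<^esub> (F b c \<otimes>\<^bsub>sec A V\<^esub> h c a))"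
      using a C
      by (intro V.finsum_cong') (auto simp: F' simp del: V.smult_mult_left intro!: V.finsum_rdistr V.finsum_closed)
    finally have "psgn (p' a) \<odot>\<^bsub>sec A V\<^esub> basis_coord V k' e' (nabla_ad V D (e' a)) a = psgn (p' a) \<odot>\<^bsub>sec A V\<^esub> \<dots>" by simp
    also have "\<dots> = (\<Oplus>\<^bsub>sec A V\<^esub>b\<in>{..<k}. psgn (p' a) \<odot>\<^bsub>sec A V\<^esub> (\<Oplus>\<^bsub>sec A V\<^esub>c\<in>{..<k}.
       (psgn (q * (p' a + p b)) \<odot>\<^bsub>sec A V\<^esub> g a b) \<otimes>\<^bsub>sec A V\<^esub> (F b c \<otimes>\<^bsub>sec A V\<^esub> h c a)))"
      using a C by (intro V.smult_finsum V.finsum_closed) auto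
    also have "\<dots> = (\<Oplus>\<^bsub>sec A V\<^esub>b\<in>{..<k}. \<Oplus>\<^bsub>sec A V\<^esub>c\<in>{..<k}. T a b c)"
    proof (rule V.finsum_cong')
      fix b assume b: "b \<in> {..<k}"
      have "psgn (p' a) \<odot>\<^bsub>sec A V\<^esub> (\<Oplus>\<^bsub>sec A V\<^esub>c\<in>{..<k}.
         (psgn (q * (p' a + p b)) \<odot>\<^bsub>sec A V\<^esub> g a b) \<otimes>\<^bsub>sec A V\<^esub> (F b c \<otimes>\<^bsub>sec A V\<^esub> h c a)) =
        (\<Oplus>\<^bsub>sec A V\<^esub>c\<in>{..<k}. psgn (p' a) \<odot>\<^bsub>sec A V\<^esub>
         ((psgn (q * (p' a + p b)) \<odot>\<^bsub>sec A V\<^esub> g a b) \<otimes>\<^bsub>sec A V\<^esub> (F b c \<otimes>\<^bsub>sec A V\<^esub> h c a)))"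
        using a b C by (intro V.smult_finsum) auto
      also have "\<dots> = (\<Oplus>\<^bsub>sec A V\<^esub>c\<in>{..<k}. T a b c)"
        using a b TC by (intro V.finsum_cong') (auto simp: trm)
      finally show "psgn (p' a) \<odot>\<^bsub>sec A V\<^esub> (\<Oplus>\<^bsub>sec A V\<^esub>c\<in>{..<k}.
         (psgn (q * (p' a + p b)) \<odot>\<^bsub>sec A V\<^esub> g a b) \<otimes>\<^bsub>sec A V\<^esub> (F b c \<otimes>\<^bsub>sec A V\<^esub> h c a)) = (\<Oplus>\<^bsub>sec A V\<^esub>c\<in>{..<k}. T a b c)" .
    qed (use a TC in \<open>auto intro!: V.finsum_closed\<close>)
    finally show ?thesis .
  qed
  then have "basis_strace V k' p' e' D = (\<Oplus>\<^bsub>sec A V\<^esub>a\<in>{..<k'}. \<Oplus>\<^bsub>sec A V\<^esub>b\<in>{..<k}. \<Oplus>\<^bsub>sec A V\<^esub>c\<in>{..<k}. T a b c)"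
    unfolding basis_strace_def using TC by (intro V.finsum_cong') (auto intro!: V.finsum_closed)
  \<comment> \<open>Bringing the sum over a innermost lets h g collapse to a Kronecker delta. Only c
    = b remains, where the sign depending on q is (-1)^{q(|b|+|b|)} = 1.\<close>
  also have "\<dots> = (\<Oplus>\<^bsub>sec A V\<^esub>b\<in>{..<k}. \<Oplus>\<^bsub>sec A V\<^esub>a\<in>{..<k'}. \<Oplus>\<^bsub>sec A V\<^esub>c\<in>{..<k}. T a b c)"
    using TC by (intro V.finsum_swap) (auto intro!: V.finsum_closed)
  also have "\<dots> = (\<Oplus>\<^bsub>sec A V\<^esub>b\<in>{..<k}. psgn (p b) \<odot>\<^bsub>sec A V\<^esub> F b b)"
  proof (rule V.finsum_cong')
    fix b assume "b \<in> {..<k}"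
    then have b: "b < k" by simp
    have "(\<Oplus>\<^bsub>sec A V\<^esub>a\<in>{..<k'}. \<Oplus>\<^bsub>sec A V\<^esub>c\<in>{..<k}. T a b c) = (\<Oplus>\<^bsub>sec A V\<^esub>c\<in>{..<k}. \<Oplus>\<^bsub>sec A V\<^esub>a\<in>{..<k'}. T a b c)"
      using b TC by (intro V.finsum_swap) auto
    also have "\<dots> = (\<Oplus>\<^bsub>sec A V\<^esub>c\<in>{..<k}. (if c = b then \<one>\<^bsub>sec A V\<^esub> else \<zero>\<^bsub>sec A V\<^esub>) \<otimes>\<^bsub>sec A V\<^esub> (s c b \<odot>\<^bsub>sec A V\<^esub> F b c))"
    proof (rule V.finsum_cong')
      fix c assume "c \<in> {..<k}"
      then have c: "c < k" by simp
      have "(\<Oplus>\<^bsub>sec A V\<^esub>a\<in>{..<k'}. T a b c) = (\<Oplus>\<^bsub>sec A V\<^esub>a\<in>{..<k'}. (h c a \<otimes>\<^bsub>sec A V\<^esub> g a b) \<otimes>\<^bsub>sec A V\<^esub> (s c b \<odot>\<^bsub>sec A V\<^esub> F b c))"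
        using b c C FC by (intro V.finsum_cong') (auto simp: T_def)
      also have "\<dots> = (\<Oplus>\<^bsub>sec A V\<^esub>a\<in>{..<k'}. h c a \<otimes>\<^bsub>sec A V\<^esub> g a b) \<otimes>\<^bsub>sec A V\<^esub> (s c b \<odot>\<^bsub>sec A V\<^esub> F b c)"
        using b c C FC by (intro V.finsum_ldistr[symmetric]) auto
      finally show "(\<Oplus>\<^bsub>sec A V\<^esub>a\<in>{..<k'}. T a b c) =
         (if c = b then \<one>\<^bsub>sec A V\<^esub> else \<zero>\<^bsub>sec A V\<^esub>) \<otimes>\<^bsub>sec A V\<^esub> (s c b \<odot>\<^bsub>sec A V\<^esub> F b c)"
        using hg[OF b c] by (simp add: eq_commute)
    qed (use b FC in auto)
    also have "\<dots> = s b b \<odot>\<^bsub>sec A V\<^esub> F b b"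
      using b FC by (intro V.finsum_delta) auto
    also have "s b b = psgn (p b)" by (simp add: s_def)
    finally show "(\<Oplus>\<^bsub>sec A V\<^esub>a\<in>{..<k'}. \<Oplus>\<^bsub>sec A V\<^esub>c\<in>{..<k}. T a b c) = psgn (p b) \<odot>\<^bsub>sec A V\<^esub> F b b" .
  qed (use FC in auto)
  also have "\<dots> = basis_strace V k p e D" by (simp add: basis_strace_def F_def)
  finally show ?thesis .
qed

text \<open>The signs of the homogeneous case refer to a definite degree of D. The general case
  follows by additivity over the two components.\<close>

lemma basis_strace_independent:
  assumes basis: "basis_at V k p e" and basis': "basis_at V k' p' e'" and D: "D \<in> vf_carrier M A V"
  shows "basis_strace V k' p' e' D = basis_strace V k p e D"
proof -
  obtain D0 D1 where D: "D0 \<in> hder M A V 0" "D1 \<in> hder M A V (0 + 1)" "D = vf_add M A V D0 D1"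
    using vf_carrierE[OF D] .
  then show ?thesis
    using basis_strace_independent_hder[OF basis basis'] hder_vf_carrier
    by (simp add: basis_strace_add[OF basis] basis_strace_add[OF basis'])
qed

end

section \<open>Gluing the local supertraces, given that homogeneous bases exist locally\<close>

locale graded_conn_local_basis = graded_conn M A nabla
  for M :: "'x topology" and A :: "('x, 'a) superalgebra_sheaf" and nabla +
  assumes local_basis: "x \<in> topspace M \<Longrightarrow> \<exists>V k p e. openin M V \<and> x \<in> V \<and> homogeneous_basis M A V k p e"
begin

text \<open>The property under the description operator in \<open>supertrace\<close>, with the local
  expression in its signed form. Properties of the divergence are proved by exhibiting a section
  with this property.\<close>

definition is_div :: "'x set \<Rightarrow> ('x, 'a) vfield \<Rightarrow> 'a \<Rightarrow> bool"
  where "is_div U D s \<longleftrightarrow> s \<in> C U \<and>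
    (\<forall>V\<in>opens M U. \<forall>k p e. homogeneous_basis M A V k p e \<longrightarrow> res A U V s = basis_strace V k p e (vf_res M V D))"

lemma homogeneous_basis_res:
  assumes "homogeneous_basis M A V k p e" "W \<in> opens M V"
  shows "homogeneous_basis M A W k p (\<lambda>b. vf_res M W (e b))"
  using assms hder_vf_res opens_trans[OF assms(2)]
  by (auto simp: homogeneous_basis_def is_coords_def vf_res_vf_res)

definition basis_opens :: "'x set \<Rightarrow> 'x set set"
  where "basis_opens U = {V \<in> opens M U. \<exists>k p e. homogeneous_basis M A V k p e}"

lemma Union_basis_opens: "openin M U \<Longrightarrow> \<Union>(basis_opens U) = U"
proof
  assume U: "openin M U"
  show "\<Union>(basis_opens U) \<subseteq> U" by (auto simp: basis_opens_def opens_def)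
  show "U \<subseteq> \<Union>(basis_opens U)"
  proof
    fix x assume x: "x \<in> U"
    then have "x \<in> topspace M" using U openin_subset by blast
    then obtain V k p e where V: "openin M V" "x \<in> V" "homogeneous_basis M A V k p e"
      using local_basis by blast
    have W: "V \<inter> U \<in> opens M V" using V U by (auto simp: opens_def)
    have "V \<inter> U \<in> basis_opens U"
      using homogeneous_basis_res[OF V(3) W] V U by (auto simp: basis_opens_def opens_def)
    then show "x \<in> \<Union>(basis_opens U)" using x V by blast
  qed
qed

text \<open>The open sets that carry a homogeneous basis cover U, and on each of them the
  restriction is prescribed.\<close>

lemma is_div_unique:
  assumes U: "openin M U" and "is_div U D s" "is_div U D t"
  shows "s = t"
proof (rule glue_unique[of "basis_opens U"])
  show "openin M V" if "V \<in> basis_opens U" for V using that opens_open by (auto simp: basis_opens_def)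
  show "s \<in> C (\<Union>(basis_opens U))" "t \<in> C (\<Union>(basis_opens U))"
    using assms by (auto simp: Union_basis_opens is_div_def)
  show "res A (\<Union>(basis_opens U)) V s = res A (\<Union>(basis_opens U)) V t" if "V \<in> basis_opens U" for V
    using that assms unfolding Union_basis_opens[OF U] by (auto simp: basis_opens_def is_div_def)
qed

lemma is_div_exists:
  assumes U: "openin M U" and D: "D \<in> vf_carrier M A U"
  shows "\<exists>s. is_div U D s"
proof -
  \<comment> \<open>Some basis is chosen over each open set that has one. Independence of the basis
    makes the value the same for every choice.\<close>
  define s where "s V = (SOME t. \<exists>k p e. homogeneous_basis M A V k p e \<and> t = basis_strace V k p e (vf_res M V D))" for V
  have s: "s V = basis_strace V k p e (vf_res M V D)" if V: "V \<in> opens M U" and h: "homogeneous_basis M A V k p e" for V k p e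
  proof -
    have "\<exists>t. \<exists>k p e. homogeneous_basis M A V k p e \<and> t = basis_strace V k p e (vf_res M V D)" using h by blast
    from someI_ex[OF this] obtain k' p' e' where
       "homogeneous_basis M A V k' p' e'" "s V = basis_strace V k' p' e' (vf_res M V D)" unfolding s_def by blast
    with h show ?thesis
      using homogeneous_basis_basis_at opens_open[OF V] vf_res_carrier[OF V D] basis_strace_independent by metis
  qed
  have sC: "s V \<in> C V" and sres: "W \<in> opens M V \<Longrightarrow> res A V W (s V) = s W" if "V \<in> basis_opens U" for V W
  proof -
    obtain k p e where V: "V \<in> opens M U" and h: "homogeneous_basis M A V k p e"
      using \<open>V \<in> basis_opens U\<close> by (auto simp: basis_opens_def)
    note b = homogeneous_basis_basis_at[OF h opens_open[OF V]]
    note DV = vf_res_carrier[OF V D]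
    show "s V \<in> C V" unfolding s[OF V h] by (rule basis_strace_closed[OF b DV])
    show "res A V W (s V) = s W" if W: "W \<in> opens M V"
      \<comment> \<open>The value over W may be computed in the restricted basis, where it is
        visibly the restriction of the value over V.\<close>
      unfolding s[OF V h] s[OF opens_trans[OF V W] homogeneous_basis_res[OF h W]]
      using basis_strace_res[OF b W homogeneous_basis_basis_at_res[OF h W] DV] W by (simp add: vf_res_vf_res)
  qed
  obtain t where t: "t \<in> C (\<Union>(basis_opens U))" "\<And>V. V \<in> basis_opens U \<Longrightarrow> res A (\<Union>(basis_opens U)) V t = s V"
  proof (rule glue_exists[of "basis_opens U" s])
    show o: "openin M V" if "V \<in> basis_opens U" for V using that opens_open by (auto simp: basis_opens_def)
    show "res A V (V \<inter> W) (s V) = res A W (V \<inter> W) (s W)" if "V \<in> basis_opens U" "W \<in> basis_opens U" for V W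
    proof -
      have "V \<inter> W \<in> opens M V" "V \<inter> W \<in> opens M W" using o that by (auto simp: opens_def)
      then show ?thesis using sres that by simp
    qed
  qed (use sC in auto)
  have "is_div U D t"
    unfolding is_div_def
  proof (intro conjI ballI allI impI)
    show "t \<in> C U" using t(1) by (simp add: Union_basis_opens[OF U])
    fix V k p e assume V: "V \<in> opens M U" and h: "homogeneous_basis M A V k p e"
    then have "V \<in> basis_opens U" by (auto simp: basis_opens_def)
    from t(2)[OF this] show "res A U V t = basis_strace V k p e (vf_res M V D)"
      by (simp add: Union_basis_opens[OF U] s[OF V h])
  qed
  then show ?thesis by blast
qed

text \<open>Removes the description operator: to compute a divergence it is enough to guess a
  section and check its local expressions.\<close>

lemma div_connection_eqI:
  assumes U: "openin M U" and D: "D \<in> vf_carrier M A U" and s: "is_div U D s"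
  shows "div_connection M A nabla U D = s"
proof -
  have eq: "basis_supertrace M A V k p e (\<lambda>E. nabla V (vf_res M V D) E \<ominus>\<^bsub>Der M A V\<^esub> ad M A D V E) =
      basis_strace V k p e (vf_res M V D)" if V: "V \<in> opens M U" and h: "homogeneous_basis M A V k p e" for V k p e
  proof -
    note b = homogeneous_basis_basis_at[OF h opens_open[OF V]]
    show ?thesis
      using nabla_ad_eq[OF opens_open[OF V] vf_res_carrier[OF V D] basis_vf[OF b]] vf_res_carrier[OF V D]
      by (intro basis_supertrace_basis_strace[OF b]) (simp_all add: ad_def)
  qed
  have "(s \<in> C U \<and> (\<forall>V\<in>opens M U. \<forall>k p e. homogeneous_basis M A V k p e \<longrightarrow> res A U V s =
     basis_supertrace M A V k p e (\<lambda>E. nabla V (vf_res M V D) E \<ominus>\<^bsub>Der M A V\<^esub> ad M A D V E))) = is_div U D s" for s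
    unfolding is_div_def using eq by auto
  then have "div_connection M A nabla U D = (THE s. is_div U D s)"
    by (simp add: div_connection_def supertrace_def)
  also have "\<dots> = s" using s is_div_unique[OF U] by blast
  finally show ?thesis .
qed

lemma is_div_div_connection:
  assumes U: "openin M U" and D: "D \<in> vf_carrier M A U"
  shows "is_div U D (div_connection M A nabla U D)"
  using is_div_exists[OF U D] div_connection_eqI[OF U D] by auto

text \<open>Each law holds for \<open>basis_strace\<close> in every local basis. The section on its
  expected right-hand side therefore satisfies \<open>is_div\<close>, and uniqueness turns this into
  the law itself.\<close>

theorem divergence_operator_div_connection: "divergence_operator M A (div_connection M A nabla)"
proof -
  let ?dv = "div_connection M A nabla"
  have lin: "real_linear (Der_real M A U) (sec A U) (?dv U)" if U: "openin M U" for U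
  proof -
    interpret U: superalg "sec A U" "par A U" using superalg' U .
    note isd = is_div_div_connection[OF U]
    have cl: "?dv U D \<in> C U" if "D \<in> vf_carrier M A U" for D using isd[OF that] by (simp add: is_div_def)
    have "?dv U (vf_add M A U D E) = ?dv U D \<oplus>\<^bsub>sec A U\<^esub> ?dv U E"
      if D: "D \<in> vf_carrier M A U" and E: "E \<in> vf_carrier M A U" for D E
    proof (rule div_connection_eqI[OF U vf_carrier_add[OF D E]])
      show "is_div U (vf_add M A U D E) (?dv U D \<oplus>\<^bsub>sec A U\<^esub> ?dv U E)"
        unfolding is_div_def
      proof (intro conjI ballI allI impI)
        fix V k p e assume V: "V \<in> opens M U" and h: "homogeneous_basis M A V k p e"
        note b = homogeneous_basis_basis_at[OF h opens_open[OF V]]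
        show "res A U V (?dv U D \<oplus>\<^bsub>sec A U\<^esub> ?dv U E) = basis_strace V k p e (vf_res M V (vf_add M A U D E))"
          using isd[OF D] isd[OF E] V h cl[OF D] cl[OF E] vf_res_carrier[OF V D] vf_res_carrier[OF V E]
          by (simp add: is_div_def res_add[OF U V] vf_res_add[OF V] basis_strace_add[OF b])
      qed (use cl D E in auto)
    qed
    moreover have "?dv U (rmult U c D) = c \<odot>\<^bsub>sec A U\<^esub> ?dv U D" if D: "D \<in> vf_carrier M A U" for c D
    proof (rule div_connection_eqI[OF U vf_carrier_rmult[OF D]])
      show "is_div U (rmult U c D) (c \<odot>\<^bsub>sec A U\<^esub> ?dv U D)"
        unfolding is_div_def
      proof (intro conjI ballI allI impI)
        fix V k p e assume V: "V \<in> opens M U" and h: "homogeneous_basis M A V k p e"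
        note b = homogeneous_basis_basis_at[OF h opens_open[OF V]]
        show "res A U V (c \<odot>\<^bsub>sec A U\<^esub> ?dv U D) = basis_strace V k p e (vf_res M V (rmult U c D))"
          using isd[OF D] V h cl[OF D] vf_res_carrier[OF V D]
          by (simp add: is_div_def res_smult[OF U V] vf_res_rmult[OF V] basis_strace_rmult[OF b])
      qed (use cl D in auto)
    qed
    ultimately show ?thesis using cl by (auto simp: real_linear_def Der_simps)
  qed
  have par: "?dv U D \<in> par A U p" if U: "openin M U" and D: "D \<in> hder M A U p" for U D p
  proof -
    interpret U: superalg "sec A U" "par A U" using superalg' U .
    note DC = hder_vf_carrier[OF D]
    have dv: "is_div U D (?dv U D)" using is_div_div_connection[OF U DC] .
    then have "?dv U D \<in> C U" by (simp add: is_div_def)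
    then obtain y z where yz: "y \<in> par A U p" "z \<in> par A U (p + 1)" "?dv U D = y \<oplus>\<^bsub>sec A U\<^esub> z"
      using U.par_decompose by blast
    then have yzC: "y \<in> C U" "z \<in> C U" using U.par_closed by auto
    \<comment> \<open>All local values have degree p, so comparing components shows that the degree
      p part y of the divergence has the same restrictions as the divergence. By uniqueness the two
      coincide.\<close>
    have "is_div U D y"
      unfolding is_div_def
    proof (intro conjI ballI allI impI)
      fix V k p' e assume V: "V \<in> opens M U" and h: "homogeneous_basis M A V k p' e"
      interpret V: superalg "sec A V" "par A V" using superalg V .
      note b = homogeneous_basis_basis_at[OF h opens_open[OF V]]
      have "res A U V y \<oplus>\<^bsub>sec A V\<^esub> res A U V z = basis_strace V k p' e (vf_res M V D) \<oplus>\<^bsub>sec A V\<^esub> \<zero>\<^bsub>sec A V\<^esub>"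
      proof -
        have "res A U V (?dv U D) = basis_strace V k p' e (vf_res M V D)"
          using dv V h by (simp add: is_div_def)
        then show ?thesis
          using basis_strace_closed[OF b vf_res_carrier[OF V DC]] by (simp add: yz(3) res_add[OF U V yzC])
      qed
      then show "res A U V y = basis_strace V k p' e (vf_res M V D)"
        using V.par_decompose_unique(1) res_par[OF U V] yz basis_strace_par[OF b hder_vf_res[OF V D]] V.par_zero by metis
    qed (use yzC in auto)
    then have "?dv U D = y" by (rule div_connection_eqI[OF U DC])
    then show ?thesis using yz by simp
  qed
  have leib: "?dv U (lmult U f D) = f \<otimes>\<^bsub>sec A U\<^esub> ?dv U D \<oplus>\<^bsub>sec A U\<^esub> psgn (q * p) \<odot>\<^bsub>sec A U\<^esub> D U f"
    if U: "openin M U" and f: "f \<in> par A U q" and D: "D \<in> hder M A U p" for U f D p q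
  proof -
    interpret U: superalg "sec A U" "par A U" using superalg' U .
    note DC = hder_vf_carrier[OF D]
    have Dl: "D \<in> lin_field U" using D hder_lin_field by auto
    have dv: "is_div U D (?dv U D)" using is_div_div_connection[OF U DC] .
    have fC: "f \<in> C U" using f U.par_closed by auto
    have cl: "?dv U D \<in> C U" "D U f \<in> C U" using dv fC Dl U by (auto simp: is_div_def lf_closed)
    show ?thesis
    proof (rule div_connection_eqI[OF U vf_carrier_lmult[OF DC U fC]])
      show "is_div U (lmult U f D) (f \<otimes>\<^bsub>sec A U\<^esub> ?dv U D \<oplus>\<^bsub>sec A U\<^esub> psgn (q * p) \<odot>\<^bsub>sec A U\<^esub> D U f)"
        unfolding is_div_def
      proof (intro conjI ballI allI impI)
        fix V k p' e assume V: "V \<in> opens M U" and h: "homogeneous_basis M A V k p' e"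
        note b = homogeneous_basis_basis_at[OF h opens_open[OF V]]
        show "res A U V (f \<otimes>\<^bsub>sec A U\<^esub> ?dv U D \<oplus>\<^bsub>sec A U\<^esub> psgn (q * p) \<odot>\<^bsub>sec A U\<^esub> D U f) = basis_strace V k p' e (vf_res M V (lmult U f D))"
          using dv U V h cl fC lf_res[OF Dl _ V fC] opens_open[OF V]
          by (simp add: is_div_def res_add[OF U V] res_smult[OF U V] res_mult[OF U V] vf_res_lmult[OF U V]
              basis_strace_lmult[OF b hder_vf_res[OF V D] res_par[OF U V f]])
      qed (use cl fC in auto)
    qed
  qed
  have restr: "res A U V (?dv U D) = ?dv V (vf_res M V D)"
    if U: "openin M U" and V: "V \<in> opens M U" and DC: "D \<in> vf_carrier M A U" for U V D
  proof -
    have dv: "is_div U D (?dv U D)" using is_div_div_connection[OF U DC] .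
    then have cl: "?dv U D \<in> C U" by (simp add: is_div_def)
    have "is_div V (vf_res M V D) (res A U V (?dv U D))"
      unfolding is_div_def
    proof (intro conjI ballI allI impI)
      show "res A U V (?dv U D) \<in> C V" using res_closed[OF U V cl] .
      fix W k p e assume W: "W \<in> opens M V" and h: "homogeneous_basis M A W k p e"
      show "res A V W (res A U V (?dv U D)) = basis_strace W k p e (vf_res M W (vf_res M V D))"
        using dv opens_trans[OF V W] h W by (simp add: is_div_def res_res[OF U V W cl] vf_res_vf_res)
    qed
    from div_connection_eqI[OF opens_open[OF V] vf_res_carrier[OF V DC] this] show ?thesis by simp
  qed
  show ?thesis
    unfolding divergence_operator_def Der_simps using lin par leib restr by (auto simp: opens_def)
qed

end

section \<open>Smooth functions and Hadamard's lemma\<close>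

text \<open>The type class topology on functions is the product topology, so the abstract space is a
  subspace of a type and the set-based calculus of continuity applies.\<close>

lemma Euclidean_space_top_of_set: "Euclidean_space m = top_of_set (topspace (Euclidean_space m))"
  by (simp add: Euclidean_space_def euclidean_product_topology topspace_Euclidean_space)

lemma continuous_map_Euclidean_subspace:
  assumes "V \<subseteq> topspace (Euclidean_space m)"
  shows "continuous_map (subtopology (Euclidean_space m) V) euclideanreal f \<longleftrightarrow> continuous_on V f"
proof -
  have "subtopology (Euclidean_space m) V = top_of_set V"
    using assms by (subst Euclidean_space_top_of_set) (simp add: subtopology_subtopology Int_absorb1)
  then show ?thesis by simp
qed

lemma continuous_on_coord: "continuous_on S (\<lambda>x :: nat \<Rightarrow> real. x i)"
  by (rule continuous_on_product_then_coordinatewise) (rule continuous_on_id)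

lemma continuous_on_fun_upd:
  assumes "continuous_on S f" "continuous_on S (g :: 'b :: topological_space \<Rightarrow> real)"
  shows "continuous_on S (\<lambda>z. (f z :: nat \<Rightarrow> real)(i := g z))"
proof (rule continuous_on_coordinatewise_then_product)
  fix j
  show "continuous_on S (\<lambda>z. ((f z)(i := g z)) j)"
    using assms continuous_on_product_then_coordinatewise[OF assms(1)] by (cases "j = i") auto
qed

lemma topspace_Euclidean_upd:
  "x \<in> topspace (Euclidean_space m) \<Longrightarrow> i < m \<Longrightarrow> x(i := t) \<in> topspace (Euclidean_space m)"
  by (auto simp: topspace_Euclidean_space)

text \<open>An open set contains a short segment through x in each direction i < m. Hence partial
  derivatives at x see only values on the open set. For i \<ge> m the updated point would leave the
  space.\<close>

lemma eventually_upd_mem: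
  assumes V: "openin (Euclidean_space m) V" and x: "x \<in> V" and i: "i < m"
  shows "\<forall>\<^sub>F t in nhds (x i). x(i := t) \<in> V"
proof -
  obtain T where T: "open T" "V = topspace (Euclidean_space m) \<inter> T"
    using V by (metis Euclidean_space_top_of_set openin_open)
  have "open ((\<lambda>t. x(i := t)) -` T)"
    using T(1) by (intro open_vimage continuous_on_fun_upd continuous_intros)
  moreover have "x i \<in> (\<lambda>t. x(i := t)) -` T" using x T by simp
  ultimately have "\<forall>\<^sub>F t in nhds (x i). t \<in> (\<lambda>t. x(i := t)) -` T" by (rule eventually_nhds_in_open)
  then show ?thesis
    by eventually_elim (use x T i in \<open>auto intro: topspace_Euclidean_upd\<close>)
qed

text \<open>\<open>partial\<close> is built on \<open>deriv\<close>, whose value says nothing where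
  no derivative exists. The relation carries existence along with the value.\<close>

definition has_partial :: "nat \<Rightarrow> ((nat \<Rightarrow> real) \<Rightarrow> real) \<Rightarrow> (nat \<Rightarrow> real) \<Rightarrow> real \<Rightarrow> bool"
  where "has_partial i f x d \<longleftrightarrow> ((\<lambda>t. f (x(i := t))) has_real_derivative d) (at (x i))"

lemma has_partial_imp_partial: "has_partial i f x d \<Longrightarrow> partial i f x = d"
  by (simp add: has_partial_def partial_def DERIV_imp_deriv)

lemma has_partial_cong:
  assumes V: "openin (Euclidean_space m) V" and eq: "\<And>z. z \<in> V \<Longrightarrow> f z = g z" and x: "x \<in> V" and i: "i < m"
  shows "has_partial i f x d \<longleftrightarrow> has_partial i g x d"
  unfolding has_partial_def
  by (rule DERIV_cong_ev) (use eventually_upd_mem[OF V x i] in \<open>auto elim!: eventually_mono simp: eq\<close>)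

lemma partial_cong:
  assumes V: "openin (Euclidean_space m) V" and eq: "\<And>z. z \<in> V \<Longrightarrow> f z = g z" and x: "x \<in> V" and i: "i < m"
  shows "partial i f x = partial i g x"
  unfolding partial_def
  by (rule deriv_cong_ev) (use eventually_upd_mem[OF V x i] in \<open>auto elim!: eventually_mono simp: eq\<close>)

context
  fixes m :: nat and V :: "(nat \<Rightarrow> real) set"
  assumes V: "openin (Euclidean_space m) V"
begin

lemma smooth_continuous:
  "smooth_fun_on m V f \<Longrightarrow> set is \<subseteq> {..<m} \<Longrightarrow> continuous_on V (foldr partial is f)"
  using openin_subset[OF V] by (auto simp: smooth_fun_on_def continuous_map_Euclidean_subspace)

lemma smooth_has_partial:
  assumes "smooth_fun_on m V f" "set is \<subseteq> {..<m}" "i < m" "x \<in> V"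
  shows "has_partial i (foldr partial is f) x (foldr partial (i # is) f x)"
proof -
  have "(\<lambda>t. foldr partial is f (x(i := t))) differentiable (at (x i))"
    using assms unfolding smooth_fun_on_def by blast
  then show ?thesis
    by (simp add: has_partial_def partial_def DERIV_deriv_iff_real_differentiable)
qed

lemma smooth_has_partial_1:
  "smooth_fun_on m V f \<Longrightarrow> i < m \<Longrightarrow> x \<in> V \<Longrightarrow> has_partial i f x (partial i f x)"
  using smooth_has_partial[of f "[]" i x] by simp

text \<open>A coinduction principle: a set of continuous functions closed under partial
  differentiation consists of smooth functions. By induction on the list of directions, each
  iterated derivative of f agrees on V with a member of S. Agreement on V is enough, as V is
  open.\<close>

lemma smooth_coinduct:
  assumes f: "f \<in> S"
    and cont: "\<And>g. g \<in> S \<Longrightarrow> continuous_on V g"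
    and part: "\<And>g i. g \<in> S \<Longrightarrow> i < m \<Longrightarrow> \<exists>h\<in>S. \<forall>x\<in>V. has_partial i g x (h x)"
  shows "smooth_fun_on m V f"
proof -
  have ex: "\<exists>g\<in>S. \<forall>x\<in>V. foldr partial is f x = g x" if "set is \<subseteq> {..<m}" for "is"
    using that
  proof (induction "is")
    case Nil
    then show ?case using f by auto
  next
    case (Cons i "is")
    then obtain g where g: "g \<in> S" "\<And>x. x \<in> V \<Longrightarrow> foldr partial is f x = g x" by auto
    obtain h where h: "h \<in> S" "\<And>x. x \<in> V \<Longrightarrow> has_partial i g x (h x)" using part[OF g(1), of i] Cons by auto
    have "foldr partial (i # is) f x = h x" if "x \<in> V" for x
      using partial_cong[OF V g(2) that, where i = i] has_partial_imp_partial[OF h(2)[OF that]] Cons by simp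
    then show ?case using h by blast
  qed
  show ?thesis
    unfolding smooth_fun_on_def continuous_map_Euclidean_subspace[OF openin_subset[OF V]]
  proof (intro allI impI conjI ballI)
    fix "is" assume "set is \<subseteq> {..<m}"
    then obtain g where g: "g \<in> S" "\<And>x. x \<in> V \<Longrightarrow> foldr partial is f x = g x" using ex by blast
    show "continuous_on V (foldr partial is f)"
      using cont[OF g(1)] by (rule continuous_on_eq) (simp add: g)
    fix i x assume i: "i < m" and x: "x \<in> V"
    obtain h where h: "h \<in> S" "\<And>x. x \<in> V \<Longrightarrow> has_partial i g x (h x)" using part[OF g(1) i] by auto
    have "has_partial i (foldr partial is f) x (h x)"
      using has_partial_cong[OF V g(2) x i] h(2)[OF x] by simp
    then show "(\<lambda>t. foldr partial is f (x(i := t))) differentiable (at (x i))"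
      by (auto simp: has_partial_def real_differentiable_def)
  qed
qed

text \<open>The invariant set consists of the iterated derivatives of f together with g, which may
  differ from f off V. Every member agrees on V with an iterated derivative of f.\<close>

lemma smooth_cong:
  assumes f: "smooth_fun_on m V f" and eq: "\<And>x. x \<in> V \<Longrightarrow> f x = g x"
  shows "smooth_fun_on m V g"
proof (rule smooth_coinduct[of g "insert g {foldr partial is f | is. set is \<subseteq> {..<m}}"])
  fix g' assume "g' \<in> insert g {foldr partial is f | is. set is \<subseteq> {..<m}}"
  then have "\<exists>is. set is \<subseteq> {..<m} \<and> (\<forall>x\<in>V. g' x = foldr partial is f x)"
  proof (cases "g' = g")
    case True
    then show ?thesis by (intro exI[of _ "[]"]) (simp add: eq)
  qed auto
  then obtain "is" where "is": "set is \<subseteq> {..<m}" "\<And>x. x \<in> V \<Longrightarrow> g' x = foldr partial is f x"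
    by blast
  show "continuous_on V g'"
    using smooth_continuous[OF f "is"(1)] by (rule continuous_on_eq) (simp add: "is")
  fix i assume i: "i < m"
  show "\<exists>h\<in>insert g {foldr partial is f | is. set is \<subseteq> {..<m}}. \<forall>x\<in>V. has_partial i g' x (h x)"
  proof (rule bexI, rule ballI)
    fix x assume x: "x \<in> V"
    show "has_partial i g' x (foldr partial (i # is) f x)"
      using has_partial_cong[OF V "is"(2) x i] smooth_has_partial[OF f "is"(1) i x] by simp
  next
    show "foldr partial (i # is) f \<in> insert g {foldr partial is f | is. set is \<subseteq> {..<m}}"
      using i "is"(1) by (intro insertI2 CollectI exI[of _ "i # is"]) auto
  qed
qed auto

text \<open>\<open>foldr\<close> applies the last index first, so differentiating beforehand appends
  i to the list of directions.\<close>

lemma smooth_partial: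
  assumes f: "smooth_fun_on m V f" and i: "i < m"
  shows "smooth_fun_on m V (partial i f)"
proof -
  have "foldr partial is (partial i f) = foldr partial (is @ [i]) f" for "is" by simp
  moreover have "set (is @ [i]) \<subseteq> {..<m}" if "set is \<subseteq> {..<m}" for "is" using i that by auto
  ultimately show ?thesis using f unfolding smooth_fun_on_def by metis
qed

lemma smooth_cmult:
  assumes f: "smooth_fun_on m V f"
  shows "smooth_fun_on m V (\<lambda>x. c * f x)"
proof (rule smooth_coinduct[of _ "{\<lambda>x. c * foldr partial is f x | is. set is \<subseteq> {..<m}}"])
  show "(\<lambda>x. c * f x) \<in> {\<lambda>x. c * foldr partial is f x | is. set is \<subseteq> {..<m}}"
    by (intro CollectI exI[of _ "[]"]) simp
  fix g assume "g \<in> {\<lambda>x. c * foldr partial is f x | is. set is \<subseteq> {..<m}}"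
  then obtain "is" where "is": "set is \<subseteq> {..<m}" "g = (\<lambda>x. c * foldr partial is f x)" by auto
  show "continuous_on V g"
    unfolding "is"(2) by (intro continuous_intros smooth_continuous[OF f "is"(1)])
  fix i assume i: "i < m"
  show "\<exists>h\<in>{\<lambda>x. c * foldr partial is f x | is. set is \<subseteq> {..<m}}. \<forall>x\<in>V. has_partial i g x (h x)"
  proof (rule bexI, rule ballI)
    fix x assume x: "x \<in> V"
    show "has_partial i g x (c * foldr partial (i # is) f x)"
      using smooth_has_partial[OF f "is"(1) i x] unfolding has_partial_def "is"(2) by (rule DERIV_cmult)
  next
    show "(\<lambda>x. c * foldr partial (i # is) f x) \<in> {\<lambda>x. c * foldr partial is f x | is. set is \<subseteq> {..<m}}"
      using i "is"(1) by (intro CollectI exI[of _ "i # is"]) auto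
  qed
qed

lemma smooth_const: "smooth_fun_on m V (\<lambda>x. c)"
proof (rule smooth_coinduct[of _ "range (\<lambda>c x. c)"])
  fix g :: "(nat \<Rightarrow> real) \<Rightarrow> real" and i assume "g \<in> range (\<lambda>c x. c)"
  then show "continuous_on V g" by auto
  show "\<exists>h\<in>range (\<lambda>c x. c). \<forall>x\<in>V. has_partial i g x (h x)"
    using \<open>g \<in> _\<close> by (intro bexI[of _ "\<lambda>x. 0"]) (auto simp: has_partial_def)
qed auto

lemma smooth_coord: "smooth_fun_on m V (\<lambda>x. x j)"
proof (rule smooth_coinduct[of _ "insert (\<lambda>x. x j) (range (\<lambda>c x. c))"])
  fix g :: "(nat \<Rightarrow> real) \<Rightarrow> real" and i assume g: "g \<in> insert (\<lambda>x. x j) (range (\<lambda>c x. c))"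
  have "continuous_on V (\<lambda>x. x j)"
    by (rule continuous_on_product_then_coordinatewise) (rule continuous_on_id)
  then show "continuous_on V g" using g by auto
  have "has_partial i (\<lambda>x. x j) x (if i = j then 1 else 0)" for x
    by (cases "i = j") (auto simp: has_partial_def intro!: derivative_eq_intros)
  moreover have "has_partial i (\<lambda>x. c) x 0" for x c by (simp add: has_partial_def)
  ultimately show "\<exists>h\<in>insert (\<lambda>x. x j) (range (\<lambda>c x. c)). \<forall>x\<in>V. has_partial i g x (h x)"
    using g
    by (intro bexI[of _ "\<lambda>x. if g = (\<lambda>x. x j) then if i = j then 1 else 0 else 0"]) auto
qed auto

end

text \<open>A product of intervals is stable under replacing any coordinate by another value of its
  interval. Freezing a coordinate and differentiating along it therefore never leave the
  domain.\<close>

definition cube :: "nat \<Rightarrow> (nat \<Rightarrow> real) \<Rightarrow> real \<Rightarrow> (nat \<Rightarrow> real) set"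
  where "cube m y \<epsilon> = {x \<in> topspace (Euclidean_space m). \<forall>i<m. \<bar>x i - y i\<bar> < \<epsilon>}"

lemma openin_cube: "openin (Euclidean_space m) (cube m y \<epsilon>)"
proof -
  have "open {x :: nat \<Rightarrow> real. \<bar>x i - y i\<bar> < \<epsilon>}" for i
    by (rule open_Collect_less[OF continuous_on_rabs[OF continuous_on_diff[OF continuous_on_coord continuous_on_const]]
         continuous_on_const])
  then have "open (\<Inter>i<m. {x :: nat \<Rightarrow> real. \<bar>x i - y i\<bar> < \<epsilon>})" by (intro open_INT) auto
  then have "openin (top_of_set (topspace (Euclidean_space m))) (topspace (Euclidean_space m) \<inter> (\<Inter>i<m. {x. \<bar>x i - y i\<bar> < \<epsilon>}))"
    by (rule openin_open_Int)
  moreover have "cube m y \<epsilon> = topspace (Euclidean_space m) \<inter> (\<Inter>i<m. {x. \<bar>x i - y i\<bar> < \<epsilon>})"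
    by (auto simp: cube_def)
  ultimately show ?thesis by (simp only: Euclidean_space_top_of_set[symmetric])
qed

lemma cube_subset:
  assumes "openin (Euclidean_space m) V" "y \<in> V"
  obtains \<epsilon> where "\<epsilon> > 0" "cube m y \<epsilon> \<subseteq> V"
proof -
  obtain T where T: "openin (powertop_real UNIV) T" "V = T \<inter> {x. \<forall>i\<ge>m. x i = 0}"
    using assms(1) by (auto simp: Euclidean_space_def openin_subtopology)
  have yT: "y \<in> T" using assms T by auto
  obtain X where X: "y \<in> (\<Pi>\<^sub>E i\<in>UNIV. X i)" "\<And>i. openin euclideanreal (X i)" "(\<Pi>\<^sub>E i\<in>UNIV. X i) \<subseteq> T"
    using product_topology_open_contains_basis[OF T(1) yT] by auto
  have "\<exists>e>0. \<forall>t. \<bar>t - y i\<bar> < e \<longrightarrow> t \<in> X i" for i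
  proof -
    have "open (X i)" "y i \<in> X i" using X by auto
    then show ?thesis unfolding open_dist dist_real_def by blast
  qed
  then obtain e where e: "\<And>i. e i > 0" "\<And>i t. \<bar>t - y i\<bar> < e i \<Longrightarrow> t \<in> X i" by metis
  \<comment> \<open>The extra element 1 keeps the minimum meaningful for m = 0.\<close>
  define \<epsilon> where "\<epsilon> = Min (insert 1 (e ` {..<m}))"
  have \<epsilon>: "\<epsilon> > 0" "\<And>i. i < m \<Longrightarrow> \<epsilon> \<le> e i" using e(1) by (auto simp: \<epsilon>_def)
  have "x \<in> V" if "x \<in> cube m y \<epsilon>" for x
  proof -
    have x: "\<forall>i\<ge>m. x i = 0" "\<And>i. i < m \<Longrightarrow> \<bar>x i - y i\<bar> < \<epsilon>"
      using that by (auto simp: cube_def topspace_Euclidean_space)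
    \<comment> \<open>From index m on, both points have coordinate 0, so these coordinates satisfy
      the product condition trivially.\<close>
    have y: "\<forall>i\<ge>m. y i = 0" using assms T by auto
    have "x i \<in> X i" for i
    proof (cases "i < m")
      case True
      then show ?thesis using x(2)[OF True] \<epsilon>(2)[OF True] by (intro e(2)) auto
    next
      case False
      then show ?thesis using x y e by (intro e(2)) auto
    qed
    then show ?thesis using X x T by auto
  qed
  with \<epsilon> that show thesis by blast
qed

lemma center_mem_cube:
  "y \<in> topspace (Euclidean_space m) \<Longrightarrow> \<epsilon> > 0 \<Longrightarrow> y \<in> cube m y \<epsilon>"
  by (simp add: cube_def)

lemma cube_upd:
  "x \<in> cube m y \<epsilon> \<Longrightarrow> i < m \<Longrightarrow> \<bar>t - y i\<bar> < \<epsilon> \<Longrightarrow> x(i := t) \<in> cube m y \<epsilon>"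
  by (simp add: cube_def topspace_Euclidean_upd)

section \<open>Hadamard's lemma on a cube, one coordinate at a time\<close>

context
  fixes m :: nat and y :: "nat \<Rightarrow> real" and \<epsilon> :: real and i :: nat and h :: "(nat \<Rightarrow> real) \<Rightarrow> real"
  assumes \<epsilon>: "\<epsilon> > 0" and i: "i < m" and h: "smooth_fun_on m (cube m y \<epsilon>) h"
begin

lemma smooth_freeze: "smooth_fun_on m (cube m y \<epsilon>) (\<lambda>x. h (x(i := y i)))"
proof (rule smooth_coinduct[OF openin_cube, of _ "insert (\<lambda>x. 0) {\<lambda>x. foldr partial is h (x(i := y i)) | is. set is \<subseteq> {..<m}}"])
  show "(\<lambda>x. h (x(i := y i))) \<in> insert (\<lambda>x. 0) {\<lambda>x. foldr partial is h (x(i := y i)) | is. set is \<subseteq> {..<m}}"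
    by (intro insertI2 CollectI exI[of _ "[]"]) simp
  fix g assume "g \<in> insert (\<lambda>x. 0) {\<lambda>x. foldr partial is h (x(i := y i)) | is. set is \<subseteq> {..<m}}"
  then consider "g = (\<lambda>x. 0)" | "is" where "set is \<subseteq> {..<m}" "g = (\<lambda>x. foldr partial is h (x(i := y i)))" by auto
  note g = this
  have upd: "x(i := y i) \<in> cube m y \<epsilon>" if "x \<in> cube m y \<epsilon>" for x using that i \<epsilon> by (intro cube_upd) auto
  show "continuous_on (cube m y \<epsilon>) g"
    using g
  proof cases
    case 2
    have "continuous_on (cube m y \<epsilon>) (\<lambda>x. foldr partial is h (x(i := y i)))"
      by (rule continuous_on_compose2[OF smooth_continuous[OF openin_cube h 2(1)]
           continuous_on_fun_upd[OF continuous_on_id continuous_on_const]]) (use upd in auto)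
    then show ?thesis using 2 by simp
  qed auto
  fix j assume j: "j < m"
  show "\<exists>k\<in>insert (\<lambda>x. 0) {\<lambda>x. foldr partial is h (x(i := y i)) | is. set is \<subseteq> {..<m}}.
     \<forall>x\<in> cube m y \<epsilon>. has_partial j g x (k x)"
    using g
  proof cases
    case 1
    then show ?thesis by (intro bexI[of _ "\<lambda>x. 0"]) (auto simp: has_partial_def)
  next
    case 2
    show ?thesis
    proof (cases "j = i")
      case True
      then show ?thesis unfolding 2(2) by (intro bexI[of _ "\<lambda>x. 0"]) (auto simp: has_partial_def)
    next
      case False
      have "has_partial j g x (foldr partial (j # is) h (x(i := y i)))" if "x \<in> cube m y \<epsilon>" for x
        using smooth_has_partial[OF openin_cube h 2(1) j upd[OF that]] False
        by (simp add: has_partial_def 2(2) fun_upd_twist)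
      moreover have "(\<lambda>x. foldr partial (j # is) h (x(i := y i))) \<in> {\<lambda>x. foldr partial is h (x(i := y i)) | is. set is \<subseteq> {..<m}}"
        using j 2(1) by (intro CollectI exI[of _ "j # is"]) auto
      ultimately show ?thesis
        by (intro bexI[of _ "\<lambda>x. foldr partial (j # is) h (x(i := y i))"] ballI insertI2)
    qed
  qed
qed

definition ray :: "(nat \<Rightarrow> real) \<Rightarrow> real \<Rightarrow> nat \<Rightarrow> real"
  where "ray x t = x(i := y i + t * (x i - y i))"

text \<open>The powers of t make the family closed under partial differentiation, as
  \<open>smooth_coinduct\<close> requires: each derivative in direction i brings out a factor t.
  Hadamard's quotient is the member for the list [i] and exponent 0.\<close>

definition ray_integral :: "nat list \<Rightarrow> nat \<Rightarrow> (nat \<Rightarrow> real) \<Rightarrow> real"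
  where "ray_integral is k x = integral (cbox 0 1) (\<lambda>t. t ^ k * foldr partial is h (ray x t))"

lemma ray_mem: "x \<in> cube m y \<epsilon> \<Longrightarrow> t \<in> {0..1} \<Longrightarrow> ray x t \<in> cube m y \<epsilon>"
proof -
  assume x: "x \<in> cube m y \<epsilon>" and t: "t \<in> {0..1}"
  have "\<bar>t * (x i - y i)\<bar> \<le> 1 * \<bar>x i - y i\<bar>"
    unfolding abs_mult using t by (intro mult_right_mono) auto
  also have "\<dots> < \<epsilon>" using x i by (auto simp: cube_def)
  finally show ?thesis unfolding ray_def using x i by (intro cube_upd) auto
qed

lemma continuous_on_ray_integrand:
  assumes "set is \<subseteq> {..<m}"
  shows "continuous_on ((cube m y \<epsilon>) \<times> cbox 0 1) (\<lambda>(x, t). t ^ k * foldr partial is h (ray x t))"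
proof -
  have c: "continuous_on ((cube m y \<epsilon>) \<times> cbox (0::real) 1) (\<lambda>z. fst z i)"
    by (rule continuous_on_product_then_coordinatewise) (rule continuous_on_fst[OF continuous_on_id])
  have "continuous_on ((cube m y \<epsilon>) \<times> cbox (0::real) 1) (\<lambda>z. ray (fst z) (snd z))"
    unfolding ray_def by (intro continuous_on_fun_upd continuous_intros c)
  then have "continuous_on ((cube m y \<epsilon>) \<times> cbox (0::real) 1) (\<lambda>z. foldr partial is h (ray (fst z) (snd z)))"
    by (rule continuous_on_compose2[OF smooth_continuous[OF openin_cube h assms]]) (auto intro: ray_mem)
  then show ?thesis by (auto simp: case_prod_unfold intro!: continuous_intros)
qed

lemma continuous_on_ray_integral: "set is \<subseteq> {..<m} \<Longrightarrow> continuous_on (cube m y \<epsilon>) (ray_integral is k)"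
  unfolding ray_integral_def[abs_def]
  by (rule integral_continuous_on_param) (rule continuous_on_ray_integrand)

text \<open>Differentiation under the integral sign with the j-th coordinate as parameter. For j = i
  the chain rule yields the factor t, and for j \<noteq> i the update commutes with passing to the
  ray.\<close>

lemma has_partial_ray_integral:
  assumes "is": "set is \<subseteq> {..<m}" and j: "j < m" and x: "x \<in> cube m y \<epsilon>"
  shows "has_partial j (ray_integral is k) x (ray_integral (j # is) (if j = i then Suc k else k) x)"
proof -
  \<comment> \<open>The interval of admissible j-th coordinates. It is open, so the derivative
    within it is the full derivative.\<close>
  let ?U = "ball (y j) \<epsilon>" and ?k = "if j = i then Suc k else k"
  have is': "set (j # is) \<subseteq> {..<m}" using "is" j by auto
  have U: "x(j := s) \<in> cube m y \<epsilon>" if "s \<in> ?U" for s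
    using that x j by (intro cube_upd) (auto simp: dist_real_def abs_minus_commute)
  have xj: "x j \<in> ?U" using x j by (auto simp: cube_def dist_real_def abs_minus_commute)
  have cont: "continuous_on (?U \<times> cbox 0 1) (\<lambda>(s, t). t ^ l * foldr partial js h (ray (x(j := s)) t))"
    if js: "set js \<subseteq> {..<m}" for js l
  proof -
    have "continuous_on (?U \<times> cbox (0::real) 1) (\<lambda>z. (x(j := fst z), snd z))"
      by (intro continuous_on_Pair continuous_on_fun_upd continuous_intros)
    then have "continuous_on (?U \<times> cbox (0::real) 1) (\<lambda>z. (\<lambda>(x, t). t ^ l * foldr partial js h (ray x t)) (x(j := fst z), snd z))"
      by (rule continuous_on_compose2[OF continuous_on_ray_integrand[OF js]]) (auto simp: U simp del: mem_ball)
    then show ?thesis by (simp add: case_prod_unfold)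
  qed
  have "((\<lambda>s. integral (cbox 0 1) (\<lambda>t. t ^ k * foldr partial is h (ray (x(j := s)) t))) has_field_derivative
     integral (cbox 0 1) (\<lambda>t. t ^ ?k * foldr partial (j # is) h (ray (x(j := x j)) t))) (at (x j) within ?U)"
  proof (rule leibniz_rule_field_derivative)
    fix s t assume s: "s \<in> ?U" and t: "t \<in> cbox 0 (1::real)"
    define z where "z = ray (x(j := s)) t"
    have z: "z \<in> cube m y \<epsilon>" unfolding z_def using U[OF s] t by (intro ray_mem) auto
    have hp: "((\<lambda>r. foldr partial is h (z(j := r))) has_real_derivative foldr partial (j # is) h z) (at (z j))"
      using smooth_has_partial[OF openin_cube h "is" j z] by (simp add: has_partial_def)
    have "((\<lambda>s. foldr partial is h (ray (x(j := s)) t)) has_real_derivative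
       (if j = i then t else 1) * foldr partial (j # is) h z) (at s)"
    proof (cases "j = i")
      case True
      have "((\<lambda>s. foldr partial is h (z(j := y j + t * (s - y j)))) has_real_derivative foldr partial (j # is) h z * t) (at s)"
      proof (rule DERIV_chain2[of "\<lambda>r. foldr partial is h (z(j := r))"])
        show "((\<lambda>r. foldr partial is h (z(j := r))) has_real_derivative foldr partial (j # is) h z) (at (y j + t * (s - y j)))"
          using hp True by (simp add: z_def ray_def)
        show "((\<lambda>s. y j + t * (s - y j)) has_real_derivative t) (at s)"
          by (auto intro!: derivative_eq_intros)
      qed
      then show ?thesis using True by (simp add: z_def ray_def mult.commute)
    next
      case False
      have "ray (x(j := r)) t = z(j := r)" for r using False by (auto simp: z_def ray_def fun_upd_twist)
      moreover have "z j = s" using False by (simp add: z_def ray_def)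
      ultimately show ?thesis using hp False by simp
    qed
    then have "((\<lambda>s. t ^ k * foldr partial is h (ray (x(j := s)) t)) has_real_derivative
       t ^ k * ((if j = i then t else 1) * foldr partial (j # is) h z)) (at s)"
      by (rule DERIV_cmult)
    moreover have "t ^ k * ((if j = i then t else 1) * foldr partial (j # is) h z) = t ^ ?k * foldr partial (j # is) h z"
      by simp
    ultimately show "((\<lambda>s. t ^ k * foldr partial is h (ray (x(j := s)) t)) has_field_derivative
       t ^ ?k * foldr partial (j # is) h (ray (x(j := s)) t)) (at s within ?U)"
      unfolding z_def by (metis has_field_derivative_at_within)
  next
    fix s assume s: "s \<in> ?U"
    have "continuous_on (cbox 0 1) (\<lambda>t. (\<lambda>(s, t). t ^ k * foldr partial is h (ray (x(j := s)) t)) (s, t))"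
      by (rule continuous_on_compose2[OF cont[OF "is"]]) (use s in \<open>auto intro!: continuous_intros\<close>)
    then show "(\<lambda>t. t ^ k * foldr partial is h (ray (x(j := s)) t)) integrable_on cbox 0 1"
      by (intro integrable_continuous) simp
  next
    show "continuous_on (?U \<times> cbox 0 1) (\<lambda>(s, t). t ^ ?k * foldr partial (j # is) h (ray (x(j := s)) t))"
      by (rule cont[OF is'])
  qed (use xj in auto)
  then show ?thesis
    using xj by (simp add: has_partial_def ray_integral_def at_within_open[OF _ open_ball])
qed

lemma smooth_ray_integral: "smooth_fun_on m (cube m y \<epsilon>) (ray_integral [i] 0)"
proof (rule smooth_coinduct[OF openin_cube, of _ "{ray_integral is k | is k. set is \<subseteq> {..<m}}"])
  show "ray_integral [i] 0 \<in> {ray_integral is k | is k. set is \<subseteq> {..<m}}" using i by auto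
  fix g assume "g \<in> {ray_integral is k | is k. set is \<subseteq> {..<m}}"
  then obtain "is" k where g: "g = ray_integral is k" "set is \<subseteq> {..<m}" by auto
  then show "continuous_on (cube m y \<epsilon>) g" by (simp add: continuous_on_ray_integral)
  fix j assume j: "j < m"
  show "\<exists>k\<in>{ray_integral is k | is k. set is \<subseteq> {..<m}}. \<forall>x\<in> cube m y \<epsilon>. has_partial j g x (k x)"
  proof (rule bexI, rule ballI)
    fix x assume "x \<in> cube m y \<epsilon>"
    then show "has_partial j g x (ray_integral (j # is) (if j = i then Suc k else k) x)"
      unfolding g(1) by (rule has_partial_ray_integral[OF g(2) j])
  next
    have "set (j # is) \<subseteq> {..<m}" using g(2) j by auto
    then show "ray_integral (j # is) (if j = i then Suc k else k) \<in> {ray_integral is k | is k. set is \<subseteq> {..<m}}"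
      by blast
  qed
qed

text \<open>The fundamental theorem of calculus along the ray, whose velocity x_i - y_i comes out of
  the integral.\<close>

lemma ray_integral_eq:
  assumes x: "x \<in> cube m y \<epsilon>"
  shows "h x - h (x(i := y i)) = (x i - y i) * ray_integral [i] 0 x"
proof -
  have "((\<lambda>t. (x i - y i) * partial i h (ray x t)) has_integral h (ray x 1) - h (ray x 0)) {0..1}"
  proof (rule fundamental_theorem_of_calculus)
    fix t :: real assume t: "t \<in> {0..1}"
    have "has_partial i h (ray x t) (partial i h (ray x t))"
      by (rule smooth_has_partial_1[OF openin_cube h i ray_mem[OF x t]])
    then have hp: "((\<lambda>r. h (x(i := r))) has_real_derivative partial i h (ray x t)) (at (y i + t * (x i - y i)))"
      by (simp add: has_partial_def ray_def)
    have "((\<lambda>t. y i + t * (x i - y i)) has_real_derivative (x i - y i)) (at t)"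
      by (auto intro!: derivative_eq_intros)
    from DERIV_chain2[OF hp this]
    have "((\<lambda>t. h (ray x t)) has_real_derivative (x i - y i) * partial i h (ray x t)) (at t)"
      by (simp add: ray_def mult.commute)
    then show "((\<lambda>t. h (ray x t)) has_vector_derivative (x i - y i) * partial i h (ray x t)) (at t within {0..1})"
      by (simp add: has_real_derivative_iff_has_vector_derivative has_vector_derivative_at_within)
  qed simp
  from integral_unique[OF this] have "h (ray x 1) - h (ray x 0) = (x i - y i) * integral {0..1} (\<lambda>t. partial i h (ray x t))"
    by simp
  then show ?thesis by (simp add: ray_def ray_integral_def cbox_interval)
qed

text \<open>Only one coordinate is expanded, so a single smooth quotient appears. Freezing the
  coordinates successively recovers the full expansion.\<close>

theorem Hadamard:
  obtains g where "smooth_fun_on m (cube m y \<epsilon>) g" "\<And>x. x \<in> cube m y \<epsilon> \<Longrightarrow> h x = h (x(i := y i)) + (x i - y i) * g x"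
  using that[OF smooth_ray_integral] ray_integral_eq by (metis add.commute diff_eq_eq)

end

section \<open>Derivations of the local model\<close>

lemma psgn_of_nat: "psgn (of_nat k) = (-1) ^ k"
  by (induction k) (auto simp: psgn_add)

lemma ext_sign_empty [simp]: "ext_sign {} J = 1" "ext_sign I {} = 1"
  by (simp_all add: ext_sign_def)

lemma ext_sign_square [simp]: "ext_sign I J * ext_sign I J = 1" "ext_sign I J * (ext_sign I J * x) = x"
  by (simp_all add: ext_sign_def flip: power_mult_distrib mult.assoc)

lemma ext_sign_Un_left:
  assumes "finite I" "finite I'" "finite J" "I \<inter> I' = {}"
  shows "ext_sign (I \<union> I') J = ext_sign I J * ext_sign I' J"
proof -
  have "{(i, j). i \<in> I \<union> I' \<and> j \<in> J \<and> j < i} =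
     {(i, j). i \<in> I \<and> j \<in> J \<and> j < i} \<union> {(i, j). i \<in> I' \<and> j \<in> J \<and> j < i}" by auto
  moreover have "finite {(i, j). i \<in> I \<and> j \<in> J \<and> j < i}" "finite {(i, j). i \<in> I' \<and> j \<in> J \<and> j < i}"
    using assms by (auto intro: finite_subset[of _ "I \<times> J"] finite_subset[of _ "I' \<times> J"])
  moreover have "{(i, j). i \<in> I \<and> j \<in> J \<and> j < i} \<inter> {(i, j). i \<in> I' \<and> j \<in> J \<and> j < i} = {}"
    using assms by auto
  ultimately show ?thesis by (simp add: ext_sign_def card_Un_disjoint power_add)
qed

lemma ext_sign_Un_right:
  assumes "finite I" "finite J" "finite J'" "J \<inter> J' = {}"
  shows "ext_sign I (J \<union> J') = ext_sign I J * ext_sign I J'"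
proof -
  have "{(i, j). i \<in> I \<and> j \<in> J \<union> J' \<and> j < i} =
     {(i, j). i \<in> I \<and> j \<in> J \<and> j < i} \<union> {(i, j). i \<in> I \<and> j \<in> J' \<and> j < i}" by auto
  moreover have "finite {(i, j). i \<in> I \<and> j \<in> J \<and> j < i}" "finite {(i, j). i \<in> I \<and> j \<in> J' \<and> j < i}"
    using assms by (auto intro: finite_subset[of _ "I \<times> J"] finite_subset[of _ "I \<times> J'"])
  moreover have "{(i, j). i \<in> I \<and> j \<in> J \<and> j < i} \<inter> {(i, j). i \<in> I \<and> j \<in> J' \<and> j < i} = {}"
    using assms by auto
  ultimately show ?thesis by (simp add: ext_sign_def card_Un_disjoint power_add)
qed

lemma ext_sign_insert_left:
  "finite I \<Longrightarrow> finite J \<Longrightarrow> j \<notin> I \<Longrightarrow> ext_sign (insert j I) J = ext_sign {j} J * ext_sign I J"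
  using ext_sign_Un_left[of "{j}" I J] by simp

lemma ext_sign_insert_right:
  "finite I \<Longrightarrow> finite J \<Longrightarrow> j \<notin> J \<Longrightarrow> ext_sign I (insert j J) = ext_sign I {j} * ext_sign I J"
  using ext_sign_Un_right[of I "{j}" J] by simp

text \<open>One factor counts the elements of I below j, the other those above j. Together they
  exhaust I.\<close>

lemma ext_sign_swap:
  assumes "finite I" "j \<notin> I"
  shows "ext_sign {j} I * ext_sign I {j} = (-1) ^ card I"
proof -
  have "{(i, k). i \<in> {j} \<and> k \<in> I \<and> k < i} = Pair j ` {k \<in> I. k < j}" by auto
  then have "card {(i, k). i \<in> {j} \<and> k \<in> I \<and> k < i} = card {k \<in> I. k < j}"
    by (simp add: card_image inj_on_def)
  moreover have "{(i, k). i \<in> I \<and> k \<in> {j} \<and> k < i} = (\<lambda>i. (i, j)) ` {k \<in> I. j < k}" by auto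
  then have "card {(i, k). i \<in> I \<and> k \<in> {j} \<and> k < i} = card {k \<in> I. j < k}"
    by (simp add: card_image inj_on_def)
  moreover have "card {k \<in> I. k < j} + card {k \<in> I. j < k} = card ({k \<in> I. k < j} \<union> {k \<in> I. j < k})"
    using assms by (subst card_Un_disjoint) auto
  moreover have "{k \<in> I. k < j} \<union> {k \<in> I. j < k} = I" using assms by (auto) (metis linorder_neqE_nat)
  ultimately show ?thesis by (simp add: ext_sign_def flip: power_add)
qed

lemma ext_sign_swap': "finite I \<Longrightarrow> j \<notin> I \<Longrightarrow> ext_sign I {j} = (-1) ^ card I * ext_sign {j} I"
  by (metis ext_sign_swap ext_sign_square(2) mult.commute)

type_synonym model_section = "nat set \<Rightarrow> (nat \<Rightarrow> real) \<Rightarrow> real"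

abbreviation model_carrier :: "nat \<Rightarrow> nat \<Rightarrow> (nat \<Rightarrow> real) set \<Rightarrow> model_section set"
  where "model_carrier m n V \<equiv> carrier (model_algebra m n V)"

definition mmult :: "model_section \<Rightarrow> model_section \<Rightarrow> model_section"
  where "mmult f g = (\<lambda>K x. \<Sum>I\<in>Pow K. ext_sign I (K - I) * f I x * g (K - I) x)"

text \<open>The section h \<theta>_J over V, cut off outside V as the carrier demands. For J empty
  it is the function h.\<close>

definition mlift :: "(nat \<Rightarrow> real) set \<Rightarrow> nat set \<Rightarrow> ((nat \<Rightarrow> real) \<Rightarrow> real) \<Rightarrow> model_section"
  where "mlift V J h = (\<lambda>I x. if I = J \<and> x \<in> V then h x else 0)"

lemma model_simps:
  "mult (model_algebra m n V) = mmult" "one (model_algebra m n V) = mlift V {} (\<lambda>_. 1)"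
  "zero (model_algebra m n V) = (\<lambda>I x. 0)" "add (model_algebra m n V) = (\<lambda>f g I x. f I x + g I x)"
  "smult (model_algebra m n V) = (\<lambda>c f I x. c * f I x)"
  "sec (model_sheaf m n) = model_algebra m n"
  "res (model_sheaf m n) V W = (\<lambda>f I x. if x \<in> W then f I x else 0)"
  by (simp_all add: model_algebra_def mmult_def[abs_def] mlift_def model_sheaf_def)

lemma model_carrier_iff:
  "f \<in> model_carrier m n V \<longleftrightarrow> (\<forall>I. smooth_fun_on m V (f I)) \<and>
    (\<forall>I. \<not> I \<subseteq> {..<n} \<longrightarrow> f I = (\<lambda>_. 0)) \<and> (\<forall>I x. x \<notin> V \<longrightarrow> f I x = 0)"
  by (simp add: model_algebra_def)

lemma model_par_iff:
  "f \<in> par (model_sheaf m n) V p \<longleftrightarrow> f \<in> model_carrier m n V \<and>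
    (\<forall>I x. f I x \<noteq> 0 \<longrightarrow> (of_nat (card I) :: bit) = p)"
  by (auto simp: model_sheaf_def fun_eq_iff)

text \<open>The sum then ranges over infinitely many subsets and takes its default value 0, in
  agreement with the vanishing of coefficients at infinite index sets.\<close>

lemma mmult_infinite: "infinite K \<Longrightarrow> mmult f g K x = 0"
  by (simp add: mmult_def)

text \<open>The index j belongs either to the right or to the left factor. The Leibniz rule for the
  derivative in \<theta>_j compares these two groups of terms.\<close>

lemma mmult_insert:
  assumes "finite K" "j \<notin> K"
  shows "mmult f g (insert j K) x =
    (\<Sum>L\<in>Pow K. ext_sign L (insert j (K - L)) * f L x * g (insert j (K - L)) x +
       ext_sign (insert j L) (K - L) * f (insert j L) x * g (K - L) x)"
proof -
  have inj: "inj_on (insert j) (Pow K)" using assms by (auto simp: inj_on_def)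
  have disj: "Pow K \<inter> insert j ` Pow K = {}" using assms by auto
  have "mmult f g (insert j K) x = (\<Sum>L\<in>Pow K \<union> insert j ` Pow K.
     ext_sign L (insert j K - L) * f L x * g (insert j K - L) x)"
    by (simp add: mmult_def Pow_insert)
  also have "\<dots> = (\<Sum>L\<in>Pow K. ext_sign L (insert j K - L) * f L x * g (insert j K - L) x) +
     (\<Sum>L\<in>insert j ` Pow K. ext_sign L (insert j K - L) * f L x * g (insert j K - L) x)"
    using assms disj by (intro sum.union_disjoint) auto
  also have "(\<Sum>L\<in>insert j ` Pow K. ext_sign L (insert j K - L) * f L x * g (insert j K - L) x) =
     (\<Sum>L\<in>Pow K. ext_sign (insert j L) (insert j K - insert j L) * f (insert j L) x * g (insert j K - insert j L) x)"
    using inj by (simp add: sum.reindex)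
  also have "\<dots> = (\<Sum>L\<in>Pow K. ext_sign (insert j L) (K - L) * f (insert j L) x * g (K - L) x)"
  proof (rule sum.cong[OF refl])
    fix L assume "L \<in> Pow K"
    then have "insert j K - insert j L = K - L" using assms by auto
    then show "ext_sign (insert j L) (insert j K - insert j L) * f (insert j L) x * g (insert j K - insert j L) x =
       ext_sign (insert j L) (K - L) * f (insert j L) x * g (K - L) x" by simp
  qed
  also have "(\<Sum>L\<in>Pow K. ext_sign L (insert j K - L) * f L x * g (insert j K - L) x) =
     (\<Sum>L\<in>Pow K. ext_sign L (insert j (K - L)) * f L x * g (insert j (K - L)) x)"
  proof (rule sum.cong[OF refl])
    fix L assume "L \<in> Pow K"
    then have "insert j K - L = insert j (K - L)" using assms by auto
    then show "ext_sign L (insert j K - L) * f L x * g (insert j K - L) x =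
      ext_sign L (insert j (K - L)) * f L x * g (insert j (K - L)) x" by simp
  qed
  finally show ?thesis by (simp add: sum.distrib)
qed

lemma smooth_add:
  assumes V: "openin (Euclidean_space m) V" and f: "smooth_fun_on m V f" and g: "smooth_fun_on m V g"
  shows "smooth_fun_on m V (\<lambda>x. f x + g x)"
proof (rule smooth_coinduct[OF V, of _ "{\<lambda>x. foldr partial is f x + foldr partial is g x | is. set is \<subseteq> {..<m}}"])
  show "(\<lambda>x. f x + g x) \<in> {\<lambda>x. foldr partial is f x + foldr partial is g x | is. set is \<subseteq> {..<m}}"
    by (intro CollectI exI[of _ "[]"]) simp
  fix u assume "u \<in> {\<lambda>x. foldr partial is f x + foldr partial is g x | is. set is \<subseteq> {..<m}}"
  then obtain "is" where "is": "set is \<subseteq> {..<m}" "u = (\<lambda>x. foldr partial is f x + foldr partial is g x)" by auto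
  show "continuous_on V u"
    unfolding "is"(2) by (intro continuous_on_add smooth_continuous[OF V _ "is"(1)] f g)
  fix i assume i: "i < m"
  show "\<exists>h\<in>{\<lambda>x. foldr partial is f x + foldr partial is g x | is. set is \<subseteq> {..<m}}. \<forall>x\<in>V. has_partial i u x (h x)"
  proof (rule bexI, rule ballI)
    fix x assume x: "x \<in> V"
    show "has_partial i u x (foldr partial (i # is) f x + foldr partial (i # is) g x)"
      using smooth_has_partial[OF V f "is"(1) i x] smooth_has_partial[OF V g "is"(1) i x]
      unfolding has_partial_def "is"(2) by (rule DERIV_add)
  next
    show "(\<lambda>x. foldr partial (i # is) f x + foldr partial (i # is) g x) \<in>
      {\<lambda>x. foldr partial is f x + foldr partial is g x | is. set is \<subseteq> {..<m}}"
      using i "is"(1) by (intro CollectI exI[of _ "i # is"]) auto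
  qed
qed

text \<open>The derivative in x_i. The cut-off restores the value 0 outside V, since
  \<open>partial\<close> of an extension by zero cannot be relied upon at the boundary.\<close>

definition mod_d :: "nat \<Rightarrow> (nat \<Rightarrow> real) set \<Rightarrow> model_section \<Rightarrow> model_section"
  where "mod_d i V f = (\<lambda>I x. if x \<in> V then partial i (f I) x else 0)"

text \<open>The left derivative in \<theta>_j: write \<theta>_{I+j} as \<open>ext_sign {j} I\<close>
  times \<theta>_j \<theta>_I and delete the leading \<theta>_j.\<close>

definition mod_theta :: "nat \<Rightarrow> model_section \<Rightarrow> model_section"
  where "mod_theta j f = (\<lambda>I x. if j \<in> I then 0 else ext_sign {j} I * f (insert j I) x)"

text \<open>For j outside K, the two groups of terms in \<open>mmult_insert\<close> are the two
  summands, the sign arising from carrying \<theta>_j past f. For j in K, the left side is 0, and on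
  the right the products in which both original factors contain j occur twice with opposite
  signs.\<close>

lemma mod_theta_Leibniz:
  assumes f: "\<And>I x. f I x \<noteq> 0 \<Longrightarrow> (of_nat (card I) :: bit) = q"
  shows "mod_theta j (mmult f g) K x = mmult (mod_theta j f) g K x + psgn q * mmult f (mod_theta j g) K x"
proof (cases "finite K")
  case False
  then show ?thesis by (simp add: mod_theta_def mmult_infinite)
next
  case fin: True
  \<comment> \<open>The parity of an index set is known only where the coefficient is nonzero,
    whence the case distinctions on vanishing coefficients below.\<close>
  have q: "psgn q = (-1) ^ card I" if "f I x \<noteq> 0" for I
    using psgn_of_nat[of "card I"] f[OF that] by simp
  show ?thesis
  proof (cases "j \<in> K")
    case False
    have "ext_sign {j} K * (ext_sign L (insert j (K - L)) * f L x * g (insert j (K - L)) x +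
       ext_sign (insert j L) (K - L) * f (insert j L) x * g (K - L) x) =
      ext_sign L (K - L) * mod_theta j f L x * g (K - L) x +
      psgn q * (ext_sign L (K - L) * f L x * mod_theta j g (K - L) x)" if L: "L \<in> Pow K" for L
    proof -
      have fL: "finite L" "finite (K - L)" "j \<notin> L" "j \<notin> K - L" using L fin False by (auto intro: finite_subset)
      have "L \<union> (K - L) = K" using L by auto
      then have K: "ext_sign {j} K = ext_sign {j} L * ext_sign {j} (K - L)"
        using ext_sign_Un_right[of "{j}" L "K - L"] fL by simp
      have 1: "ext_sign {j} K * (ext_sign L (insert j (K - L)) * f L x) = psgn q * (ext_sign L (K - L) * f L x * ext_sign {j} (K - L))"
      proof (cases "f L x = 0")
        case nz: False
        define a b c where "a = ext_sign {j} L" and "b = ext_sign {j} (K - L)" and "c = ext_sign L (K - L)"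
        have "ext_sign L (insert j (K - L)) = psgn q * a * c"
          using fL q[OF nz] by (simp only: ext_sign_insert_right[OF fL(1,2,4)] ext_sign_swap'[OF fL(1,3)] a_def c_def mult_ac)
        then have "ext_sign {j} K * (ext_sign L (insert j (K - L)) * f L x) = (a * a) * (psgn q * (c * f L x * b))"
          by (simp only: K a_def[symmetric] b_def[symmetric] c_def[symmetric] mult_ac)
        also have "a * a = 1" by (simp add: a_def)
        finally show ?thesis by (simp add: b_def c_def)
      qed simp
      have 2: "ext_sign {j} K * ext_sign (insert j L) (K - L) = ext_sign L (K - L) * ext_sign {j} L"
        using fL by (simp add: K ext_sign_insert_left[OF fL(1,2,3)] mult_ac)
      have "ext_sign {j} K * (ext_sign L (insert j (K - L)) * f L x * g (insert j (K - L)) x +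
         ext_sign (insert j L) (K - L) * f (insert j L) x * g (K - L) x) =
        (ext_sign {j} K * (ext_sign L (insert j (K - L)) * f L x)) * g (insert j (K - L)) x +
        (ext_sign {j} K * ext_sign (insert j L) (K - L)) * f (insert j L) x * g (K - L) x"
        by (simp only: distrib_left mult.assoc)
      then show ?thesis
        unfolding 1 2 using fL(3,4) by (simp add: mod_theta_def mult_ac)
    qed
    then show ?thesis
      using False fin
      by (simp add: mod_theta_def[of _ "mmult f g"] mmult_insert sum_distrib_left)
        (simp add: mmult_def sum.distrib sum_distrib_left)
  next
    case True
    define K' where "K' = K - {j}"
    have K': "K = insert j K'" "j \<notin> K'" "finite K'" using True fin by (auto simp: K'_def)
    have "mmult (mod_theta j f) g K x + psgn q * mmult f (mod_theta j g) K x = 0"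
      unfolding K'(1) mmult_insert[OF K'(3,2)] sum_distrib_left sum.distrib[symmetric]
    proof (rule sum.neutral, rule ballI)
      fix L assume L: "L \<in> Pow K'"
      have fL: "finite L" "finite (K' - L)" "j \<notin> L" "j \<notin> K' - L" using L K' by (auto intro: finite_subset)
      \<comment> \<open>The coefficient carries one index more than L, so its parity flips the sign
        relative to (-1)^{|L|}. This is what makes the two terms cancel.\<close>
      have "f (insert j L) x = 0 \<or> psgn q = - ((-1) ^ card L)"
        using q[of "insert j L"] fL by auto
      then show "ext_sign L (insert j (K' - L)) * mod_theta j f L x * g (insert j (K' - L)) x +
         ext_sign (insert j L) (K' - L) * mod_theta j f (insert j L) x * g (K' - L) x +
         psgn q * (ext_sign L (insert j (K' - L)) * f L x * mod_theta j g (insert j (K' - L)) x +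
           ext_sign (insert j L) (K' - L) * f (insert j L) x * mod_theta j g (K' - L) x) = 0"
        using fL by (auto simp: mod_theta_def ext_sign_insert_left[OF fL(1,2,3)]
          ext_sign_insert_right[OF fL(1,2,4)] ext_sign_swap'[OF fL(1,3)] mult_ac)
    qed
    then show ?thesis using True by (simp add: mod_theta_def[of _ "mmult f g"])
  qed
qed

section \<open>Coordinate derivations on the sections over an open set\<close>

context
  fixes m n :: nat and V :: "(nat \<Rightarrow> real) set"
  assumes V: "openin (Euclidean_space m) V"
begin

lemma model_smooth: "f \<in> model_carrier m n V \<Longrightarrow> smooth_fun_on m V (f I)"
  by (simp add: model_carrier_iff)

lemma model_smult_closed: "f \<in> model_carrier m n V \<Longrightarrow> (\<lambda>I x. c * f I x) \<in> model_carrier m n V"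
  by (simp add: model_carrier_iff smooth_cmult[OF V])

lemma model_has_partial: "f \<in> model_carrier m n V \<Longrightarrow> i < m \<Longrightarrow> x \<in> V \<Longrightarrow> has_partial i (f I) x (partial i (f I) x)"
  by (rule smooth_has_partial_1[OF V model_smooth])

lemma mod_d_eqI: "x \<in> V \<Longrightarrow> has_partial i (f I) x d \<Longrightarrow> mod_d i V f I x = d"
  by (simp add: mod_d_def has_partial_imp_partial)

lemma mod_d_closed:
  assumes i: "i < m" and f: "f \<in> model_carrier m n V"
  shows "mod_d i V f \<in> model_carrier m n V"
  unfolding model_carrier_iff
proof (intro conjI allI impI)
  fix I
  show "smooth_fun_on m V (mod_d i V f I)"
    by (rule smooth_cong[OF V smooth_partial[OF V model_smooth[OF f] i]]) (simp add: mod_d_def)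
  show "mod_d i V f I = (\<lambda>_. 0)" if "\<not> I \<subseteq> {..<n}"
  proof -
    have "f I = (\<lambda>_. 0)" using f that by (simp add: model_carrier_iff)
    then show ?thesis by (intro ext) (simp add: mod_d_def partial_def)
  qed
qed (simp add: mod_d_def)

lemma mod_d_add:
  assumes i: "i < m" and f: "f \<in> model_carrier m n V" and g: "g \<in> model_carrier m n V"
  shows "mod_d i V (\<lambda>I x. f I x + g I x) = (\<lambda>I x. mod_d i V f I x + mod_d i V g I x)"
proof (intro ext)
  fix I x
  show "mod_d i V (\<lambda>I x. f I x + g I x) I x = mod_d i V f I x + mod_d i V g I x"
  proof (cases "x \<in> V")
    case True
    have "has_partial i (\<lambda>x. f I x + g I x) x (partial i (f I) x + partial i (g I) x)"
      using model_has_partial[OF f i True] model_has_partial[OF g i True]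
      unfolding has_partial_def by (rule DERIV_add)
    then show ?thesis using True by (simp add: mod_d_def has_partial_imp_partial)
  qed (simp add: mod_d_def)
qed

lemma mod_d_smult:
  assumes i: "i < m" and f: "f \<in> model_carrier m n V"
  shows "mod_d i V (\<lambda>I x. c * f I x) = (\<lambda>I x. c * mod_d i V f I x)"
proof (intro ext)
  fix I x
  show "mod_d i V (\<lambda>I x. c * f I x) I x = c * mod_d i V f I x"
  proof (cases "x \<in> V")
    case True
    have "has_partial i (\<lambda>x. c * f I x) x (c * partial i (f I) x)"
      using model_has_partial[OF f i True] unfolding has_partial_def by (rule DERIV_cmult)
    then show ?thesis using True by (simp add: mod_d_def has_partial_imp_partial)
  qed (simp add: mod_d_def)
qed

lemma mod_d_par:
  assumes i: "i < m" and f: "f \<in> par (model_sheaf m n) V q"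
  shows "mod_d i V f \<in> par (model_sheaf m n) V q"
  unfolding model_par_iff
proof (intro conjI allI impI)
  show "mod_d i V f \<in> model_carrier m n V" using f i by (simp add: model_par_iff mod_d_closed)
  fix I x assume "mod_d i V f I x \<noteq> 0"
  then have "partial i (f I) x \<noteq> 0" by (simp add: mod_d_def split: if_splits)
  then have "f I \<noteq> (\<lambda>_. 0)" by (auto simp: partial_def)
  then show "of_nat (card I) = q" using f by (auto simp: model_par_iff fun_eq_iff)
qed

lemma mod_d_Leibniz:
  assumes i: "i < m" and f: "f \<in> model_carrier m n V" and g: "g \<in> model_carrier m n V"
  shows "mod_d i V (mmult f g) K x = mmult (mod_d i V f) g K x + mmult f (mod_d i V g) K x"
proof (cases "x \<in> V")
  case True
  have "has_partial i (mmult f g K) x (\<Sum>I\<in>Pow K. ext_sign I (K - I) * partial i (f I) x * g (K - I) x +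
     ext_sign I (K - I) * f I x * partial i (g (K - I)) x)"
    unfolding has_partial_def mmult_def
  proof (rule DERIV_sum)
    fix I
    have "((\<lambda>t. f I (x(i := t)) * g (K - I) (x(i := t))) has_real_derivative
      partial i (f I) x * g (K - I) (x(i := x i)) + partial i (g (K - I)) x * f I (x(i := x i))) (at (x i))"
      using model_has_partial[OF f i True] model_has_partial[OF g i True]
      unfolding has_partial_def by (rule DERIV_mult)
    from DERIV_cmult[OF this, of "ext_sign I (K - I)"]
    show "((\<lambda>t. ext_sign I (K - I) * f I (x(i := t)) * g (K - I) (x(i := t))) has_real_derivative
      ext_sign I (K - I) * partial i (f I) x * g (K - I) x + ext_sign I (K - I) * f I x * partial i (g (K - I)) x) (at (x i))"
      by (simp add: algebra_simps)
  qed
  then show ?thesis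
    using True by (simp add: mod_d_eqI) (simp add: mmult_def mod_d_def sum.distrib)
next
  case False
  then show ?thesis using f g by (simp add: mmult_def mod_d_def model_carrier_iff)
qed

lemma mod_d_res:
  assumes i: "i < m" and W: "openin (Euclidean_space m) W" "W \<subseteq> V"
  shows "(\<lambda>I x. if x \<in> W then mod_d i V f I x else 0) = mod_d i W (\<lambda>I x. if x \<in> W then f I x else 0)"
proof (intro ext)
  fix I x
  have "partial i (f I) x = partial i (\<lambda>x. if x \<in> W then f I x else 0) x" if "x \<in> W"
    by (rule partial_cong[OF W(1) _ that i]) simp
  then show "(if x \<in> W then mod_d i V f I x else 0) = mod_d i W (\<lambda>I x. if x \<in> W then f I x else 0) I x"
    using W by (auto simp: mod_d_def)
qed

lemma mod_theta_closed:
  assumes f: "f \<in> model_carrier m n V"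
  shows "mod_theta j f \<in> model_carrier m n V"
  unfolding model_carrier_iff
proof (intro conjI allI impI)
  fix I
  show "smooth_fun_on m V (mod_theta j f I)"
    using smooth_const[OF V] smooth_cmult[OF V model_smooth[OF f]] by (cases "j \<in> I") (simp_all add: mod_theta_def)
  show "mod_theta j f I = (\<lambda>_. 0)" if "\<not> I \<subseteq> {..<n}"
    by (intro ext) (use f that in \<open>auto simp: model_carrier_iff mod_theta_def\<close>)
  show "mod_theta j f I x = 0" if "x \<notin> V" for x
    using f that by (auto simp: model_carrier_iff mod_theta_def)
qed

lemma mod_theta_par:
  assumes f: "f \<in> par (model_sheaf m n) V q"
  shows "mod_theta j f \<in> par (model_sheaf m n) V (1 + q)"
  unfolding model_par_iff
proof (intro conjI allI impI)
  show "mod_theta j f \<in> model_carrier m n V" using f by (simp add: model_par_iff mod_theta_closed)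
  fix I x assume "mod_theta j f I x \<noteq> 0"
  then have I: "j \<notin> I" "f (insert j I) x \<noteq> 0" by (auto simp: mod_theta_def split: if_splits)
  have "insert j I \<subseteq> {..<n}" using f I(2) unfolding model_par_iff model_carrier_iff by metis
  then have "finite I" using finite_subset by auto
  then have "of_nat (card (insert j I)) = (1 + of_nat (card I) :: bit)" using I(1) by simp
  moreover have "(of_nat (card (insert j I)) :: bit) = q" using f I(2) by (auto simp: model_par_iff)
  ultimately have "1 + of_nat (card I) = q" by simp
  then show "of_nat (card I) = 1 + q" by auto
qed

lemma mlift_closed:
  assumes h: "smooth_fun_on m V h" and J: "J \<subseteq> {..<n}"
  shows "mlift V J h \<in> model_carrier m n V"
  unfolding model_carrier_iff
proof (intro conjI allI impI)
  fix I
  show "smooth_fun_on m V (mlift V J h I)"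
  proof (cases "I = J")
    case True
    then show ?thesis by (intro smooth_cong[OF V h]) (simp add: mlift_def)
  next
    case False
    then show ?thesis by (intro smooth_cong[OF V smooth_const[OF V, of 0]]) (simp add: mlift_def)
  qed
  show "mlift V J h I = (\<lambda>_. 0)" if "\<not> I \<subseteq> {..<n}"
    by (intro ext) (use J that in \<open>auto simp: mlift_def\<close>)
qed (simp add: mlift_def)

lemma mlift_par: "smooth_fun_on m V h \<Longrightarrow> J \<subseteq> {..<n} \<Longrightarrow> mlift V J h \<in> par (model_sheaf m n) V (of_nat (card J))"
  by (auto simp: model_par_iff mlift_closed) (auto simp: mlift_def split: if_splits)

lemma mlift_mult:
  assumes f: "f \<in> model_carrier m n V"
  shows "mmult (mlift V {} h) f K x = (if x \<in> V then h x * f K x else 0)"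
proof (cases "finite K")
  case True
  have "mmult (mlift V {} h) f K x = (\<Sum>I\<in>Pow K. if I = {} then mlift V {} h {} x * f K x else 0)"
    unfolding mmult_def by (intro sum.cong refl) (auto simp: mlift_def)
  also have "\<dots> = mlift V {} h {} x * f K x" using True by (simp add: sum.delta)
  finally show ?thesis by (simp add: mlift_def)
next
  case False
  then have "\<not> K \<subseteq> {..<n}" using finite_subset by blast
  then show ?thesis using False f by (simp add: mmult_infinite model_carrier_iff)
qed

end

section \<open>Derivations over a cube that annihilate its coordinates, studied at the
  centre\<close>

context
  fixes m n :: nat and y :: "nat \<Rightarrow> real" and \<epsilon> :: real and d :: "model_section \<Rightarrow> model_section" and p :: bit
  assumes \<epsilon>: "\<epsilon> > 0" and y: "y \<in> topspace (Euclidean_space m)"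
    and d_closed: "\<And>f. f \<in> model_carrier m n (cube m y \<epsilon>) \<Longrightarrow>
       d f \<in> model_carrier m n (cube m y \<epsilon>)"
    and d_add: "\<And>f g. f \<in> model_carrier m n (cube m y \<epsilon>) \<Longrightarrow>
       g \<in> model_carrier m n (cube m y \<epsilon>) \<Longrightarrow>
       d (\<lambda>I x. f I x + g I x) = (\<lambda>I x. d f I x + d g I x)"
    and d_smult: "\<And>c f. f \<in> model_carrier m n (cube m y \<epsilon>) \<Longrightarrow>
       d (\<lambda>I x. c * f I x) = (\<lambda>I x. c * d f I x)"
    and d_Leibniz: "\<And>q f g. f \<in> par (model_sheaf m n) (cube m y \<epsilon>) q \<Longrightarrow>
       g \<in> model_carrier m n (cube m y \<epsilon>) \<Longrightarrow>
       d (mmult f g) = (\<lambda>K x. mmult (d f) g K x + psgn (p * q) * mmult f (d g) K x)"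
    and d_x: "\<And>i. i < m \<Longrightarrow> d (mlift (cube m y \<epsilon>) {} (\<lambda>x. x i)) = (\<lambda>I x. 0)"
    and d_theta: "\<And>j. j < n \<Longrightarrow> d (mlift (cube m y \<epsilon>) {j} (\<lambda>x. 1)) = (\<lambda>I x. 0)"
begin

text \<open>The Leibniz rule on 1 = 1 * 1 makes d(1) equal to its own double.\<close>

lemma d_one: "d (mlift (cube m y \<epsilon>) {} (\<lambda>x. 1)) = (\<lambda>I x. 0)"
proof -
  let ?o = "mlift (cube m y \<epsilon>) {} (\<lambda>x. 1)"
  have o: "?o \<in> model_carrier m n (cube m y \<epsilon>)" "?o \<in> par (model_sheaf m n) (cube m y \<epsilon>) 0"
    using mlift_closed[OF openin_cube smooth_const[OF openin_cube]] mlift_par[OF openin_cube smooth_const[OF openin_cube], of "{}"] by auto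
  have "mmult ?o ?o = ?o"
    by (intro ext) (simp add: mlift_mult[OF openin_cube o(1)], simp add: mlift_def)
  with d_Leibniz[OF o(2,1)] have *: "d ?o K x = mmult (d ?o) ?o K x + mmult ?o (d ?o) K x" for K x
    by (simp add: fun_eq_iff)
  have "mmult (d ?o) ?o K x = (if x \<in> cube m y \<epsilon> then d ?o K x else 0)" for K x
  proof (cases "finite K")
    case True
    have "mmult (d ?o) ?o K x = (\<Sum>I\<in>Pow K. if I = K then (if x \<in> cube m y \<epsilon> then d ?o K x else 0) else 0)"
      unfolding mmult_def by (intro sum.cong refl) (auto simp: mlift_def)
    also have "\<dots> = (if x \<in> cube m y \<epsilon> then d ?o K x else 0)" using True by (simp add: sum.delta)
    finally show ?thesis .
  next
    case False
    then have "\<not> K \<subseteq> {..<n}" using finite_subset by blast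
    then show ?thesis using False d_closed[OF o(1)] by (simp add: mmult_infinite model_carrier_iff)
  qed
  moreover have "mmult ?o (d ?o) K x = (if x \<in> cube m y \<epsilon> then d ?o K x else 0)" for K x
    using mlift_mult[OF openin_cube d_closed[OF o(1)]] by simp
  ultimately have "d ?o K x = (if x \<in> cube m y \<epsilon> then d ?o K x else 0) + (if x \<in> cube m y \<epsilon> then d ?o K x else 0)" for K x
    using * by simp
  then have "d ?o K x = 0" for K x by (smt (verit))
  then show ?thesis by auto
qed

lemma mmult_zero [simp]: "mmult (\<lambda>I x. 0) g = (\<lambda>I x. 0)" "mmult f (\<lambda>I x. 0) = (\<lambda>I x. 0)"
  by (auto simp: mmult_def)

lemma vanish_mult_left: "(\<And>I. f I y = 0) \<Longrightarrow> mmult f g K y = 0"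
  by (simp add: mmult_def)

text \<open>By Hadamard h is its frozen version plus z g with z = x_i - y_i. Since d(z) = 0, what
  remains of d(z g) is z d(g), all of whose coefficients vanish at y.\<close>

lemma d_mlift_step:
  assumes h: "smooth_fun_on m (cube m y \<epsilon>) h" and i: "i < m" and K: "d (mlift (cube m y \<epsilon>) {} (\<lambda>x. h (x(i := y i)))) K y = 0"
  shows "d (mlift (cube m y \<epsilon>) {} h) K y = 0"
proof -
  obtain g where g: "smooth_fun_on m (cube m y \<epsilon>) g" "\<And>x. x \<in> cube m y \<epsilon> \<Longrightarrow> h x = h (x(i := y i)) + (x i - y i) * g x"
    using Hadamard[OF \<epsilon> i h] by metis
  let ?x = "mlift (cube m y \<epsilon>) {} (\<lambda>x. x i)" and ?o = "mlift (cube m y \<epsilon>) {} (\<lambda>x. 1)" and ?g = "mlift (cube m y \<epsilon>) {} g"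
  let ?h' = "mlift (cube m y \<epsilon>) {} (\<lambda>x. h (x(i := y i)))"
  \<comment> \<open>Written as a combination of the coordinate and 1, so that linearity with
    \<open>d_x\<close> and \<open>d_one\<close> gives d(z) = 0. The identification with a lifted
    function follows in \<open>zl\<close>.\<close>
  define z where "z = (\<lambda>I x. ?x I x + (- y i) * ?o I x)"
  have gC: "?g \<in> model_carrier m n (cube m y \<epsilon>)" using mlift_closed[OF openin_cube g(1)] by auto
  have h'C: "?h' \<in> model_carrier m n (cube m y \<epsilon>)" using mlift_closed[OF openin_cube smooth_freeze[OF \<epsilon> i h]] by auto
  have xC: "?x \<in> model_carrier m n (cube m y \<epsilon>)" using mlift_closed[OF openin_cube smooth_coord[OF openin_cube]] by auto
  have oC: "?o \<in> model_carrier m n (cube m y \<epsilon>)" using mlift_closed[OF openin_cube smooth_const[OF openin_cube]] by auto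
  have zl: "z = mlift (cube m y \<epsilon>) {} (\<lambda>x. x i - y i)" by (auto simp: z_def mlift_def fun_eq_iff)
  have zsm: "smooth_fun_on m (cube m y \<epsilon>) (\<lambda>x. x i - y i)"
    using smooth_add[OF openin_cube smooth_coord[OF openin_cube, where j = i]
      smooth_const[OF openin_cube, where c = "- y i"]] by simp
  have zC: "z \<in> model_carrier m n (cube m y \<epsilon>)" and zp: "z \<in> par (model_sheaf m n) (cube m y \<epsilon>) 0"
    unfolding zl using mlift_closed[OF openin_cube zsm] mlift_par[OF openin_cube zsm, of "{}"] by auto
  have oC': "(\<lambda>I x. (- y i) * ?o I x) \<in> model_carrier m n (cube m y \<epsilon>)"
    by (rule model_smult_closed[OF openin_cube oC])
  have "d z = (\<lambda>I x. d ?x I x + d (\<lambda>I x. (- y i) * ?o I x) I x)"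
    unfolding z_def by (rule d_add[OF xC oC'])
  then have dz: "d z = (\<lambda>I x. 0)"
    using d_smult[OF oC, of "- y i"] d_x[OF i] d_one by auto
  have zg: "mmult z ?g = mlift (cube m y \<epsilon>) {} (\<lambda>x. (x i - y i) * g x)"
    unfolding zl by (intro ext) (simp add: mlift_mult[OF openin_cube gC], simp add: mlift_def)
  \<comment> \<open>Smoothness of the product is read off from Hadamard's identity, where it is the
    difference of h and its frozen version.\<close>
  have zgs: "smooth_fun_on m (cube m y \<epsilon>) (\<lambda>x. (x i - y i) * g x)"
  proof -
    have "smooth_fun_on m (cube m y \<epsilon>) (\<lambda>x. h x + (-1) * h (x(i := y i)))"
      using smooth_add[OF openin_cube h smooth_cmult[OF openin_cube smooth_freeze[OF \<epsilon> i h]]] .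
    then show ?thesis by (rule smooth_cong[OF openin_cube]) (use g in auto)
  qed
  have zgC: "mmult z ?g \<in> model_carrier m n (cube m y \<epsilon>)" unfolding zg using mlift_closed[OF openin_cube zgs] by auto
  have "mlift (cube m y \<epsilon>) {} h = (\<lambda>I x. ?h' I x + mmult z ?g I x)"
    unfolding zg using g(2) by (auto simp: mlift_def fun_eq_iff)
  then have "d (mlift (cube m y \<epsilon>) {} h) K y = d ?h' K y + d (mmult z ?g) K y"
    using d_add[OF h'C zgC] by simp
  also have "d (mmult z ?g) K y = mmult z (d ?g) K y"
    using d_Leibniz[OF zp gC] by (simp add: dz)
  also have "\<dots> = 0"
    by (rule vanish_mult_left) (simp add: zl mlift_def)
  finally show ?thesis by (simp only: K add_0_right)
qed

text \<open>Let \<open>hh k\<close> be h with its first k coordinates frozen at the centre. The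
  claim holds for \<open>hh m\<close>, a constant, and \<open>d_mlift_step\<close> carries it down
  to \<open>hh 0\<close>, which is h.\<close>

lemma d_mlift:
  assumes h: "smooth_fun_on m (cube m y \<epsilon>) h"
  shows "d (mlift (cube m y \<epsilon>) {} h) K y = 0"
proof -
  define hh where "hh k = (\<lambda>x. h (\<lambda>j. if j < k then y j else x j))" for k
  have hh_Suc: "hh (Suc k) = (\<lambda>x. hh k (x(k := y k)))" for k
  proof
    fix x
    have "(\<lambda>j. if j < Suc k then y j else x j) = (\<lambda>j. if j < k then y j else (x(k := y k)) j)"
      by (auto simp: less_Suc_eq)
    then show "hh (Suc k) x = hh k (x(k := y k))" by (simp add: hh_def)
  qed
  have sm: "smooth_fun_on m (cube m y \<epsilon>) (hh k)" if "k \<le> m" for k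
    using that
  proof (induction k)
    case 0
    then show ?case using h by (simp add: hh_def)
  next
    case (Suc k)
    then show ?case unfolding hh_Suc by (intro smooth_freeze[OF \<epsilon>]) auto
  qed
  have "d (mlift (cube m y \<epsilon>) {} (hh k)) K y = 0" if "k \<le> m" for k
    using that
  proof (induction k rule: inc_induct)
    \<comment> \<open>Points of the cube agree with y from index m on, so freezing m coordinates
      leaves the constant h(y).\<close>
    case base
    have "mlift (cube m y \<epsilon>) {} (hh m) = (\<lambda>I x. h y * mlift (cube m y \<epsilon>) {} (\<lambda>x. 1) I x)"
    proof (intro ext)
      fix I and x :: "nat \<Rightarrow> real"
      have "hh m x = h y" if "x \<in> cube m y \<epsilon>"
      proof -
        have "(\<lambda>j. if j < m then y j else x j) = y"
          using that y by (auto simp: cube_def topspace_Euclidean_space)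
        then show ?thesis by (simp add: hh_def)
      qed
      then show "mlift (cube m y \<epsilon>) {} (hh m) I x = h y * mlift (cube m y \<epsilon>) {} (\<lambda>x. 1) I x" by (auto simp: mlift_def)
    qed
    moreover have "mlift (cube m y \<epsilon>) {} (\<lambda>x. 1) \<in> model_carrier m n (cube m y \<epsilon>)" using mlift_closed[OF openin_cube smooth_const[OF openin_cube]] by auto
    ultimately show ?case using d_smult d_one by simp
  next
    case (step k)
    show ?case
    proof (rule d_mlift_step)
      show "smooth_fun_on m (cube m y \<epsilon>) (hh k)" using step by (intro sm) simp
      show "k < m" using step by simp
      show "d (mlift (cube m y \<epsilon>) {} (\<lambda>x. hh k (x(k := y k)))) K y = 0" using step.IH unfolding hh_Suc .
    qed
  qed
  from this[of 0] show ?thesis by (simp add: hh_def)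
qed

text \<open>The largest index is appended on the right, so \<theta>_J \<theta>_j is \<theta>_{J+j}
  with sign +1 and the Leibniz rule applies directly.\<close>

lemma d_theta_prod:
  assumes "finite J" "J \<subseteq> {..<n}"
  shows "d (mlift (cube m y \<epsilon>) J (\<lambda>x. 1)) = (\<lambda>I x. 0)"
  using assms
proof (induction J rule: finite_linorder_max_induct)
  case empty
  then show ?case by (rule_tac d_one)
next
  case (insert j J)
  have J: "J \<subseteq> {..<n}" "j < n" "j \<notin> J" using insert by auto
  have "mmult (mlift (cube m y \<epsilon>) J (\<lambda>x. 1)) (mlift (cube m y \<epsilon>) {j} (\<lambda>x. 1)) = mlift (cube m y \<epsilon>) (insert j J) (\<lambda>x. 1)"
  proof (intro ext)
    fix K x
    show "mmult (mlift (cube m y \<epsilon>) J (\<lambda>x. 1)) (mlift (cube m y \<epsilon>) {j} (\<lambda>x. 1)) K x = mlift (cube m y \<epsilon>) (insert j J) (\<lambda>x. 1) K x"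
    proof (cases "finite K")
      case True
      have s: "ext_sign J {j} = 1"
      proof -
        have "{(i, k). i \<in> J \<and> k \<in> {j} \<and> k < i} = {}" using insert.hyps(2) by (auto dest: less_asym)
        then show ?thesis by (simp only: ext_sign_def card.empty power_0)
      qed
      have "mmult (mlift (cube m y \<epsilon>) J (\<lambda>x. 1)) (mlift (cube m y \<epsilon>) {j} (\<lambda>x. 1)) K x =
         (\<Sum>L\<in>Pow K. if L = J then (if K = insert j J \<and> x \<in> cube m y \<epsilon> then 1 else 0) else 0)"
        unfolding mmult_def
      proof (intro sum.cong refl)
        fix L assume L: "L \<in> Pow K"
        have "K - J = {j} \<longleftrightarrow> K = insert j J" if "J \<subseteq> K" using that J(3) by auto
        then show "ext_sign L (K - L) * mlift (cube m y \<epsilon>) J (\<lambda>x. 1) L x * mlift (cube m y \<epsilon>) {j} (\<lambda>x. 1) (K - L) x =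
          (if L = J then (if K = insert j J \<and> x \<in> cube m y \<epsilon> then 1 else 0) else 0)"
          using L s by (auto simp: mlift_def)
      qed
      also have "\<dots> = (if J \<in> Pow K then (if K = insert j J \<and> x \<in> cube m y \<epsilon> then 1 else 0) else 0)"
        using True by (subst sum.delta) auto
      also have "\<dots> = mlift (cube m y \<epsilon>) (insert j J) (\<lambda>x. 1) K x" by (auto simp: mlift_def)
      finally show ?thesis .
    next
      case False
      then have "K \<noteq> insert j J" using insert by auto
      then show ?thesis using False by (simp add: mmult_infinite) (simp add: mlift_def)
    qed
  qed
  moreover have "mlift (cube m y \<epsilon>) J (\<lambda>x. 1) \<in> par (model_sheaf m n) (cube m y \<epsilon>) (of_nat (card J))"
    using mlift_par[OF openin_cube smooth_const[OF openin_cube] J(1)] .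
  moreover have "mlift (cube m y \<epsilon>) {j} (\<lambda>x. 1) \<in> model_carrier m n (cube m y \<epsilon>)" using mlift_closed[OF openin_cube smooth_const[OF openin_cube], of "{j}"] J by auto
  ultimately show ?case using d_Leibniz d_theta[OF J(2)] insert.IH[OF J(1)] by force
qed

text \<open>Expand f as the sum of f_J \<theta>_J. Since d kills \<theta>_J, each term contributes
  d(f_J) \<theta>_J, which vanishes at y with d(f_J).\<close>

theorem derivation_vanishes:
  assumes f: "f \<in> model_carrier m n (cube m y \<epsilon>)"
  shows "d f K y = 0"
proof -
  have comp: "d (mlift (cube m y \<epsilon>) J (f J)) K y = 0" and compC: "mlift (cube m y \<epsilon>) J (f J) \<in> model_carrier m n (cube m y \<epsilon>)" if J: "J \<subseteq> {..<n}" for J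
  proof -
    have fin: "finite J" using J finite_subset by auto
    have s: "smooth_fun_on m (cube m y \<epsilon>) (f J)" using model_smooth[OF openin_cube f] .
    have t: "mlift (cube m y \<epsilon>) J (\<lambda>x. 1) \<in> model_carrier m n (cube m y \<epsilon>)" using mlift_closed[OF openin_cube smooth_const[OF openin_cube] J] .
    have l: "mlift (cube m y \<epsilon>) {} (f J) \<in> par (model_sheaf m n) (cube m y \<epsilon>) 0"
      using mlift_par[OF openin_cube s, of "{}"] by auto
    show "mlift (cube m y \<epsilon>) J (f J) \<in> model_carrier m n (cube m y \<epsilon>)" using mlift_closed[OF openin_cube s J] .
    have "mlift (cube m y \<epsilon>) J (f J) = mmult (mlift (cube m y \<epsilon>) {} (f J)) (mlift (cube m y \<epsilon>) J (\<lambda>x. 1))"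
      by (intro ext) (simp add: mlift_mult[OF openin_cube t], simp add: mlift_def)
    then have "d (mlift (cube m y \<epsilon>) J (f J)) K y = mmult (d (mlift (cube m y \<epsilon>) {} (f J))) (mlift (cube m y \<epsilon>) J (\<lambda>x. 1)) K y"
      using d_Leibniz[OF l t] d_theta_prod[OF fin J] by simp
    also have "\<dots> = 0" by (rule vanish_mult_left) (rule d_mlift[OF s])
    finally show "d (mlift (cube m y \<epsilon>) J (f J)) K y = 0" .
  qed
  \<comment> \<open>Additivity of d is binary, so the expansion is built up one index set at a time.
    The empty sum uses that d(0) is 0 times d(0).\<close>
  have "(\<lambda>I x. if I \<in> S then f I x else 0) \<in> model_carrier m n (cube m y \<epsilon>) \<and> d (\<lambda>I x. if I \<in> S then f I x else 0) K y = 0"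
    if "finite S" "S \<subseteq> Pow {..<n}" for S
    using that
  proof (induction S rule: finite_induct)
    case empty
    have z: "(\<lambda>I x. 0) \<in> model_carrier m n (cube m y \<epsilon>)" using smooth_const[OF openin_cube] by (simp add: model_carrier_iff)
    have "d (\<lambda>I x. 0 * (0 :: real)) = (\<lambda>I x. 0 * d (\<lambda>I x. 0) I x)" using d_smult[OF z, of 0] by simp
    then show ?case using z by simp
  next
    case (insert J S)
    have S: "(\<lambda>I x. if I \<in> S then f I x else 0) \<in> model_carrier m n (cube m y \<epsilon>)" "d (\<lambda>I x. if I \<in> S then f I x else 0) K y = 0" and J: "J \<subseteq> {..<n}"
      using insert by auto
    have eq: "(\<lambda>I x. if I \<in> insert J S then f I x else 0) =
       (\<lambda>I x. mlift (cube m y \<epsilon>) J (f J) I x + (if I \<in> S then f I x else 0))"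
      using insert f by (auto simp: mlift_def fun_eq_iff model_carrier_iff)
    have "(\<lambda>I x. if I \<in> insert J S then f I x else 0) \<in> model_carrier m n (cube m y \<epsilon>)"
    proof -
      have "smooth_fun_on m (cube m y \<epsilon>) (\<lambda>x. if I \<in> insert J S then f I x else 0)" for I
        using model_smooth[OF openin_cube f] smooth_const[OF openin_cube] by (cases "I \<in> insert J S") auto
      moreover have "(\<lambda>x. if I \<in> insert J S then f I x else 0) = (\<lambda>_. 0)" if "\<not> I \<subseteq> {..<n}" for I
        by (intro ext) (use f that in \<open>auto simp: model_carrier_iff\<close>)
      ultimately show ?thesis using f by (simp add: model_carrier_iff)
    qed
    moreover have "d (\<lambda>I x. if I \<in> insert J S then f I x else 0) K y = 0"
      unfolding eq d_add[OF compC[OF J] S(1)] using comp[OF J] S(2) by simp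
    ultimately show ?case by blast
  qed
  from this[of "Pow {..<n}"] have "d (\<lambda>I x. if I \<in> Pow {..<n} then f I x else 0) K y = 0" by simp
  moreover have "(\<lambda>I x. if I \<in> Pow {..<n} then f I x else 0) = f"
    using f by (auto simp: fun_eq_iff model_carrier_iff)
  ultimately show ?thesis by simp
qed

end

section \<open>Coordinate frames\<close>

text \<open>What has to be checked on the model for a chart to transport \<delta> to a homogeneous
  vector field on M. The last clause is compatibility with restriction.\<close>

definition model_der :: "nat \<Rightarrow> nat \<Rightarrow> bit \<Rightarrow> ((nat \<Rightarrow> real) set \<Rightarrow> model_section \<Rightarrow> model_section) \<Rightarrow> bool"
  where "model_der m n p \<delta> \<longleftrightarrow> (\<forall>V. openin (Euclidean_space m) V \<longrightarrow>
    (\<forall>f\<in>model_carrier m n V. \<delta> V f \<in> model_carrier m n V) \<and>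
    (\<forall>f\<in>model_carrier m n V. \<forall>g\<in>model_carrier m n V.
       \<delta> V (\<lambda>I x. f I x + g I x) = (\<lambda>I x. \<delta> V f I x + \<delta> V g I x)) \<and>
    (\<forall>f\<in>model_carrier m n V. \<forall>c. \<delta> V (\<lambda>I x. c * f I x) = (\<lambda>I x. c * \<delta> V f I x)) \<and>
    (\<forall>q. \<forall>f\<in>par (model_sheaf m n) V q. \<delta> V f \<in> par (model_sheaf m n) V (p + q)) \<and>
    (\<forall>q. \<forall>f\<in>par (model_sheaf m n) V q. \<forall>g\<in>model_carrier m n V.
       \<delta> V (mmult f g) = (\<lambda>K x. mmult (\<delta> V f) g K x + psgn (p * q) * mmult f (\<delta> V g) K x)) \<and>
    (\<forall>f\<in>model_carrier m n V. \<forall>W. openin (Euclidean_space m) W \<and> W \<subseteq> V \<longrightarrow>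
       (\<lambda>I x. if x \<in> W then \<delta> V f I x else 0) = \<delta> W (\<lambda>I x. if x \<in> W then f I x else 0)))"

lemma model_der_mod_d: "i < m \<Longrightarrow> model_der m n 0 (mod_d i)"
  unfolding model_der_def
  by (auto simp: mod_d_closed mod_d_add mod_d_smult mod_d_par mod_d_res)
    (auto simp: fun_eq_iff model_par_iff mod_d_Leibniz)

lemma model_der_mod_theta: "model_der m n 1 (\<lambda>V. mod_theta j)"
  unfolding model_der_def
proof (intro allI impI conjI ballI)
  fix V q f g assume "openin (Euclidean_space m) V"
    and f: "f \<in> par (model_sheaf m n) V q" and g: "g \<in> model_carrier m n V"
  show "mod_theta j (mmult f g) = (\<lambda>K x. mmult (mod_theta j f) g K x + psgn (1 * q) * mmult f (mod_theta j g) K x)"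
    by (intro ext, subst mod_theta_Leibniz[of f q]) (use f in \<open>auto simp: model_par_iff\<close>)
qed (auto simp: mod_theta_closed mod_theta_par, auto simp: mod_theta_def fun_eq_iff algebra_simps)

text \<open>Indices below m number the even coordinates, and m + j stands for \<theta>_j.
  \<open>mfield\<close> and \<open>cparity\<close> follow the same numbering.\<close>

definition mcoord :: "nat \<Rightarrow> nat \<Rightarrow> (nat \<Rightarrow> real) set \<Rightarrow> model_section"
  where "mcoord m a V = (if a < m then mlift V {} (\<lambda>x. x a) else mlift V {a - m} (\<lambda>x. 1))"

definition mfield :: "nat \<Rightarrow> nat \<Rightarrow> (nat \<Rightarrow> real) set \<Rightarrow> model_section \<Rightarrow> model_section"
  where "mfield m a = (if a < m then mod_d a else (\<lambda>V. mod_theta (a - m)))"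

definition cparity :: "nat \<Rightarrow> nat \<Rightarrow> bit"
  where "cparity m a = (if a < m then 0 else 1)"

lemma model_der_mfield: "model_der m n (cparity m a) (mfield m a)"
  by (simp add: mfield_def cparity_def model_der_mod_d model_der_mod_theta)

lemma mcoord_par:
  assumes V: "openin (Euclidean_space m) V" and a: "a < m + n"
  shows "mcoord m a V \<in> par (model_sheaf m n) V (cparity m a)"
proof (cases "a < m")
  case True
  then show ?thesis using mlift_par[OF V smooth_coord[OF V], of "{}" n a] by (simp add: mcoord_def cparity_def)
next
  case False
  then show ?thesis using mlift_par[OF V smooth_const[OF V], of "{a - m}" n 1] a by (simp add: mcoord_def cparity_def)
qed

text \<open>This duality is what allows the coefficients of a combination of coordinate fields to be
  read off by evaluating it on coordinates.\<close>

lemma mfield_mcoord: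
  assumes V: "openin (Euclidean_space m) V"
  shows "mfield m a V (mcoord m b V) = (if a = b then mlift V {} (\<lambda>x. 1) else (\<lambda>I x. 0))"
proof (cases "a < m")
  case a: True
  have "mod_d a V (mlift V {} (\<lambda>x. x b)) I x = (if a = b then mlift V {} (\<lambda>x. 1) else (\<lambda>I x. 0)) I x" for I x
  proof (cases "x \<in> V \<and> I = {}")
    case True
    then have x: "x \<in> V" and I: "I = {}" by auto
    have "has_partial a (\<lambda>x. x b) x (if a = b then 1 else 0)"
      by (cases "a = b") (auto simp: has_partial_def intro!: derivative_eq_intros)
    then have "has_partial a (mlift V {} (\<lambda>x. x b) {}) x (if a = b then 1 else 0)"
      by (subst has_partial_cong[OF V _ x a, of _ "\<lambda>x. x b"]) (simp_all add: mlift_def)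
    then have "mod_d a V (mlift V {} (\<lambda>x. x b)) {} x = (if a = b then 1 else 0)"
      by (rule mod_d_eqI[OF V x])
    then show ?thesis using x I by (simp add: mlift_def[of _ _ "\<lambda>x. 1"])
  next
    case False
    then show ?thesis by (auto simp: mod_d_def mlift_def partial_def)
  qed
  moreover have "mod_d a V (mlift V {b - m} (\<lambda>x. 1)) I x = 0" for I x
  proof (cases "x \<in> V")
    case x: True
    have "has_partial a (\<lambda>x. if I = {b - m} then 1 else 0) x 0" by (simp add: has_partial_def)
    then have "has_partial a (mlift V {b - m} (\<lambda>x. 1) I) x 0"
      by (subst has_partial_cong[OF V _ x a, of _ "\<lambda>x. if I = {b - m} then 1 else 0"]) (simp_all add: mlift_def)
    then show ?thesis by (rule mod_d_eqI[OF V x])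
  qed (simp add: mod_d_def)
  ultimately show ?thesis using a by (auto simp: mfield_def mcoord_def fun_eq_iff)
next
  case a: False
  have "mod_theta (a - m) (mlift V {} h) = (\<lambda>I x. 0)" for h
    by (auto simp: mod_theta_def mlift_def fun_eq_iff)
  moreover have "mod_theta (a - m) (mlift V {b - m} (\<lambda>x. 1)) = (if a - m = b - m then mlift V {} (\<lambda>x. 1) else (\<lambda>I x. 0))"
  proof (intro ext)
    fix I x
    show "mod_theta (a - m) (mlift V {b - m} (\<lambda>x. 1)) I x = (if a - m = b - m then mlift V {} (\<lambda>x. 1) else (\<lambda>I x. 0)) I x"
      by (cases "I = {}") (auto simp: mod_theta_def mlift_def)
  qed
  ultimately show ?thesis using a by (auto simp: mfield_def mcoord_def)
qed

lemma mcoord_res: "W \<subseteq> V \<Longrightarrow> (\<lambda>I x. if x \<in> W then mcoord m a V I x else 0) = mcoord m a W"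
  by (auto simp: mcoord_def mlift_def fun_eq_iff)

section \<open>Transport between a chart domain and the model\<close>

locale supermanifold_chart = superalg_sheaf M A
  for M :: "'x topology" and A :: "('x, 'a) superalgebra_sheaf" +
  fixes m n :: nat and U :: "'x set" and V :: "(nat \<Rightarrow> real) set"
    and \<phi> :: "'x \<Rightarrow> nat \<Rightarrow> real" and \<psi> :: "'x set \<Rightarrow> 'a \<Rightarrow> model_section"
  assumes U: "openin M U" and V: "openin (Euclidean_space m) V"
    and homeo: "homeomorphic_map (subtopology M U) (subtopology (Euclidean_space m) V) \<phi>"
    and psi: "\<And>W. W \<in> opens M U \<Longrightarrow> superalgebra_hom (sec A W) (par A W)
            (sec (model_sheaf m n) (\<phi> ` W)) (par (model_sheaf m n) (\<phi> ` W)) (\<psi> W)"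
    and psi_bij: "\<And>W. W \<in> opens M U \<Longrightarrow> bij_betw (\<psi> W) (C W) (carrier (sec (model_sheaf m n) (\<phi> ` W)))"
    and psi_res: "\<And>W W' s. W \<in> opens M U \<Longrightarrow> W' \<in> opens M W \<Longrightarrow> s \<in> C W \<Longrightarrow>
             \<psi> W' (res A W W' s) = res (model_sheaf m n) (\<phi> ` W) (\<phi> ` W') (\<psi> W s)"
begin

lemma image_open:
  assumes W: "W \<in> opens M U"
  shows "openin (Euclidean_space m) (\<phi> ` W)" "\<phi> ` W \<subseteq> V"
proof -
  from W have "openin (subtopology M U) W" using U by (simp add: opens_def openin_open_subtopology)
  then have "openin (subtopology (Euclidean_space m) V) (\<phi> ` W)"
    using homeomorphic_imp_open_map[OF homeo] by (simp add: open_map_def)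
  then show "openin (Euclidean_space m) (\<phi> ` W)" "\<phi> ` W \<subseteq> V"
    by (simp_all add: openin_open_subtopology[OF V])
qed

text \<open>Lets a small cube in the model be traded for an open subset of M.\<close>

lemma preimage_open:
  assumes W: "W \<in> opens M U" and Y: "openin (Euclidean_space m) Y" "Y \<subseteq> \<phi> ` W"
  obtains W' where "W' \<in> opens M W" "\<phi> ` W' = Y"
proof
  have "openin (subtopology (Euclidean_space m) V) Y"
    using Y image_open(2)[OF W] by (simp add: openin_open_subtopology[OF V])
  then have "openin (subtopology M U) {x \<in> topspace (subtopology M U). \<phi> x \<in> Y}"
    using homeomorphic_imp_continuous_map[OF homeo] openin_continuous_map_preimage by blast
  moreover have "topspace (subtopology M U) = U"
    using openin_subset[OF U] by (simp add: Int_absorb1)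
  ultimately have "openin (subtopology M U) {x \<in> U. \<phi> x \<in> Y}" by (simp only:)
  then have "openin M {x \<in> U. \<phi> x \<in> Y}" by (simp add: openin_open_subtopology[OF U])
  then have "openin M ({x \<in> U. \<phi> x \<in> Y} \<inter> W)"
    using W by (auto simp: opens_def)
  then show "{x \<in> U. \<phi> x \<in> Y} \<inter> W \<in> opens M W" by (simp add: opens_def)
  show "\<phi> ` ({x \<in> U. \<phi> x \<in> Y} \<inter> W) = Y" using Y W by (auto simp: opens_def)
qed

context
  fixes W assumes W: "W \<in> opens M U"
begin

lemma psi_closed: "s \<in> C W \<Longrightarrow> \<psi> W s \<in> model_carrier m n (\<phi> ` W)"
  using psi_bij[OF W] by (auto simp: bij_betw_def model_simps)

lemma psi_inj: "s \<in> C W \<Longrightarrow> t \<in> C W \<Longrightarrow> \<psi> W s = \<psi> W t \<Longrightarrow> s = t"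
  using psi_bij[OF W] by (auto simp: bij_betw_def inj_on_def)

lemma psi_add: "s \<in> C W \<Longrightarrow> t \<in> C W \<Longrightarrow> \<psi> W (s \<oplus>\<^bsub>sec A W\<^esub> t) = (\<lambda>I x. \<psi> W s I x + \<psi> W t I x)"
  using psi[OF W] by (auto simp: superalgebra_hom_def ring_hom_def model_simps)

lemma psi_mult: "s \<in> C W \<Longrightarrow> t \<in> C W \<Longrightarrow> \<psi> W (s \<otimes>\<^bsub>sec A W\<^esub> t) = mmult (\<psi> W s) (\<psi> W t)"
  using psi[OF W] by (auto simp: superalgebra_hom_def ring_hom_def model_simps)

lemma psi_one: "\<psi> W \<one>\<^bsub>sec A W\<^esub> = mlift (\<phi> ` W) {} (\<lambda>x. 1)"
  using psi[OF W] by (auto simp: superalgebra_hom_def ring_hom_def model_simps)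

lemma psi_smult: "s \<in> C W \<Longrightarrow> \<psi> W (c \<odot>\<^bsub>sec A W\<^esub> s) = (\<lambda>I x. c * \<psi> W s I x)"
  using psi[OF W] by (auto simp: superalgebra_hom_def real_linear_def model_simps)

lemma psi_par: "s \<in> par A W p \<Longrightarrow> \<psi> W s \<in> par (model_sheaf m n) (\<phi> ` W) p"
  using psi[OF W] by (auto simp: superalgebra_hom_def)

lemma psi_zero: "\<psi> W \<zero>\<^bsub>sec A W\<^esub> = (\<lambda>I x. 0)"
proof -
  interpret W: superalg "sec A W" "par A W" using superalg W .
  show ?thesis using psi_smult[of "\<zero>\<^bsub>sec A W\<^esub>" 0] by simp
qed

definition psi_inv :: "model_section \<Rightarrow> 'a"
  where "psi_inv = inv_into (C W) (\<psi> W)"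

lemma psi_inv_closed: "f \<in> model_carrier m n (\<phi> ` W) \<Longrightarrow> psi_inv f \<in> C W"
  using psi_bij[OF W] by (auto simp: psi_inv_def bij_betw_def model_simps intro!: inv_into_into)

lemma psi_psi_inv [simp]: "f \<in> model_carrier m n (\<phi> ` W) \<Longrightarrow> \<psi> W (psi_inv f) = f"
  using psi_bij[OF W] by (auto simp: psi_inv_def bij_betw_def model_simps intro!: f_inv_into_f)

lemma psi_inv_psi [simp]: "s \<in> C W \<Longrightarrow> psi_inv (\<psi> W s) = s"
  using psi_bij[OF W] by (auto simp: psi_inv_def bij_betw_def)

text \<open>\<open>superalgebra_hom\<close> demands only that parity be preserved. Conversely, the
  component z of s of the wrong parity has an image whose coefficients are all forced to be 0, and
  \<open>\<psi> W\<close> is injective.\<close>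

lemma psi_par_reflect:
  assumes s: "s \<in> C W" and f: "\<psi> W s \<in> par (model_sheaf m n) (\<phi> ` W) p"
  shows "s \<in> par A W p"
proof -
  interpret W: superalg "sec A W" "par A W" using superalg W .
  obtain y z where yz: "y \<in> par A W p" "z \<in> par A W (p + 1)" "s = y \<oplus>\<^bsub>sec A W\<^esub> z"
    using W.par_decompose[OF s] .
  then have C: "y \<in> C W" "z \<in> C W" using W.par_closed by auto
  have "\<psi> W z I x = 0" for I x
  proof (rule ccontr)
    assume nz: "\<psi> W z I x \<noteq> 0"
    have "of_nat (card I) = p + 1"
      using psi_par[OF yz(2)] nz by (auto simp: model_par_iff)
    then have "of_nat (card I) \<noteq> p" by (cases p) auto
    then have "\<psi> W s I x = 0" "\<psi> W y I x = 0"
      using f psi_par[OF yz(1)] unfolding model_par_iff by blast+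
    moreover have "\<psi> W s I x = \<psi> W y I x + \<psi> W z I x" using psi_add[OF C] yz(3) by simp
    ultimately show False using nz by simp
  qed
  then have "\<psi> W z = \<psi> W \<zero>\<^bsub>sec A W\<^esub>" by (auto simp: psi_zero)
  then have "z = \<zero>\<^bsub>sec A W\<^esub>" using C by (auto intro: psi_inj)
  then show ?thesis using yz C by simp
qed

end

definition chart_field :: "((nat \<Rightarrow> real) set \<Rightarrow> model_section \<Rightarrow> model_section) \<Rightarrow> ('x, 'a) vfield"
  where "chart_field \<delta> = field_of U (\<lambda>W s. psi_inv W (\<delta> (\<phi> ` W) (\<psi> W s)))"

lemma psi_chart_field:
  assumes d: "model_der m n p \<delta>" and W: "W \<in> opens M U" and s: "s \<in> C W"
  shows "\<psi> W (chart_field \<delta> W s) = \<delta> (\<phi> ` W) (\<psi> W s)"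
proof -
  have "\<delta> (\<phi> ` W) (\<psi> W s) \<in> model_carrier m n (\<phi> ` W)"
    using d image_open(1)[OF W] psi_closed[OF W s] by (simp add: model_der_def)
  then show ?thesis using W s by (simp add: chart_field_def)
qed

text \<open>Every identity is checked after applying the injective \<open>\<psi> W\<close>, where it
  becomes a clause of \<open>model_der\<close>.\<close>

lemma chart_field_hder:
  assumes d: "model_der m n p \<delta>"
  shows "chart_field \<delta> \<in> hder M A U p"
proof (rule hderI)
  note pc = psi_chart_field[OF d]
  have cl: "chart_field \<delta> W s \<in> C W" if W: "W \<in> opens M U" and s: "s \<in> C W" for W s
  proof -
    have "\<delta> (\<phi> ` W) (\<psi> W s) \<in> model_carrier m n (\<phi> ` W)"
      using d image_open(1)[OF W] psi_closed[OF W s] by (simp add: model_der_def)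
    then show ?thesis using W s by (simp add: chart_field_def psi_inv_closed)
  qed
  have "field_of U (chart_field \<delta>) \<in> lin_field U"
  proof (rule field_of_lin_field)
    fix W s assume W: "W \<in> opens M U" and s: "s \<in> C W"
    interpret W: superalg "sec A W" "par A W" using superalg W .
    have o: "openin (Euclidean_space m) (\<phi> ` W)" using image_open(1)[OF W] .
    show "chart_field \<delta> W s \<in> C W" using cl[OF W s] .
    show "chart_field \<delta> W (s \<oplus>\<^bsub>sec A W\<^esub> t) = chart_field \<delta> W s \<oplus>\<^bsub>sec A W\<^esub> chart_field \<delta> W t" if t: "t \<in> C W" for t
      by (rule psi_inj[OF W])
        (use d o W s t cl psi_closed[OF W] in \<open>simp_all add: pc psi_add model_der_def\<close>)
    show "chart_field \<delta> W (c \<odot>\<^bsub>sec A W\<^esub> s) = c \<odot>\<^bsub>sec A W\<^esub> chart_field \<delta> W s" for c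
      by (rule psi_inj[OF W])
        (use d o W s cl psi_closed[OF W] in \<open>simp_all add: pc psi_smult model_der_def\<close>)
    show "res A W W' (chart_field \<delta> W s) = chart_field \<delta> W' (res A W W' s)"
      if W': "W' \<in> opens M W" "W' \<in> opens M U" for W'
    proof (rule psi_inj[OF W'(2)])
      have Wo: "openin M W" using W opens_open by auto
      show "res A W W' (chart_field \<delta> W s) \<in> C W'" "chart_field \<delta> W' (res A W W' s) \<in> C W'"
        using cl W' W s res_closed[OF Wo W'(1)] by auto
      have sub: "\<phi> ` W' \<subseteq> \<phi> ` W" using W' by (auto simp: opens_def)
      have f: "\<psi> W s \<in> model_carrier m n (\<phi> ` W)" using psi_closed[OF W s] .
      have "\<psi> W' (res A W W' (chart_field \<delta> W s)) = (\<lambda>I x. if x \<in> \<phi> ` W' then \<delta> (\<phi> ` W) (\<psi> W s) I x else 0)"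
        using psi_res[OF W W'(1) cl[OF W s]] pc[OF W s] by (simp add: model_simps)
      also have "\<dots> = \<delta> (\<phi> ` W') (\<lambda>I x. if x \<in> \<phi> ` W' then \<psi> W s I x else 0)"
        using d o f sub image_open(1)[OF W'(2)] unfolding model_der_def by blast
      also have "\<dots> = \<delta> (\<phi> ` W') (\<psi> W' (res A W W' s))"
        using psi_res[OF W W'(1) s] by (simp add: model_simps)
      also have "\<dots> = \<psi> W' (chart_field \<delta> W' (res A W W' s))"
        using pc[OF W'(2) res_closed[OF Wo W'(1) s]] by simp
      finally show "\<psi> W' (res A W W' (chart_field \<delta> W s)) = \<psi> W' (chart_field \<delta> W' (res A W W' s))" .
    qed
  qed
  moreover have "field_of U (chart_field \<delta>) = chart_field \<delta>"
    by (auto simp: chart_field_def field_of_def fun_eq_iff restrict_def)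
  ultimately show "chart_field \<delta> \<in> lin_field U" by simp
  fix W q s assume W: "W \<in> opens M U" and s: "s \<in> par A W q"
  interpret W: superalg "sec A W" "par A W" using superalg W .
  have o: "openin (Euclidean_space m) (\<phi> ` W)" using image_open(1)[OF W] .
  have sC: "s \<in> C W" using s W.par_closed by simp
  show "chart_field \<delta> W s \<in> par A W (p + q)"
    using d o psi_par[OF W s] cl[OF W sC] by (intro psi_par_reflect[OF W]) (simp_all add: pc[OF W sC] model_der_def)
  fix t assume t: "t \<in> C W"
  show "chart_field \<delta> W (s \<otimes>\<^bsub>sec A W\<^esub> t) = chart_field \<delta> W s \<otimes>\<^bsub>sec A W\<^esub> t \<oplus>\<^bsub>sec A W\<^esub>
      psgn (p * q) \<odot>\<^bsub>sec A W\<^esub> (s \<otimes>\<^bsub>sec A W\<^esub> chart_field \<delta> W t)"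
    by (rule psi_inj[OF W])
      (use d o W sC t cl psi_closed[OF W] psi_par[OF W s] in
        \<open>simp_all add: pc psi_add psi_mult psi_smult model_der_def\<close>)
qed

definition frame :: "nat \<Rightarrow> ('x, 'a) vfield"
  where "frame a = chart_field (mfield m a)"

definition coordinate :: "'x set \<Rightarrow> nat \<Rightarrow> 'a"
  where "coordinate W a = psi_inv W (mcoord m a (\<phi> ` W))"

lemma frame_hder: "frame a \<in> hder M A U (cparity m a)"
  unfolding frame_def by (rule chart_field_hder[OF model_der_mfield])

lemma coordinate_closed:
  assumes "W \<in> opens M U" "a < m + n"
  shows "coordinate W a \<in> C W" "\<psi> W (coordinate W a) = mcoord m a (\<phi> ` W)"
proof -
  have "mcoord m a (\<phi> ` W) \<in> model_carrier m n (\<phi> ` W)"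
    using mcoord_par[OF image_open(1)[OF assms(1)] assms(2)] by (simp add: model_par_iff)
  then show "coordinate W a \<in> C W" "\<psi> W (coordinate W a) = mcoord m a (\<phi> ` W)"
    using assms by (simp_all add: coordinate_def psi_inv_closed)
qed

lemma coordinate_par: "W \<in> opens M U \<Longrightarrow> a < m + n \<Longrightarrow> coordinate W a \<in> par A W (cparity m a)"
  using coordinate_closed mcoord_par[OF image_open(1)] by (intro psi_par_reflect) auto

lemma coordinate_res:
  assumes W: "W \<in> opens M U" and W': "W' \<in> opens M W" and a: "a < m + n"
  shows "res A W W' (coordinate W a) = coordinate W' a"
proof -
  have W'U: "W' \<in> opens M U" using opens_trans[OF W W'] .
  have "\<phi> ` W' \<subseteq> \<phi> ` W" using W' by (auto simp: opens_def)
  then have "\<psi> W' (res A W W' (coordinate W a)) = mcoord m a (\<phi> ` W')"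
    using psi_res[OF W W' coordinate_closed(1)[OF W a]] coordinate_closed(2)[OF W a]
    by (simp add: model_simps mcoord_res)
  then show ?thesis
    using W W' W'U a coordinate_closed res_closed[OF opens_open[OF W] W']
    by (intro psi_inj[OF W'U]) auto
qed

lemma frame_coordinate:
  assumes W: "W \<in> opens M U" and b: "b < m + n"
  shows "frame a W (coordinate W b) = (if a = b then \<one>\<^bsub>sec A W\<^esub> else \<zero>\<^bsub>sec A W\<^esub>)"
proof (rule psi_inj[OF W])
  interpret W: superalg "sec A W" "par A W" using superalg W .
  note c = coordinate_closed[OF W b]
  show "frame a W (coordinate W b) \<in> C W"
    using frame_hder[of a] hder_lin_field c W by (intro lf_closed[of "frame a" U]) auto
  show "(if a = b then \<one>\<^bsub>sec A W\<^esub> else \<zero>\<^bsub>sec A W\<^esub>) \<in> C W" by simp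
  show "\<psi> W (frame a W (coordinate W b)) = \<psi> W (if a = b then \<one>\<^bsub>sec A W\<^esub> else \<zero>\<^bsub>sec A W\<^esub>)"
    unfolding frame_def psi_chart_field[OF model_der_mfield W c(1)] c(2) mfield_mcoord[OF image_open(1)[OF W]]
    by (simp add: psi_one[OF W] psi_zero[OF W])
qed

text \<open>Near the point with image y, shrink to a set whose image is a cube centred at y and
  conjugate D by the chart. \<open>derivation_vanishes\<close> gives the value at y, and as y is
  arbitrary, all coefficients are 0 everywhere.\<close>

lemma hder_eq_zero:
  assumes W: "W \<in> opens M U" and D: "D \<in> hder M A W p"
    and kill: "\<And>W' a. W' \<in> opens M W \<Longrightarrow> a < m + n \<Longrightarrow> D W' (coordinate W' a) = \<zero>\<^bsub>sec A W'\<^esub>"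
  shows "D = vf_zero M A W"
proof (rule lf_eqI)
  show Dl: "D \<in> lin_field W" using D hder_lin_field by auto
  show "vf_zero M A W \<in> lin_field W" by (rule lf_vf_zero)
  fix W' s assume W': "W' \<in> opens M W" and s: "s \<in> C W'"
  have W'U: "W' \<in> opens M U" using opens_trans[OF W W'] .
  interpret W': superalg "sec A W'" "par A W'" using superalg W' .
  have Ds: "D W' s \<in> C W'" using lf_closed[OF Dl W' s] .
  have "\<psi> W' (D W' s) K y = 0" for K y
  proof (cases "y \<in> \<phi> ` W'")
    case False
    then show ?thesis using psi_closed[OF W'U Ds] by (simp add: model_carrier_iff)
  next
    case True
    have o: "openin (Euclidean_space m) (\<phi> ` W')" using image_open(1)[OF W'U] .
    then have y: "y \<in> topspace (Euclidean_space m)" using True openin_subset by blast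
    obtain \<epsilon> where \<epsilon>: "\<epsilon> > 0" "cube m y \<epsilon> \<subseteq> \<phi> ` W'"
      using cube_subset[OF o True] .
    \<comment> \<open>The cube depends on y, because the model argument controls a derivation only
      at the centre of its cube.\<close>
    obtain X where X: "X \<in> opens M W'" "\<phi> ` X = cube m y \<epsilon>"
      using preimage_open(1)[OF W'U openin_cube \<epsilon>(2)] .
    have XW: "X \<in> opens M W" using opens_trans[OF W' X(1)] .
    have XU: "X \<in> opens M U" using opens_trans[OF W'U X(1)] .
    interpret X: superalg "sec A X" "par A X" using superalg XU .
    have yX: "y \<in> \<phi> ` X" using center_mem_cube[OF y \<epsilon>(1)] X by simp
    define d where "d f = \<psi> X (D X (psi_inv X f))" for f
    note cl = lf_closed[OF Dl XW] psi_closed[OF XU] psi_inv_closed[OF XU] psi_psi_inv[OF XU] psi_inv_psi[OF XU]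
    have inv: "psi_inv X (\<psi> X t) = t" if "t \<in> C X" for t using that XU by simp
    have rs: "res A W' X s \<in> C X" using res_closed[OF opens_open[OF W'] X(1) s] .
    have "d (\<psi> X (res A W' X s)) K y = 0"
    proof (rule derivation_vanishes[OF \<epsilon>(1) y, of n d p])
      show "\<psi> X (res A W' X s) \<in> model_carrier m n (cube m y \<epsilon>)"
        using cl(2)[OF rs] X by simp
      fix f assume "f \<in> model_carrier m n (cube m y \<epsilon>)"
      then have f: "f \<in> model_carrier m n (\<phi> ` X)" using X by simp
      show "d f \<in> model_carrier m n (cube m y \<epsilon>)"
        using cl f X unfolding d_def by metis
      show "d (\<lambda>I x. c * f I x) = (\<lambda>I x. c * d f I x)" for c
      proof -
        have "(\<lambda>I x. c * f I x) = \<psi> X (c \<odot>\<^bsub>sec A X\<^esub> psi_inv X f)"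
          using f cl(3)[OF f] by (simp add: psi_smult[OF XU] cl(4))
        then have "d (\<lambda>I x. c * f I x) = \<psi> X (D X (c \<odot>\<^bsub>sec A X\<^esub> psi_inv X f))"
          using inv cl(3)[OF f] by (simp add: d_def)
        then show ?thesis
          using cl(1,3) f by (simp add: d_def lf_smult[OF Dl XW] psi_smult[OF XU])
      qed
      fix g assume "g \<in> model_carrier m n (cube m y \<epsilon>)"
      then have g: "g \<in> model_carrier m n (\<phi> ` X)" using X by simp
      show "d (\<lambda>I x. f I x + g I x) = (\<lambda>I x. d f I x + d g I x)"
      proof -
        have "(\<lambda>I x. f I x + g I x) = \<psi> X (psi_inv X f \<oplus>\<^bsub>sec A X\<^esub> psi_inv X g)"
          using f g cl(3)[OF f] cl(3)[OF g] by (simp add: psi_add[OF XU] cl(4))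
        then have "d (\<lambda>I x. f I x + g I x) = \<psi> X (D X (psi_inv X f \<oplus>\<^bsub>sec A X\<^esub> psi_inv X g))"
          using inv cl(3)[OF f] cl(3)[OF g] by (simp add: d_def)
        then show ?thesis
          using cl(1,3) f g by (simp add: d_def lf_add[OF Dl XW] psi_add[OF XU])
      qed
    next
      fix q f g assume f': "f \<in> par (model_sheaf m n) (cube m y \<epsilon>) q"
        and "g \<in> model_carrier m n (cube m y \<epsilon>)"
      then have g: "g \<in> model_carrier m n (\<phi> ` X)" and f: "f \<in> model_carrier m n (\<phi> ` X)" using X by (auto simp: model_par_iff)
      have fp: "psi_inv X f \<in> par A X q"
        using f' f cl(3)[OF f] X by (intro psi_par_reflect[OF XU]) (simp_all add: cl(4))
      have "mmult f g = \<psi> X (psi_inv X f \<otimes>\<^bsub>sec A X\<^esub> psi_inv X g)"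
        using f g cl(3)[OF f] cl(3)[OF g] by (simp add: psi_mult[OF XU] cl(4))
      then have "d (mmult f g) = \<psi> X (D X (psi_inv X f \<otimes>\<^bsub>sec A X\<^esub> psi_inv X g))"
        using inv cl(3)[OF f] cl(3)[OF g] by (simp add: d_def)
      then show "d (mmult f g) = (\<lambda>K x. mmult (d f) g K x + psgn (p * q) * mmult f (d g) K x)"
        using cl(1,3) f g
        by (simp add: d_def hder_Leibniz[OF D XW fp] psi_add[OF XU] psi_mult[OF XU] psi_smult[OF XU] cl(4))
    next
      fix i assume i: "i < m"
      then show "d (mlift (cube m y \<epsilon>) {} (\<lambda>x. x i)) = (\<lambda>I x. 0)"
        using kill[OF XW, of i] X by (simp add: d_def coordinate_def mcoord_def psi_zero[OF XU])
    next
      fix j assume j: "j < n"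
      then show "d (mlift (cube m y \<epsilon>) {j} (\<lambda>x. 1)) = (\<lambda>I x. 0)"
        using kill[OF XW, of "m + j"] X by (simp add: d_def coordinate_def mcoord_def psi_zero[OF XU])
    qed
    then have "\<psi> X (D X (res A W' X s)) K y = 0" using inv[OF rs] by (simp add: d_def)
    \<comment> \<open>Compatibility with restriction moves the result from the small set X back to
      the section over W'.\<close>
    then have "\<psi> X (res A W' X (D W' s)) K y = 0" by (simp add: lf_res[OF Dl W' X(1) s])
    then show ?thesis using psi_res[OF W'U X(1) Ds] yX by (simp add: model_simps)
  qed
  then have "\<psi> W' (D W' s) = \<psi> W' \<zero>\<^bsub>sec A W'\<^esub>" by (auto simp: psi_zero[OF W'U])
  then have "D W' s = \<zero>\<^bsub>sec A W'\<^esub>" using Ds by (intro psi_inj[OF W'U]) auto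
  then show "D W' s = vf_zero M A W W' s" using W' s by simp
qed

text \<open>On a coordinate, the even and the odd part of D take values of opposite parities, so
  both vanish along with D. Coordinates restrict to coordinates, so this passes to all smaller open
  sets, as \<open>hder_eq_zero\<close> asks.\<close>

lemma vf_eq_zero:
  assumes W: "W \<in> opens M U" and D: "D \<in> vf_carrier M A W"
    and kill: "\<And>a. a < m + n \<Longrightarrow> D W (coordinate W a) = \<zero>\<^bsub>sec A W\<^esub>"
  shows "D = vf_zero M A W"
proof -
  obtain D0 D1 where D01: "D0 \<in> hder M A W 0" "D1 \<in> hder M A W (0 + 1)" "D = vf_add M A W D0 D1"
    using vf_carrierE[OF D] .
  have Dl: "D \<in> lin_field W" using D vf_carrier_lin_field by auto
  have Wo: "openin M W" using opens_open[OF W] .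
  have z: "D0 W' (coordinate W' a) = \<zero>\<^bsub>sec A W'\<^esub> \<and> D1 W' (coordinate W' a) = \<zero>\<^bsub>sec A W'\<^esub>"
    if W': "W' \<in> opens M W" and a: "a < m + n" for W' a
  proof -
    interpret W': superalg "sec A W'" "par A W'" using superalg W' .
    have W'U: "W' \<in> opens M U" using opens_trans[OF W W'] .
    note cp = coordinate_par[OF W'U a] and cC = coordinate_closed(1)[OF W'U a]
    have "D W' (coordinate W' a) = res A W W' (D W (coordinate W a))"
      using lf_res[OF Dl opens_self[OF Wo] W' coordinate_closed(1)[OF W a]] coordinate_res[OF W W' a] by simp
    then have "D W' (coordinate W' a) = \<zero>\<^bsub>sec A W'\<^esub>"
      using kill[OF a] res_zero[OF Wo W'] by simp
    then have s: "D0 W' (coordinate W' a) \<oplus>\<^bsub>sec A W'\<^esub> D1 W' (coordinate W' a) = \<zero>\<^bsub>sec A W'\<^esub>"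
      using D01(3) W' cC by simp
    have p: "D0 W' (coordinate W' a) \<in> par A W' (cparity m a)" "D1 W' (coordinate W' a) \<in> par A W' (cparity m a + 1)"
      using hder_par[OF D01(1) W' cp] hder_par[OF D01(2) W' cp] by (simp_all add: add.commute)
    show ?thesis using W'.par_sum_zero[OF p s] by simp
  qed
  have "D0 = vf_zero M A W" "D1 = vf_zero M A W"
    using hder_eq_zero[OF W D01(1)] hder_eq_zero[OF W D01(2)] z by auto
  then show ?thesis using D01(3) vf_add_zero[OF lf_vf_zero] by simp
qed

text \<open>The coefficient of the b-th frame field is the value of E on the b-th coordinate.
  Duality forces it, and E minus the resulting combination annihilates the coordinates.\<close>

theorem homogeneous_basis_frame: "homogeneous_basis M A U (m + n) (cparity m) frame"
  unfolding homogeneous_basis_def Der_simps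
proof (intro conjI ballI allI impI)
  show "frame a \<in> hder M A U (cparity m a)" for a by (rule frame_hder)
  fix W E assume W: "W \<in> opens M U" and E: "E \<in> vf_carrier M A W"
  interpret W: superalg "sec A W" "par A W" using superalg W .
  have Wo: "openin M W" using opens_open[OF W] .
  let ?e = "\<lambda>b. vf_res M W (frame b)"
  have e: "?e b \<in> vf_carrier M A W" for b
    using hder_vf_carrier[OF hder_vf_res[OF W frame_hder]] .
  have El: "E \<in> lin_field W" using E vf_carrier_lin_field by auto
  \<comment> \<open>Evaluation on the b-th coordinate singles out one coefficient. This gives
    uniqueness at once and also drives the existence part.\<close>
  have eval: "lincomb W (m + n) ?e c W (coordinate W b) = c b"
    if c: "\<And>b. b < m + n \<Longrightarrow> c b \<in> C W" and b: "b < m + n" for c b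
  proof -
    have "lincomb W (m + n) ?e c W (coordinate W b) =
       (\<Oplus>\<^bsub>sec A W\<^esub>a\<in>{..<m + n}. res A W W (c a) \<otimes>\<^bsub>sec A W\<^esub> ?e a W (coordinate W b))"
      by (rule lincomb_apply) (use Wo e c coordinate_closed(1)[OF W b] in auto)
    also have "\<dots> = (\<Oplus>\<^bsub>sec A W\<^esub>a\<in>{..<m + n}. if b = a then c a else \<zero>\<^bsub>sec A W\<^esub>)"
      by (rule W.finsum_cong') (use Wo c in \<open>auto simp: frame_coordinate[OF W b] res_self\<close>)
    also have "\<dots> = c b" using b c by (intro W.add.finprod_singleton) auto
    finally show ?thesis .
  qed
  show "\<exists>!c. is_coords M A W (m + n) frame E c"
    unfolding is_coords_lincomb
  proof (rule ex1I)
    fix c assume c: "c \<in> {..<m + n} \<rightarrow>\<^sub>E C W \<and> E = lincomb W (m + n) ?e c"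
    show "c = (\<lambda>b\<in>{..<m + n}. E W (coordinate W b))"
    proof (rule extensionalityI[of _ "{..<m + n}"])
      fix b assume "b \<in> {..<m + n}"
      then show "c b = (\<lambda>b\<in>{..<m + n}. E W (coordinate W b)) b"
        using eval[of c b] c by (auto simp: PiE_def Pi_def)
    qed (use c in \<open>auto simp: PiE_def\<close>)
  next
    let ?c = "\<lambda>b\<in>{..<m + n}. E W (coordinate W b)"
    have cC: "?c b \<in> C W" if "b < m + n" for b
      using lf_closed[OF El opens_self[OF Wo] coordinate_closed(1)[OF W that]] that by simp
    have L: "lincomb W (m + n) ?e ?c \<in> vf_carrier M A W"
      by (rule lincomb_closed) (use Wo e cC in auto)
    then have Ll: "lincomb W (m + n) ?e ?c \<in> lin_field W" using vf_carrier_lin_field by auto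
    have zero: "vf_add M A W E (rmult W (-1) (lincomb W (m + n) ?e ?c)) = vf_zero M A W"
    proof (rule vf_eq_zero[OF W vf_carrier_add[OF E vf_carrier_rmult[OF L]]])
      fix a assume a: "a < m + n"
      have "lincomb W (m + n) ?e ?c W (coordinate W a) = E W (coordinate W a)"
        using eval[of ?c a] cC a by simp
      then show "vf_add M A W E (rmult W (-1) (lincomb W (m + n) ?e ?c)) W (coordinate W a) = \<zero>\<^bsub>sec A W\<^esub>"
        using Wo coordinate_closed(1)[OF W a] cC[OF a] a by simp
    qed
    have "E = lincomb W (m + n) ?e ?c"
    proof (rule lf_eqI[OF El Ll])
      fix X f assume X: "X \<in> opens M W" and f: "f \<in> C X"
      interpret X: superalg "sec A X" "par A X" using superalg X .
      let ?l = "lincomb W (m + n) ?e ?c X f"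
      have C: "E X f \<in> C X" "?l \<in> C X" using lf_closed[OF El X f] lf_closed[OF Ll X f] .
      have "vf_add M A W E (rmult W (-1) (lincomb W (m + n) ?e ?c)) X f = \<zero>\<^bsub>sec A X\<^esub>"
        using zero X f by simp
      then have "E X f \<oplus>\<^bsub>sec A X\<^esub> (\<ominus>\<^bsub>sec A X\<^esub> ?l) = \<zero>\<^bsub>sec A X\<^esub>"
        using X f C by (simp add: X.minus_conv)
      then show "E X f = ?l" using C X.minus_equality[of "E X f" "\<ominus>\<^bsub>sec A X\<^esub> ?l"] by simp
    qed
    then show "?c \<in> {..<m + n} \<rightarrow>\<^sub>E C W \<and> E = lincomb W (m + n) ?e ?c"
      using cC by auto
  qed
qed

end

theorem proposition3p3:
  fixes M :: "'x topology" and A :: "('x, 'a) superalgebra_sheaf" and m n :: nat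
    and nabla :: "'x set \<Rightarrow> ('x, 'a) vfield \<Rightarrow> ('x, 'a) vfield \<Rightarrow> ('x, 'a) vfield"
  assumes "supermanifold m n M A"
    and "graded_connection M A nabla"
  shows "divergence_operator M A (div_connection M A nabla)"
proof -
  interpret superalg_sheaf M A
    using assms(1) by unfold_locales (simp add: supermanifold_def)
  interpret graded_conn_local_basis M A nabla
  proof unfold_locales
    show "graded_connection M A nabla" by fact
    fix x assume x: "x \<in> topspace M"
    then obtain U V \<phi> \<psi> where c: "openin M U" "x \<in> U" "openin (Euclidean_space m) V"
       "homeomorphic_map (subtopology M U) (subtopology (Euclidean_space m) V) \<phi>"
       "\<forall>W. openin M W \<and> W \<subseteq> U \<longrightarrow>
          superalgebra_hom (sec A W) (par A W)
            (sec (model_sheaf m n) (\<phi> ` W)) (par (model_sheaf m n) (\<phi> ` W)) (\<psi> W) \<and>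
          bij_betw (\<psi> W) (carrier (sec A W)) (carrier (sec (model_sheaf m n) (\<phi> ` W)))"
       "\<forall>W W'. openin M W \<and> openin M W' \<and> W' \<subseteq> W \<and> W \<subseteq> U \<longrightarrow>
          (\<forall>s\<in>carrier (sec A W).
             \<psi> W' (res A W W' s) = res (model_sheaf m n) (\<phi> ` W) (\<phi> ` W') (\<psi> W s))"
      using assms(1)[unfolded supermanifold_def, THEN conjunct2, THEN conjunct2, THEN conjunct2, THEN bspec, OF x]
      by (elim exE conjE) (rule that)
    interpret supermanifold_chart M A m n U V \<phi> \<psi>
      by unfold_locales (use c in \<open>auto simp: opens_def\<close>)
    show "\<exists>V k p e. openin M V \<and> x \<in> V \<and> homogeneous_basis M A V k p e"
      using c(1,2) homogeneous_basis_frame by blast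
  qed
  show ?thesis by (rule divergence_operator_div_connection)
qed

end
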